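(* Let $\mathcal{D}=(D,<,\approx)$ be a constraint system in which $D$ is an infinite set, $<$ is a strict total order on $D$, $\approx$ is equality, and $\mathcal{D}$ is dense and open. Then the satisfiability problem for $\mathrm{CLRV}^{\mathrm{XF}}(\mathcal{D})$ is decidable: there is an algorithm which, given a $\mathrm{CLRV}^{\mathrm{XF}}(\mathcal{D})$ formula $\phi$, decides whether there is a model $\sigma$ with $\sigma,0\models\phi$. In particular, satisfiability for $\mathrm{CLRV}^{\mathrm{XF}}((\mathbb{R},<,\approx))$ is decidable.
   Context: $\mathcal{D}$ is dense if for all $d<d''$ in $D$ there is $d'$ with $d<d'<d''$. It is open if for every $d'\in D$ there are $d,d''\in D$ with $d<d'<d''$. The set of variables is $V=V_{\mathrm{local}}\uplus V_{\mathrm{remote}}$, a disjoint union of local and remote variables. $\mathrm{CLRV}^{\mathrm{XF}}(\mathcal{D})$ formulas are given by the grammar $\phi ::= x_{loc}\approx \mathbf{X}^i y_{loc} \mid x_{loc}< \mathbf{X}^i y_{loc} \mid x_{rem}\approx \mathbf{X}^i y_{rem} \mid x_{rem}\approx \mathbf{XF}\, y_{rem} \mid \phi\wedge\phi \mid \neg\phi \mid \mathbf{X}\phi \mid \phi\mathbf{U}\phi \mid \mathbf{X}^{-1}\phi \mid \phi\mathbf{S}\phi$. Here $x_{loc},y_{loc}\in V_{\mathrm{local}}$, $x_{rem},y_{rem}\in V_{\mathrm{remote}}$ and $i\in\mathbb{N}$. A model is an infinite sequence $\sigma=\sigma(0)\sigma(1)\cdots$ of maps $V\to D$. The satisfaction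 relation at position $i\ge 0$ is as follows. - $\sigma,i\models x\approx\mathbf{X}^j y$ iff $\sigma(i)(x)=\sigma(i+j)(y)$. - $\sigma,i\models x<\mathbf{X}^j y$ iff $\sigma(i)(x)<\sigma(i+j)(y)$. - $\sigma,i\models x\approx\mathbf{XF}y$ iff there is $j>i$ with $\sigma(i)(x)=\sigma(j)(y)$. - Boolean connectives are as usual. - $\sigma,i\models\mathbf{X}\phi$ iff $\sigma,i+1\models\phi$. - $\sigma,i\models\phi\mathbf{U}\phi'$ iff there is $j\ge i$ with $\sigma,j\models\phi'$ and $\sigma,l\models\phi$ for all $i\le l<j$. - $\sigma,i\models\mathbf{X}^{-1}\phi$ iff $i\ge1$ and $\sigma,i-1\models\phi$. - $\sigma,i\models\phi\mathbf{S}\phi'$ iff there is $j\le i$ with $\sigma,j\models\phi'$ and $\sigma,l\models\phi$ for all $j<l\le i$. $\phi$ is satisfiable iff some model $\sigma$ has $\sigma,0\models\phi$. *)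

theory Defs
  imports Complex_Main "HOL-Library.Nat_Bijection"
begin

text \<open>Variables: V = V_local disjoint-union V_remote, each countably infinite (indexed by nat).\<close>
datatype var = Loc nat | Rem nat

text \<open>Formulas. Atoms take variable indices (local resp. remote) so that the
grammar's sort restrictions are enforced syntactically.\<close>
datatype form =
    EqL nat nat nat      (* x_loc \<approx> X^i y_loc : EqL x i y *)
  | LtL nat nat nat      (* x_loc < X^i y_loc  : LtL x i y *)
  | EqR nat nat nat      (* x_rem \<approx> X^i y_rem : EqR x i y *)
  | EqXF nat nat         (* x_rem \<approx> XF y_rem  : EqXF x y *)
  | And form form
  | Neg form
  | Next form
  | Until form form
  | Prev form
  | Since form form

fun holds :: "('d \<Rightarrow> 'd \<Rightarrow> bool) \<Rightarrow> (nat \<Rightarrow> var \<Rightarrow> 'd) \<Rightarrow> nat \<Rightarrow> form \<Rightarrow> bool" where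
  "holds lt \<sigma> i (EqL x j y) = (\<sigma> i (Loc x) = \<sigma> (i + j) (Loc y))"
| "holds lt \<sigma> i (LtL x j y) = lt (\<sigma> i (Loc x)) (\<sigma> (i + j) (Loc y))"
| "holds lt \<sigma> i (EqR x j y) = (\<sigma> i (Rem x) = \<sigma> (i + j) (Rem y))"
| "holds lt \<sigma> i (EqXF x y) = (\<exists>j>i. \<sigma> i (Rem x) = \<sigma> j (Rem y))"
| "holds lt \<sigma> i (And \<phi> \<psi>) = (holds lt \<sigma> i \<phi> \<and> holds lt \<sigma> i \<psi>)"
| "holds lt \<sigma> i (Neg \<phi>) = (\<not> holds lt \<sigma> i \<phi>)"
| "holds lt \<sigma> i (Next \<phi>) = holds lt \<sigma> (Suc i) \<phi>"
| "holds lt \<sigma> i (Until \<phi> \<psi>) =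
     (\<exists>j\<ge>i. holds lt \<sigma> j \<psi> \<and> (\<forall>l. i \<le> l \<and> l < j \<longrightarrow> holds lt \<sigma> l \<phi>))"
| "holds lt \<sigma> i (Prev \<phi>) = (i \<ge> 1 \<and> holds lt \<sigma> (i - 1) \<phi>)"
| "holds lt \<sigma> i (Since \<phi> \<psi>) =
     (\<exists>j\<le>i. holds lt \<sigma> j \<psi> \<and> (\<forall>l. j < l \<and> l \<le> i \<longrightarrow> holds lt \<sigma> l \<phi>))"

definition satisfiable :: "('d \<Rightarrow> 'd \<Rightarrow> bool) \<Rightarrow> form \<Rightarrow> bool" where
  "satisfiable lt \<phi> \<longleftrightarrow> (\<exists>\<sigma> :: nat \<Rightarrow> var \<Rightarrow> 'd. holds lt \<sigma> 0 \<phi>)"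

definition strict_total_order :: "('d \<Rightarrow> 'd \<Rightarrow> bool) \<Rightarrow> bool" where
  "strict_total_order lt \<longleftrightarrow>
     (\<forall>x. \<not> lt x x) \<and> (\<forall>x y z. lt x y \<and> lt y z \<longrightarrow> lt x z) \<and>
     (\<forall>x y. x \<noteq> y \<longrightarrow> lt x y \<or> lt y x)"

definition dense_rel :: "('d \<Rightarrow> 'd \<Rightarrow> bool) \<Rightarrow> bool" where
  "dense_rel lt \<longleftrightarrow> (\<forall>d d''. lt d d'' \<longrightarrow> (\<exists>d'. lt d d' \<and> lt d' d''))"

definition open_rel :: "('d \<Rightarrow> 'd \<Rightarrow> bool) \<Rightarrow> bool" where
  "open_rel lt \<longleftrightarrow> (\<forall>d'. \<exists>d d''. lt d d' \<and> lt d' d'')"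

datatype recf = Z | S | Id nat | Cn recf "recf list" | Pr recf recf | Mn recf

inductive eval_recf :: "recf \<Rightarrow> nat list \<Rightarrow> nat \<Rightarrow> bool" where
  ev_Z: "eval_recf Z xs 0"
| ev_S: "eval_recf S (x # xs) (Suc x)"
| ev_Id: "i < length xs \<Longrightarrow> eval_recf (Id i) xs (xs ! i)"
| ev_Cn: "list_all2 (\<lambda>g y. eval_recf g xs y) gs ys \<Longrightarrow> eval_recf f ys z \<Longrightarrow>
          eval_recf (Cn f gs) xs z"
| ev_Pr0: "eval_recf f xs y \<Longrightarrow> eval_recf (Pr f g) (0 # xs) y"
| ev_PrS: "eval_recf (Pr f g) (x # xs) y \<Longrightarrow> eval_recf g (x # y # xs) z \<Longrightarrow>
           eval_recf (Pr f g) (Suc x # xs) z"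
| ev_Mn: "eval_recf f (z # xs) 0 \<Longrightarrow> (\<forall>y<z. \<exists>v. eval_recf f (y # xs) v \<and> v > 0) \<Longrightarrow>
          eval_recf (Mn f) xs z"

fun enc :: "form \<Rightarrow> nat" where
  "enc (EqL x i y) = prod_encode (0, prod_encode (x, prod_encode (i, y)))"
| "enc (LtL x i y) = prod_encode (1, prod_encode (x, prod_encode (i, y)))"
| "enc (EqR x i y) = prod_encode (2, prod_encode (x, prod_encode (i, y)))"
| "enc (EqXF x y) = prod_encode (3, prod_encode (x, y))"
| "enc (And \<phi> \<psi>) = prod_encode (4, prod_encode (enc \<phi>, enc \<psi>))"
| "enc (Neg \<phi>) = prod_encode (5, enc \<phi>)"
| "enc (Next \<phi>) = prod_encode (6, enc \<phi>)"
| "enc (Until \<phi> \<psi>) = prod_encode (7, prod_encode (enc \<phi>, enc \<psi>))"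
| "enc (Prev \<phi>) = prod_encode (8, enc \<phi>)"
| "enc (Since \<phi> \<psi>) = prod_encode (9, prod_encode (enc \<phi>, enc \<psi>))"

definition decidable_form :: "(form \<Rightarrow> bool) \<Rightarrow> bool" where
  "decidable_form P \<longleftrightarrow>
     (\<exists>f. \<forall>\<phi>. eval_recf f [enc \<phi>] (if P \<phi> then 1 else 0))"

end

theory Submission
  imports Defs "HOL-Library.Infinite_Set"
begin

text \<open>
  Let \<open>e\<close> be the code of the formula; it bounds all variables, offsets and subformula codes.
  A model is abstracted to the sequence of its states, a state being a finite description of
  positions \<open>t, \<dots>, t + e\<close>: the true subformulas, the order of the local values, the
  equalities of the remote values, and for every remote value the variables at which it recurs.
  In a dense open order every consistent sequence of local order types is realised, so only the
  remote values matter. The occurrences of a value split into segments in which consecutive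
  occurrences are at most \<open>e\<close> apart. A value that leaves the window deposits a token, labelled with
  the set \<open>X\<close> of the variables at which it will still occur; a class of equal values that enters the
  window may consume a token labelled with the set of variables occurring in it now or later.
  A sequence of states comes from a model iff deposits can be matched with later consumptions so
  that every promise is kept. For a label with infinitely many consumers this
  only needs suitable consumers to recur, and for all other labels the number of tokens must
  eventually stay zero.

  Hence satisfiability is the existence of a lasso, that is, reachability of a target in a counter
  system whose steps remain possible when tokens are removed. A path witnesses reachability; a
  finite basis, given by Dickson's lemma, of an upward closed invariant witnesses unreachability.
  Searching for both kinds of witness decides satisfiability.
\<close>

section \<open>Computable functions\<close>

text \<open>Offsets in the atoms are at most \<open>e\<close>, so remote values are compared
  directly only within a window of \<open>e + 1\<close> positions. Across a longer absence the
  identity of a value is visible only through \<open>XF\<close>, which sees just the set of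
  variables at which it recurs. Hence absent values with equal labels are interchangeable, and
  counting them suffices. The obstacle is liveness: a value handed from segment to segment might
  keep its label forever and never reach a promised variable. Labels can only shrink along such a
  chain, so only a constant label is dangerous. With finitely many consumers it cannot stay constant
  forever; with infinitely many, the freedom to permute tokens lets each promised variable be served
  in turn. An entering class may also carry a fresh value, so consumption is never forced; but fewer
  tokens are never worse, so every entering class may consume a token if there is one. Truncated
  subtraction expresses exactly this. The label 0 promises nothing, so its tokens are
  ignored.\<close>

definition recn :: "nat \<Rightarrow> (nat list \<Rightarrow> nat) \<Rightarrow> bool" where
  "recn n F \<longleftrightarrow> (\<exists>r. \<forall>xs. length xs = n \<longrightarrow> eval_recf r xs (F xs))"

lemma recn_cong: "recn n F \<Longrightarrow> (\<And>xs. length xs = n \<Longrightarrow> F xs = G xs) \<Longrightarrow> recn n G"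
  unfolding recn_def by fastforce

lemma recn_comp:
  assumes "recn (length Gs) F" and "\<And>G. G \<in> set Gs \<Longrightarrow> recn n G"
  shows "recn n (\<lambda>xs. F (map (\<lambda>G. G xs) Gs))"
proof -
  obtain r where r: "\<And>xs. length xs = length Gs \<Longrightarrow> eval_recf r xs (F xs)"
    using assms(1) unfolding recn_def by blast
  have "\<forall>G\<in>set Gs. \<exists>r. \<forall>xs. length xs = n \<longrightarrow> eval_recf r xs (G xs)"
    using assms(2) unfolding recn_def by blast
  then obtain c where c: "\<forall>G\<in>set Gs. \<forall>xs. length xs = n \<longrightarrow> eval_recf (c G) xs (G xs)"
    by metis
  have "eval_recf (Cn r (map c Gs)) xs (F (map (\<lambda>G. G xs) Gs))" if "length xs = n" for xs
  proof (rule ev_Cn)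
    show "list_all2 (\<lambda>g y. eval_recf g xs y) (map c Gs) (map (\<lambda>G. G xs) Gs)"
      using c that by (auto simp: list_all2_conv_all_nth)
    show "eval_recf r (map (\<lambda>G. G xs) Gs) (F (map (\<lambda>G. G xs) Gs))"
      by (rule r) simp
  qed
  then show ?thesis unfolding recn_def by blast
qed

lemma recn_nth: "i < n \<Longrightarrow> recn n (\<lambda>xs. xs ! i)"
  unfolding recn_def by (rule exI[of _ "Id i"]) (auto intro: ev_Id)

definition rec1 :: "(nat \<Rightarrow> nat) \<Rightarrow> bool" where
  "rec1 f \<longleftrightarrow> recn 1 (\<lambda>xs. f (xs ! 0))"

lemma rec1_eval:
  assumes "rec1 f"
  shows "\<exists>r. \<forall>e. eval_recf r [e] (f e)"
proof -
  obtain r where "\<And>xs. length xs = 1 \<Longrightarrow> eval_recf r xs (f (xs ! 0))"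
    using assms unfolding rec1_def recn_def by blast
  from this[of "[_]"] have "\<And>e. eval_recf r [e] (f e)" by simp
  then show ?thesis by blast
qed

definition rec2 :: "(nat \<Rightarrow> nat \<Rightarrow> nat) \<Rightarrow> bool" where
  "rec2 f \<longleftrightarrow> recn 2 (\<lambda>xs. f (xs ! 0) (xs ! 1))"

lemma recn_rec1: "rec1 f \<Longrightarrow> recn n g \<Longrightarrow> recn n (\<lambda>xs. f (g xs))"
  unfolding rec1_def using recn_comp[of "[g]" "\<lambda>xs. f (xs ! 0)" n] by simp

lemma recn_rec2: "rec2 f \<Longrightarrow> recn n g \<Longrightarrow> recn n h \<Longrightarrow> recn n (\<lambda>xs. f (g xs) (h xs))"
proof -
  assume f: "rec2 f" and "recn n g" "recn n h"
  then have "recn n G" if "G \<in> set [g, h]" for G using that by auto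
  moreover have "recn (length [g, h]) (\<lambda>xs. f (xs ! 0) (xs ! 1))"
    using f by (simp add: rec2_def numeral_2_eq_2)
  ultimately show ?thesis using recn_comp[of "[g, h]" "\<lambda>xs. f (xs ! 0) (xs ! 1)" n] by simp
qed

lemma rec1_rf2: "rec2 f \<Longrightarrow> rec1 g \<Longrightarrow> rec1 h \<Longrightarrow> rec1 (\<lambda>e. f (g e) (h e))"
  unfolding rec1_def by (rule recn_rec2)

lemma rec1_comp: "rec1 f \<Longrightarrow> rec1 g \<Longrightarrow> rec1 (\<lambda>e. f (g e))"
  unfolding rec1_def[of g] rec1_def[of "\<lambda>e. f (g e)"] by (rule recn_rec1)

lemma rec1_id: "rec1 (\<lambda>e. e)"
  unfolding rec1_def by (rule recn_nth) simp

lemma rec1_Suc0: "rec1 Suc"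
  unfolding rec1_def recn_def
  by (rule exI[of _ S]) (auto simp: length_Suc_conv intro: ev_S)

lemma recn_const: "recn n (\<lambda>_. c)"
proof (induction c)
  case 0 show ?case unfolding recn_def by (rule exI[of _ Z]) (auto intro: ev_Z)
next
  case (Suc c) show ?case by (rule recn_rec1[OF rec1_Suc0 Suc])
qed

lemma rec1_const: "rec1 (\<lambda>_. c)"
  unfolding rec1_def by (rule recn_const)

lemma recn_Pr:
  assumes "recn n f" and "recn (Suc (Suc n)) g"
  shows "recn (Suc n) (\<lambda>xs. rec_nat (f (tl xs)) (\<lambda>k y. g (k # y # tl xs)) (hd xs))"
proof -
  obtain f' where f': "\<And>xs. length xs = n \<Longrightarrow> eval_recf f' xs (f xs)"
    using assms(1) unfolding recn_def by blast
  obtain rg where rg: "\<And>xs. length xs = Suc (Suc n) \<Longrightarrow> eval_recf rg xs (g xs)"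
    using assms(2) unfolding recn_def by blast
  have "eval_recf (Pr f' rg) (k # xs) (rec_nat (f xs) (\<lambda>k y. g (k # y # xs)) k)"
    if "length xs = n" for xs k
  proof (induction k)
    case 0 show ?case using f'[OF that] by (auto intro: ev_Pr0)
  next
    case (Suc k)
    show ?case using ev_PrS[OF Suc rg] that by simp
  qed
  then have "eval_recf (Pr f' rg) xs (rec_nat (f (tl xs)) (\<lambda>k y. g (k # y # tl xs)) (hd xs))"
    if "length xs = Suc n" for xs
    using that by (cases xs) auto
  then show ?thesis unfolding recn_def by blast
qed

text \<open>Since \<open>f\<close> is total, the positive values below the least zero that
  \<open>ev_Mn\<close> demands are available.\<close>

lemma recn_Mn:
  assumes "recn (Suc n) f" and "\<And>xs. length xs = n \<Longrightarrow> \<exists>z. f (z # xs) = 0"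
  shows "recn n (\<lambda>xs. LEAST z. f (z # xs) = 0)"
proof -
  obtain r where r: "\<And>xs. length xs = Suc n \<Longrightarrow> eval_recf r xs (f xs)"
    using assms(1) unfolding recn_def by blast
  have "eval_recf (Mn r) xs (LEAST z. f (z # xs) = 0)" if l: "length xs = n" for xs
  proof (rule ev_Mn)
    let ?z = "LEAST z. f (z # xs) = 0"
    have "f (?z # xs) = 0" using assms(2)[OF l] by (metis (mono_tags, lifting) LeastI)
    then show "eval_recf r (?z # xs) 0" using r[of "?z # xs"] l by simp
    show "\<forall>y<?z. \<exists>v. eval_recf r (y # xs) v \<and> v > 0"
      using r l not_less_Least by (metis (mono_tags, lifting) length_Cons neq0_conv)
  qed
  then show ?thesis unfolding recn_def by blast
qed

lemma rec2_Pr: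
  assumes "rec1 f" and "recn 3 (\<lambda>xs. g (xs ! 0) (xs ! 1) (xs ! 2))"
  shows "rec2 (\<lambda>k x. rec_nat (f x) (\<lambda>k y. g k y x) k)"
proof -
  have "recn (Suc 1) (\<lambda>xs. rec_nat (f (tl xs ! 0))
    (\<lambda>k y. g ((k # y # tl xs) ! 0) ((k # y # tl xs) ! 1) ((k # y # tl xs) ! 2)) (hd xs))"
    by (rule recn_Pr) (use assms in \<open>simp_all add: rec1_def numeral_3_eq_3\<close>)
  moreover have "2 = Suc 1" by simp
  ultimately show ?thesis unfolding rec2_def
    by (auto simp: length_Suc_conv numeral_2_eq_2 elim!: recn_cong)
qed

section \<open>Arithmetic functions\<close>

lemma rec2_swap: "rec2 f \<Longrightarrow> rec2 (\<lambda>x y. f y x)"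
  unfolding rec2_def[of "\<lambda>x y. f y x"] by (rule recn_rec2) (auto intro: recn_nth)

lemma rec2_cong: "rec2 f \<Longrightarrow> (\<And>x y. f x y = g x y) \<Longrightarrow> rec2 g"
  by (metis ext)

lemma rec2_add: "rec2 (+)"
  by (rule rec2_cong[OF rec2_Pr[OF rec1_id, of "\<lambda>k y x. Suc y"]])
     (auto intro!: recn_rec1[OF rec1_Suc0] recn_nth, rename_tac x y, induct_tac x, auto)

lemma rec2_mult: "rec2 (*)"
  by (rule rec2_cong[OF rec2_Pr[OF rec1_const[of 0], of "\<lambda>k y x. y + x"]])
     (auto intro!: recn_rec2[OF rec2_add] recn_nth, rename_tac x y, induct_tac x, auto)

text \<open>The recursor hands its counter to the step function; returning that counter gives the
  predecessor.\<close>

lemma rec1_pred: "rec1 (\<lambda>x. x - 1)"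
proof -
  have "rec2 (\<lambda>k x. rec_nat 0 (\<lambda>k y. k) k)"
    by (rule rec2_Pr[OF rec1_const, of "\<lambda>k y x. k"]) (auto intro: recn_nth)
  moreover have "rec_nat 0 (\<lambda>k y. k) k = k - 1" for k :: nat by (cases k) auto
  ultimately have "rec2 (\<lambda>k x. k - 1)" by simp
  from rec1_rf2[OF this rec1_id rec1_id] show ?thesis .
qed

lemma rec2_monus: "rec2 (-)"
proof -
  have "rec2 (\<lambda>k x. x - k)"
    by (rule rec2_cong[OF rec2_Pr[OF rec1_id, of "\<lambda>k y x. y - 1"]])
       (auto intro!: recn_rec1[OF rec1_pred, simplified] recn_nth, rename_tac x y, induct_tac x, auto)
  from rec2_swap[OF this] show ?thesis .
qed

lemma rec1_triangle: "rec1 triangle"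
proof -
  have "rec2 (\<lambda>k x. rec_nat 0 (\<lambda>k y. y + Suc k) k)"
    by (rule rec2_Pr[OF rec1_const, of "\<lambda>k y x. y + Suc k"])
       (auto intro!: recn_rec2[OF rec2_add] recn_rec1[OF rec1_Suc0] recn_nth simp del: add_Suc_right)
  moreover have "rec_nat 0 (\<lambda>k y. y + Suc k) k = triangle k" for k by (induction k) auto
  ultimately have "rec2 (\<lambda>k x. triangle k)" by simp
  from rec1_rf2[OF this rec1_id rec1_id] show ?thesis .
qed

section \<open>Cantor pairing and its projections\<close>

abbreviation "pr x y \<equiv> prod_encode (x, y)"
abbreviation "p1 z \<equiv> fst (prod_decode z)"
abbreviation "p2 z \<equiv> snd (prod_decode z)"

lemmas rec1_add = rec1_rf2[OF rec2_add]
lemmas rec1_mult = rec1_rf2[OF rec2_mult]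
lemmas rec1_monus = rec1_rf2[OF rec2_monus]
lemmas rec1_Suc = rec1_comp[OF rec1_Suc0]

lemma rec2_pr: "rec2 pr"
  unfolding rec2_def prod_encode_def
  by (auto intro!: recn_rec2[OF rec2_add] recn_rec1[OF rec1_triangle] recn_nth)

lemmas rec1_pr = rec1_rf2[OF rec2_pr]

lemma triangle_mono: "m \<le> n \<Longrightarrow> triangle m \<le> triangle n"
  unfolding triangle_def by (intro div_le_mono mult_le_mono) auto

text \<open>\<open>pr a b\<close> is \<open>triangle (a + b) + a\<close>, so the diagonal
  \<open>a + b\<close> is the least \<open>s\<close> for which the next triangle number exceeds the
  code. The truncated difference turns this into a zero for minimisation.\<close>

lemma Least_triangle: "(LEAST s. Suc (pr a b) - triangle (Suc s) = 0) = a + b"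
proof (rule Least_equality)
  show "Suc (pr a b) - triangle (Suc (a + b)) = 0" by (simp add: prod_encode_def)
  show "a + b \<le> s" if "Suc (pr a b) - triangle (Suc s) = 0" for s
  proof (rule ccontr)
    assume "\<not> a + b \<le> s"
    then have "triangle (Suc s) \<le> triangle (a + b)" by (intro triangle_mono) simp
    then show False using that by (simp add: prod_encode_def)
  qed
qed

lemma rec1_diag: "rec1 (\<lambda>z. p1 z + p2 z)"
proof -
  have "recn 1 (\<lambda>xs. LEAST s. (\<lambda>ys. Suc (ys ! 1) - triangle (Suc (ys ! 0))) (s # xs) = 0)"
  proof (rule recn_Mn)
    show "recn (Suc 1) (\<lambda>ys. Suc (ys ! 1) - triangle (Suc (ys ! 0)))"
      by (intro recn_rec2[OF rec2_monus] recn_rec1[OF rec1_triangle] recn_rec1[OF rec1_Suc0] recn_nth) auto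
    fix xs :: "nat list"
    have "n \<le> triangle n" for n by (induction n) auto
    from this[of "xs ! 0"]
    have "Suc (xs ! 0) - triangle (Suc (xs ! 0)) = 0" by simp
    then show "\<exists>z. Suc ((z # xs) ! 1) - triangle (Suc ((z # xs) ! 0)) = 0"
      by (intro exI[of _ "xs ! 0"]) auto
  qed
  then have "rec1 (\<lambda>z. LEAST s. Suc z - triangle (Suc s) = 0)" by (simp add: rec1_def)
  moreover have "(LEAST s. Suc z - triangle (Suc s) = 0) = p1 z + p2 z" for z
    using Least_triangle[of "p1 z" "p2 z"] by simp
  ultimately show ?thesis by simp
qed

lemma rec1_p1_0: "rec1 p1"
proof -
  have "rec1 (\<lambda>z. z - triangle (p1 z + p2 z))"
    by (intro rec1_monus rec1_id rec1_comp[OF rec1_triangle] rec1_diag)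
  moreover have "z - triangle (p1 z + p2 z) = p1 z" for z
  proof -
    have "triangle (p1 z + p2 z) + p1 z = z"
      using prod_decode_inverse[of z] by (cases "prod_decode z") (simp add: prod_encode_def)
    then show ?thesis by linarith
  qed
  ultimately show ?thesis by simp
qed

lemma rec1_p2_0: "rec1 p2"
proof -
  have "rec1 (\<lambda>z. (p1 z + p2 z) - p1 z)" by (intro rec1_monus rec1_diag rec1_p1_0)
  then show ?thesis by simp
qed

lemmas rec1_p1 = rec1_comp[OF rec1_p1_0]
lemmas rec1_p2 = rec1_comp[OF rec1_p2_0]

section \<open>Decidable predicates and bounded quantifiers\<close>

definition recp :: "(nat \<Rightarrow> bool) \<Rightarrow> bool" where
  "recp P \<longleftrightarrow> rec1 (\<lambda>x. of_bool (P x))"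

lemma recp_comp: "recp P \<Longrightarrow> rec1 f \<Longrightarrow> recp (\<lambda>x. P (f x))"
  unfolding recp_def by (rule rec1_comp[of "\<lambda>x. of_bool (P x)"])

lemma recp_const: "recp (\<lambda>_. c)"
  unfolding recp_def by (rule rec1_const)

lemma recp_not: "recp P \<Longrightarrow> recp (\<lambda>x. \<not> P x)"
proof -
  assume "recp P"
  then have "rec1 (\<lambda>x. 1 - of_bool (P x))" unfolding recp_def by (intro rec1_monus rec1_const)
  moreover have "(1::nat) - of_bool b = of_bool (\<not> b)" for b by (cases b) auto
  ultimately show ?thesis unfolding recp_def by simp
qed

lemma recp_conj: "recp P \<Longrightarrow> recp Q \<Longrightarrow> recp (\<lambda>x. P x \<and> Q x)"
  unfolding recp_def of_bool_conj by (intro rec1_mult)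

lemma recp_disj:
  assumes "recp P" "recp Q"
  shows "recp (\<lambda>x. P x \<or> Q x)"
  using recp_not[OF recp_conj[OF recp_not[OF assms(1)] recp_not[OF assms(2)]]] by simp

lemma recp_imp:
  assumes "recp P" "recp Q"
  shows "recp (\<lambda>x. P x \<longrightarrow> Q x)"
  using recp_disj[OF recp_not[OF assms(1)] assms(2)] by simp

lemma recp_iff:
  assumes "recp P" "recp Q"
  shows "recp (\<lambda>x. P x \<longleftrightarrow> Q x)"
  using recp_conj[OF recp_imp[OF assms] recp_imp[OF assms(2,1)]] by (simp add: iff_conv_conj_imp)

lemma recp_le: "rec1 f \<Longrightarrow> rec1 g \<Longrightarrow> recp (\<lambda>x. f x \<le> g x)"
proof -
  assume "rec1 f" "rec1 g"
  then have "rec1 (\<lambda>x. 1 - (f x - g x))" by (intro rec1_monus rec1_const)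
  moreover have "1 - (f x - g x) = of_bool (f x \<le> g x)" for x by auto
  ultimately show ?thesis unfolding recp_def by simp
qed

lemma recp_less:
  assumes "rec1 f" "rec1 g"
  shows "recp (\<lambda>x. f x < g x)"
  using recp_not[OF recp_le[OF assms(2,1)]] by (simp add: not_le)

lemma recp_eq:
  assumes "rec1 f" "rec1 g"
  shows "recp (\<lambda>x. f x = g x)"
  using recp_conj[OF recp_le[OF assms] recp_le[OF assms(2,1)]] by (simp add: eq_iff)

lemma rec1_sum:
  assumes "rec1 (\<lambda>z. F (p1 z) (p2 z))" and "rec1 b"
  shows "rec1 (\<lambda>e. \<Sum>y<b e. F e y)"
proof -
  have "recn 3 (\<lambda>xs. xs ! 1 + (\<lambda>z. F (p1 z) (p2 z)) (pr (xs ! 2) (xs ! 0)))"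
    by (intro recn_rec2[OF rec2_add] recn_rec1[OF assms(1)] recn_rec2[OF rec2_pr] recn_nth) auto
  then have "rec2 (\<lambda>k e. rec_nat 0 (\<lambda>k s. s + F e k) k)"
    using rec2_Pr[OF rec1_const[of 0], of "\<lambda>k s e. s + F e k"] by simp
  moreover have "rec_nat 0 (\<lambda>k s. s + F e k) k = (\<Sum>y<k. F e y)" for e k
    by (induction k) auto
  ultimately have "rec2 (\<lambda>k e. \<Sum>y<k. F e y)" by simp
  from rec1_rf2[OF this assms(2) rec1_id] show ?thesis .
qed

lemma rec1_card:
  assumes "recp (\<lambda>z. P (p1 z) (p2 z))" and "rec1 b"
  shows "rec1 (\<lambda>e. card {y. y \<le> b e \<and> P e y})"
proof -
  have "rec1 (\<lambda>e. \<Sum>y<Suc (b e). of_bool (P e y))"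
    by (rule rec1_sum) (use assms rec1_Suc in \<open>auto simp: recp_def\<close>)
  moreover have "(\<Sum>y<Suc (b e). of_bool (P e y)) = card {y. y \<le> b e \<and> P e y}" for e
    by (subst sum_of_bool_eq) (auto intro!: arg_cong[where f = card])
  ultimately show ?thesis by simp
qed

lemma recp_ex_le:
  assumes "recp (\<lambda>z. P (p1 z) (p2 z))" and "rec1 b"
  shows "recp (\<lambda>e. \<exists>y. y \<le> b e \<and> P e y)"
proof -
  have "recp (\<lambda>e. 0 < card {y. y \<le> b e \<and> P e y})"
    by (intro recp_less rec1_const rec1_card assms)
  then show ?thesis by (simp add: card_gt_0_iff)
qed

lemma recp_ex_less:
  assumes "recp (\<lambda>z. P (p1 z) (p2 z))" and "rec1 b"
  shows "recp (\<lambda>e. \<exists>y. y < b e \<and> P e y)"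
proof -
  have "recp (\<lambda>e. \<exists>y. y \<le> b e \<and> (y < b e \<and> P e y))"
    by (intro recp_ex_le recp_conj recp_less rec1_p2 rec1_id rec1_comp[OF assms(2)] rec1_p1 assms)
  moreover have "(\<exists>y. y \<le> b e \<and> (y < b e \<and> P e y)) \<longleftrightarrow> (\<exists>y. y < b e \<and> P e y)" for e
    using less_imp_le by blast
  ultimately show ?thesis by simp
qed

lemma recp_all_le:
  assumes "recp (\<lambda>z. P (p1 z) (p2 z))" and "rec1 b"
  shows "recp (\<lambda>e. \<forall>y. y \<le> b e \<longrightarrow> P e y)"
  using recp_not[OF recp_ex_le[OF recp_not[OF assms(1)] assms(2)]] by simp

lemma recp_all_less:
  assumes "recp (\<lambda>z. P (p1 z) (p2 z))" and "rec1 b"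
  shows "recp (\<lambda>e. \<forall>y. y < b e \<longrightarrow> P e y)"
  using recp_not[OF recp_ex_less[OF recp_not[OF assms(1)] assms(2)]] by simp

section \<open>Iteration; finite sets and sequences as numbers\<close>

lemma rec1_funpow:
  assumes "rec1 g" "rec1 n" "rec1 x"
  shows "rec1 (\<lambda>e. (g ^^ n e) (x e))"
proof -
  have "rec2 (\<lambda>n x. rec_nat x (\<lambda>k y. g y) n)"
    by (rule rec2_Pr[OF rec1_id, of "\<lambda>k y x. g y"]) (auto intro!: recn_rec1[OF assms(1)] recn_nth)
  moreover have "rec_nat x (\<lambda>k y. g y) n = (g ^^ n) x" for n x by (induction n) auto
  ultimately have "rec2 (\<lambda>n x. (g ^^ n) x)" by simp
  from rec1_rf2[OF this assms(2,3)] show ?thesis .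
qed

lemma rec1_pow2:
  assumes "rec1 f"
  shows "rec1 (\<lambda>e. 2 ^ f e)"
proof -
  have "rec1 (\<lambda>e. ((\<lambda>x. 2 * x) ^^ f e) 1)" by (intro rec1_funpow rec1_mult rec1_const rec1_id assms)
  moreover have "((\<lambda>x. 2 * x) ^^ n) 1 = (2 :: nat) ^ n" for n by (induction n) auto
  ultimately show ?thesis by (simp del: One_nat_def)
qed

text \<open>Half of \<open>z\<close> is the number of positive even numbers up to \<open>z\<close>,
  hence a bounded sum.\<close>

lemma rec1_div2: "rec1 (\<lambda>x. x div 2)"
proof -
  have "rec1 (\<lambda>z. \<Sum>y<z. of_bool (2 * Suc y \<le> z))"
    by (intro rec1_sum rec1_id recp_le[unfolded recp_def] rec1_mult rec1_const rec1_Suc rec1_p1 rec1_p2)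
  moreover have "(\<Sum>y<z. of_bool (2 * Suc y \<le> z)) = z div 2" for z
  proof -
    have "(\<Sum>y<z. of_bool (2 * Suc y \<le> z)) = card {y. y < z \<and> 2 * Suc y \<le> z}"
      by (subst sum_of_bool_eq) (auto intro!: arg_cong[where f = card])
    also have "{y. y < z \<and> 2 * Suc y \<le> z} = {..<z div 2}" by auto
    finally show ?thesis by simp
  qed
  ultimately show ?thesis by simp
qed

abbreviation "mem z s \<equiv> z \<in> set_decode s"

text \<open>Membership is oddness after \<open>f e\<close> halvings. A witness of evenness is at
  most the number itself, so the quantifier is bounded.\<close>

lemma recp_mem:
  assumes "rec1 f" "rec1 g"
  shows "recp (\<lambda>e. mem (f e) (g e))"
proof -
  have 1: "((\<lambda>x. x div 2) ^^ n) z = z div 2 ^ n" for n z :: nat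
    by (induction n) (auto simp: div_mult2_eq[symmetric] mult.commute)
  have "recp (\<lambda>e. \<not> (\<exists>y. y \<le> g e \<and> ((\<lambda>x. x div 2) ^^ f e) (g e) = 2 * y))"
    by (intro recp_not recp_ex_le recp_eq rec1_funpow rec1_div2 rec1_comp[OF assms(1)] rec1_comp[OF assms(2)]
        rec1_p1 rec1_p2 rec1_mult rec1_const rec1_id)
  moreover have "\<not> (\<exists>y. y \<le> g e \<and> ((\<lambda>x. x div 2) ^^ f e) (g e) = 2 * y) \<longleftrightarrow> mem (f e) (g e)" for e
  proof -
    have "y \<le> g e" if "g e div 2 ^ f e = 2 * y" for y
      using that by (metis div_le_dividend le_trans mult_2 le_add1)
    then have "(\<exists>y. y \<le> g e \<and> g e div 2 ^ f e = 2 * y) \<longleftrightarrow> even (g e div 2 ^ f e)"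
      by (metis dvd_def)
    then show ?thesis by (simp add: 1 set_decode_def)
  qed
  ultimately show ?thesis by simp
qed

text \<open>\<open>list_encode\<close> codes a nonempty list as the successor of the pair of head
  and tail code, so dropping an element is a predecessor followed by a projection.\<close>

definition nthc :: "nat \<Rightarrow> nat \<Rightarrow> nat" where
  "nthc w t = p1 (((\<lambda>w. p2 (w - 1)) ^^ t) w - 1)"

lemma nthc_list: "t < length xs \<Longrightarrow> nthc (list_encode xs) t = xs ! t"
proof (induction xs arbitrary: t)
  case (Cons x xs)
  show ?case
  proof (cases t)
    case 0 then show ?thesis by (simp add: nthc_def)
  next
    case (Suc t')
    have "nthc (list_encode (x # xs)) (Suc t') = nthc (list_encode xs) t'"
      by (simp add: nthc_def funpow_Suc_right del: funpow.simps)
    then show ?thesis using Cons Suc by simp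
  qed
qed simp

lemma nthc_ex: "\<exists>w. \<forall>t<n. nthc w t = f t"
  by (rule exI[of _ "list_encode (map f [0..<n])"]) (simp add: nthc_list)

lemma rec1_nthc: "rec1 f \<Longrightarrow> rec1 g \<Longrightarrow> rec1 (\<lambda>e. nthc (f e) (g e))"
  unfolding nthc_def by (intro rec1_p1 rec1_monus rec1_funpow rec1_p2 rec1_const rec1_id)

lemmas rec_intros = recp_const recp_conj recp_disj recp_imp recp_iff recp_not recp_le recp_less recp_eq recp_mem
  recp_all_le recp_all_less recp_ex_le recp_ex_less
  rec1_const rec1_id rec1_pr rec1_p1 rec1_p2 rec1_Suc rec1_add rec1_mult rec1_monus rec1_pow2 rec1_nthc rec1_card

abbreviation "recp2 P \<equiv> recp (\<lambda>z. P (p1 z) (p2 z))"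
abbreviation "recp3 P \<equiv> recp (\<lambda>z. P (p1 z) (p1 (p2 z)) (p2 (p2 z)))"
abbreviation "recp4 P \<equiv> recp (\<lambda>z. P (p1 z) (p1 (p2 z)) (p1 (p2 (p2 z))) (p2 (p2 (p2 z))))"

lemma recp_subst2:
  assumes "recp2 P" "rec1 f" "rec1 g"
  shows "recp (\<lambda>z. P (f z) (g z))"
  using recp_comp[OF assms(1) rec1_pr[OF assms(2,3)]] by simp

lemma recp_subst3:
  assumes "recp3 P" "rec1 f" "rec1 g" "rec1 h"
  shows "recp (\<lambda>z. P (f z) (g z) (h z))"
  using recp_comp[OF assms(1) rec1_pr[OF assms(2) rec1_pr[OF assms(3,4)]]] by simp

lemma recp_subst4:
  assumes "recp4 P" "rec1 f" "rec1 g" "rec1 h" "rec1 i"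
  shows "recp (\<lambda>z. P (f z) (g z) (h z) (i z))"
  using recp_comp[OF assms(1) rec1_pr[OF assms(2) rec1_pr[OF assms(3) rec1_pr[OF assms(4,5)]]]] by simp

lemma rec1_subst3:
  assumes "rec1 (\<lambda>z. F (p1 z) (p1 (p2 z)) (p2 (p2 z)))" "rec1 f" "rec1 g" "rec1 h"
  shows "rec1 (\<lambda>z. F (f z) (g z) (h z))"
  using rec1_comp[OF assms(1) rec1_pr[OF assms(2) rec1_pr[OF assms(3,4)]]] by simp

text \<open>Exactly one of the two searches succeeds, so the least number that witnesses either of
  them is computable, and testing \<open>A\<close> at this number gives the answer.\<close>

lemma decidable_search:
  assumes A: "recp2 A" and B: "recp2 B"
    and dual: "\<And>e. (\<exists>w. A e w) \<longleftrightarrow> \<not> (\<exists>w. B e w)"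
    and P: "\<And>\<phi>. P \<phi> \<longleftrightarrow> (\<exists>w. A (enc \<phi>) w)"
  shows "decidable_form P"
proof -
  let ?f = "\<lambda>xs. 1 - of_bool (A (xs ! 1) (xs ! 0) \<or> B (xs ! 1) (xs ! 0)) :: nat"
  have "rec1 (\<lambda>z. of_bool (A (p1 z) (p2 z) \<or> B (p1 z) (p2 z)))"
    using recp_disj[OF A B] unfolding recp_def .
  from recn_rec1[OF this recn_rec2[OF rec2_pr recn_nth[of 1 2] recn_nth[of 0 2]]]
  have "recn 2 (\<lambda>xs. of_bool (A (xs ! 1) (xs ! 0) \<or> B (xs ! 1) (xs ! 0)))" by simp
  then have "recn (Suc 1) ?f"
    by (intro recn_rec2[OF rec2_monus] recn_const) (simp add: numeral_2_eq_2)
  moreover have ex: "\<exists>z. A e z \<or> B e z" for e using dual[of e] by blast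
  ultimately have "recn 1 (\<lambda>xs. LEAST z. ?f (z # xs) = 0)" by (intro recn_Mn) auto
  moreover have "?f (z # xs) = 0 \<longleftrightarrow> A (xs ! 0) z \<or> B (xs ! 0) z" for z xs
    by (simp add: of_bool_def)
  ultimately have rL: "rec1 (\<lambda>e. LEAST z. A e z \<or> B e z)" unfolding rec1_def by (simp only:)
  obtain r where r: "\<And>e. eval_recf r [e] (of_bool (A e (LEAST z. A e z \<or> B e z)))"
    using rec1_eval[OF recp_subst2[OF A rec1_id rL, unfolded recp_def]] by blast
  have "A e (LEAST z. A e z \<or> B e z) \<longleftrightarrow> (\<exists>w. A e w)" for e
    using LeastI_ex[OF ex[of e]] dual[of e] by blast
  then have "eval_recf r [enc \<phi>] (if P \<phi> then 1 else 0)" for \<phi>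
    using r[of "enc \<phi>"] P[of \<phi>] by (simp add: of_bool_def)
  then show ?thesis unfolding decidable_form_def by blast
qed

section \<open>Reachability in monotone counter systems\<close>

lemma mem_less: "mem c w \<Longrightarrow> c < w"
proof -
  assume "mem c w"
  then have "2 ^ c \<le> w" unfolding set_decode_def by (cases "w < 2 ^ c") auto
  then show "c < w" using less_exp[of c] by linarith
qed

text \<open>Dickson's lemma: induction on the number of coordinates; above the maximum of the last
  coordinate over a basis for the others that basis suffices, and each of the finitely many smaller
  values of the last coordinate is treated separately.\<close>

lemma dickson:
  fixes A :: "(nat \<Rightarrow> nat) set"
  shows "\<exists>B\<subseteq>A. finite B \<and> (\<forall>f\<in>A. \<exists>g\<in>B. \<forall>i<K. g i \<le> f i)"
proof (induction K arbitrary: A)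
  case 0
  show ?case
  proof (cases "A = {}")
    case False
    then obtain f where "f \<in> A" by blast
    then show ?thesis by (intro exI[of _ "{f}"]) auto
  qed auto
next
  case (Suc K)
  obtain B where B: "B \<subseteq> A" "finite B" "\<forall>f\<in>A. \<exists>g\<in>B. \<forall>i<K. g i \<le> f i"
    using Suc[of A] by (elim exE conjE)
  define m where "m = Max (insert 0 ((\<lambda>g. g K) ` B))"
  have m: "g K \<le> m" if "g \<in> B" for g unfolding m_def using B(2) that by (intro Max_ge) auto
  have "\<forall>c. \<exists>C. C \<subseteq> {f\<in>A. f K = c} \<and> finite C \<and>
      (\<forall>f\<in>{f\<in>A. f K = c}. \<exists>g\<in>C. \<forall>i<K. g i \<le> f i)"
    by (rule allI, rule Suc)
  then obtain C where C': "\<forall>c. C c \<subseteq> {f\<in>A. f K = c} \<and> finite (C c) \<and>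
      (\<forall>f\<in>{f\<in>A. f K = c}. \<exists>g\<in>C c. \<forall>i<K. g i \<le> f i)"
    by (rule choice[THEN exE])
  then have C: "C c \<subseteq> {f\<in>A. f K = c}" "finite (C c)" for c by simp_all
  have C3: "\<exists>g\<in>C c. \<forall>i<K. g i \<le> f i" if "f \<in> A" "f K = c" for c f
    using C' that by simp
  let ?B = "B \<union> (\<Union>c<m. C c)"
  have "\<exists>g\<in>?B. \<forall>i<Suc K. g i \<le> f i" if f: "f \<in> A" for f
  proof (cases "f K < m")
    case True
    obtain g where g: "g \<in> C (f K)" "\<forall>i<K. g i \<le> f i" using C3[OF f refl] by blast
    then have "g K = f K" using C(1) by blast
    then show ?thesis using g True by (intro bexI[of _ g]) (auto simp: less_Suc_eq)
  next
    case False
    obtain g where g: "g \<in> B" "\<forall>i<K. g i \<le> f i" using B(3) f by blast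
    then show ?thesis using m[of g] False by (intro bexI[of _ g]) (auto simp: less_Suc_eq)
  qed
  moreover have "?B \<subseteq> A" using B(1) C(1) by blast
  moreover have "finite ?B" using B(2) C(2) by auto
  ultimately show ?case by (intro exI[of _ ?B]) blast
qed

text \<open>Conditions on the marking that survive lowering it, together with truncated subtraction,
  make reachability inherited by smaller markings. \<open>inc\<close> is read off the state left and
  \<open>dec\<close> off the state entered: a value absent from \<open>t + 1\<close> to
  \<open>t + e\<close> can be back at \<open>t + 1 + e\<close>, the last position of the next
  window.\<close>

locale counter_system =
  fixes nq K :: nat and ini tgt :: "nat \<Rightarrow> bool"
    and cs :: "nat \<Rightarrow> (nat \<Rightarrow> nat) \<Rightarrow> nat \<Rightarrow> bool" and inc dec :: "nat \<Rightarrow> nat \<Rightarrow> nat"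
  assumes cs_mono: "cs q M q' \<Longrightarrow> (\<And>X. X < K \<Longrightarrow> M' X \<le> M X) \<Longrightarrow> cs q M' q'"
begin

inductive reach :: "nat \<Rightarrow> (nat \<Rightarrow> nat) \<Rightarrow> bool" where
  base: "tgt q \<Longrightarrow> reach q M"
| step: "cs q M q' \<Longrightarrow> q' < nq \<Longrightarrow> reach q' (\<lambda>X. M X + inc q X - dec q' X) \<Longrightarrow> reach q M"

lemma reach_mono: "reach q M \<Longrightarrow> (\<And>X. X < K \<Longrightarrow> M' X \<le> M X) \<Longrightarrow> reach q M'"
proof (induction arbitrary: M' rule: reach.induct)
  case (step q M q')
  show ?case
  proof (rule reach.step[OF cs_mono[OF step.hyps(1) step.prems] step.hyps(2)])
    show "reach q' (\<lambda>X. M' X + inc q X - dec q' X)"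
      by (rule step.IH) (use step.prems in \<open>simp add: diff_le_mono\<close>)
  qed
qed (auto intro: base)

definition is_path :: "nat \<Rightarrow> (nat \<Rightarrow> nat) \<Rightarrow> (nat \<Rightarrow> nat \<Rightarrow> nat) \<Rightarrow> bool" where
  "is_path n qs Ms \<longleftrightarrow> (\<forall>t<n. cs (qs t) (Ms t) (qs (Suc t)) \<and> qs (Suc t) < nq \<and>
     (\<forall>X<K. Ms (Suc t) X = Ms t X + inc (qs t) X - dec (qs (Suc t)) X)) \<and> tgt (qs n)"

lemma reach_path:
  "reach q M \<Longrightarrow> \<exists>n qs Ms. qs 0 = q \<and> Ms 0 = M \<and> is_path n qs Ms"
proof (induction rule: reach.induct)
  case (base q M)
  then show ?case
    by (intro exI[of _ 0] exI[of _ "\<lambda>_. q"] exI[of _ "\<lambda>_. M"]) (simp add: is_path_def)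
next
  case (step q M q')
  then obtain n qs Ms where p: "qs 0 = q'" "Ms 0 = (\<lambda>X. M X + inc q X - dec q' X)" "is_path n qs Ms"
    by blast
  show ?case
    by (rule exI[of _ "Suc n"], rule exI[of _ "case_nat q qs"], rule exI[of _ "case_nat M Ms"])
      (use p step.hyps in \<open>auto simp: is_path_def less_Suc_eq_0_disj\<close>)
qed

lemma path_reach:
  assumes p: "is_path n qs Ms"
  shows "reach (qs 0) (Ms 0)"
proof -
  have "reach (qs (n - d)) (Ms (n - d))" if "d \<le> n" for d
    using that
  proof (induction d)
    case 0
    then show ?case using p by (auto simp: is_path_def intro: base)
  next
    case (Suc d)
    let ?t = "n - Suc d"
    have t: "?t < n" "Suc ?t = n - d" using Suc.prems by auto
    have s: "cs (qs ?t) (Ms ?t) (qs (n - d))" "qs (n - d) < nq"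
      "\<And>X. X < K \<Longrightarrow> Ms (n - d) X = Ms ?t X + inc (qs ?t) X - dec (qs (n - d)) X"
      using p t unfolding is_path_def by metis+
    \<comment> \<open>\<open>Ms\<close> obeys the update only below \<open>K\<close>, so it agrees
      with the marking that \<open>step\<close> demands only there; \<open>reach_mono\<close>
      bridges the difference.\<close>
    show ?case
      by (rule step[OF s(1,2)], rule reach_mono[of _ "Ms (n - d)"])
        (use Suc s(3) in auto)
  qed
  from this[of n] show ?thesis by simp
qed

section \<open>Coded witnesses of reachability and unreachability\<close>

definition path_code :: "nat \<Rightarrow> bool" where
  "path_code w \<longleftrightarrow> nthc (p1 (p2 w)) 0 < nq \<and> ini (nthc (p1 (p2 w)) 0) \<and>
     (\<forall>X<K. nthc (nthc (p2 (p2 w)) 0) X = 0) \<and>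
     is_path (p1 w) (nthc (p1 (p2 w))) (\<lambda>t. nthc (nthc (p2 (p2 w)) t))"

lemma path_code: "(\<exists>w. path_code w) \<longleftrightarrow> (\<exists>q<nq. ini q \<and> reach q (\<lambda>_. 0))"
proof
  assume "\<exists>w. path_code w"
  then obtain w where w: "path_code w" by blast
  from path_reach[of "p1 w" "nthc (p1 (p2 w))" "\<lambda>t. nthc (nthc (p2 (p2 w)) t)"] w
  have "reach (nthc (p1 (p2 w)) 0) (nthc (nthc (p2 (p2 w)) 0))" by (simp add: path_code_def)
  then have "reach (nthc (p1 (p2 w)) 0) (\<lambda>_. 0)" by (rule reach_mono) auto
  then show "\<exists>q<nq. ini q \<and> reach q (\<lambda>_. 0)" using w by (auto simp: path_code_def)
next
  assume "\<exists>q<nq. ini q \<and> reach q (\<lambda>_. 0)"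
  then obtain q where q: "q < nq" "ini q" "reach q (\<lambda>_. 0)" by blast
  from reach_path[OF this(3)] obtain n qs Ms where
    p: "qs 0 = q" "Ms 0 = (\<lambda>_. 0)" "is_path n qs Ms" by blast
  obtain wq where wq: "\<forall>t<Suc n. nthc wq t = qs t" using nthc_ex by blast
  have "\<forall>t. \<exists>m. \<forall>X<K. nthc m X = Ms t X" using nthc_ex by blast
  then obtain m where m: "\<And>t X. X < K \<Longrightarrow> nthc (m t) X = Ms t X" by metis
  obtain wm where wm: "\<forall>t<Suc n. nthc wm t = m t" using nthc_ex by blast
  have "is_path n (nthc wq) (\<lambda>t. nthc (nthc wm t))"
    unfolding is_path_def
  proof (intro conjI allI impI)
    show "tgt (nthc wq n)" using p(3) wq by (simp add: is_path_def)
    fix t assume t: "t < n"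
    then have e: "nthc wq t = qs t" "nthc wq (Suc t) = qs (Suc t)" "nthc wm t = m t"
      "nthc wm (Suc t) = m (Suc t)" using wq wm by auto
    show "cs (nthc wq t) (nthc (nthc wm t)) (nthc wq (Suc t))"
      unfolding e by (rule cs_mono[of _ "Ms t"]) (use p(3) t m in \<open>auto simp: is_path_def\<close>)
    show "nthc wq (Suc t) < nq" unfolding e using p(3) t by (auto simp: is_path_def)
    show "nthc (nthc wm (Suc t)) X = nthc (nthc wm t) X + inc (nthc wq t) X - dec (nthc wq (Suc t)) X"
      if "X < K" for X
      unfolding e m[OF that] using p(3) t that by (auto simp: is_path_def)
  qed
  then have "path_code (pr n (pr wq wm))"
    using q(1,2) p(1,2) wq wm m by (auto simp: path_code_def)
  then show "\<exists>w. path_code w" by blast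
qed

text \<open>The elements of \<open>set_decode w\<close> form a basis of an upward closed invariant.\<close>

definition cert_code :: "nat \<Rightarrow> bool" where
  "cert_code w \<longleftrightarrow>
     (\<forall>q<nq. ini q \<longrightarrow> (\<exists>c<w. mem c w \<and> p1 c = q \<and> (\<forall>X<K. nthc (p2 c) X = 0))) \<and>
     (\<forall>c<w. mem c w \<longrightarrow> \<not> tgt (p1 c) \<and>
        (\<forall>q<nq. cs (p1 c) (nthc (p2 c)) q \<longrightarrow> (\<exists>d<w. mem d w \<and> p1 d = q \<and>
           (\<forall>X<K. nthc (p2 d) X \<le> nthc (p2 c) X + inc (p1 c) X - dec q X))))"

text \<open>All along a path the certificate has an element below the marking: a step possible at
  \<open>M\<close> is possible at the smaller element, and closure of the certificate supplies the
  next one. But no element of it is at a target.\<close>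

lemma cert_sound:
  assumes w: "cert_code w" and r: "reach q M" and c: "mem c w" "p1 c = q"
    and le: "\<And>X. X < K \<Longrightarrow> nthc (p2 c) X \<le> M X"
  shows False
  using r c le
proof (induction arbitrary: c rule: reach.induct)
  case (base q M)
  then show ?case using w mem_less by (auto simp: cert_code_def)
next
  case (step q M q')
  have "cs (p1 c) (nthc (p2 c)) q'"
    using cs_mono[OF step.hyps(1), of "nthc (p2 c)"] step.prems by auto
  moreover have "c < w" using mem_less step.prems by blast
  ultimately obtain d where d: "mem d w" "p1 d = q'"
    "\<And>X. X < K \<Longrightarrow> nthc (p2 d) X \<le> nthc (p2 c) X + inc (p1 c) X - dec q' X"
    using w step.hyps(2) step.prems(1) unfolding cert_code_def by blast
  show ?case
  proof (rule step.IH[OF d(1,2)])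
    fix X assume X: "X < K"
    have "nthc (p2 c) X + inc (p1 c) X - dec q' X \<le> M X + inc q X - dec q' X"
      using step.prems X by (simp add: diff_le_mono)
    then show "nthc (p2 d) X \<le> M X + inc q X - dec q' X" using d(3)[OF X] by linarith
  qed
qed

text \<open>Unreachability is inherited by larger markings, so at each state the bad markings are
  the upward closure of a finite set. By monotonicity, closure under steps need only be checked on
  its elements.\<close>

lemma cert_code: "(\<exists>w. cert_code w) \<longleftrightarrow> \<not> (\<exists>q<nq. ini q \<and> reach q (\<lambda>_. 0))"
proof
  assume "\<exists>w. cert_code w"
  then obtain w where w: "cert_code w" by blast
  show "\<not> (\<exists>q<nq. ini q \<and> reach q (\<lambda>_. 0))"
  proof
    assume "\<exists>q<nq. ini q \<and> reach q (\<lambda>_. 0)"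
    then obtain q where q: "q < nq" "ini q" "reach q (\<lambda>_. 0)" by blast
    then obtain c where "mem c w" "p1 c = q" "\<forall>X<K. nthc (p2 c) X = 0"
      using w unfolding cert_code_def by blast
    then show False using cert_sound[OF w q(3), of c] by simp
  qed
next
  assume no: "\<not> (\<exists>q<nq. ini q \<and> reach q (\<lambda>_. 0))"
  have "\<forall>q. \<exists>B. B \<subseteq> {M. \<not> reach q M} \<and> finite B \<and>
      (\<forall>f\<in>{M. \<not> reach q M}. \<exists>g\<in>B. \<forall>i<K. g i \<le> f i)"
    by (rule allI, rule dickson)
  then obtain B where B': "\<forall>q. B q \<subseteq> {M. \<not> reach q M} \<and> finite (B q) \<and>
      (\<forall>f\<in>{M. \<not> reach q M}. \<exists>g\<in>B q. \<forall>i<K. g i \<le> f i)"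
    by (rule choice[THEN exE])
  have B: "\<not> reach q M" if "M \<in> B q" for q M using B' that by blast
  have B2: "finite (B q)" for q using B' by simp
  have B3: "\<exists>g\<in>B q. \<forall>i<K. g i \<le> f i" if "\<not> reach q f" for q f using B' that by simp
  have "\<forall>M. \<exists>m. \<forall>X<K. nthc m X = M X" using nthc_ex by blast
  then obtain m where m: "\<And>M X. X < K \<Longrightarrow> nthc (m M) X = M X" by metis
  define W where "W = (\<Union>q<nq. (\<lambda>M. pr q (m M)) ` B q)"
  define w where "w = set_encode W"
  have "finite W" unfolding W_def using B2 by auto
  then have memw: "mem c w \<longleftrightarrow> c \<in> W" for c unfolding w_def by simp
  have ex: "\<exists>c<w. mem c w \<and> p1 c = q \<and> (\<forall>X<K. nthc (p2 c) X \<le> f X)" if q: "q < nq" "\<not> reach q f" for q f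
  proof -
    obtain g where "g \<in> B q" "\<forall>i<K. g i \<le> f i" using B3[OF q(2)] by blast
    then have "mem (pr q (m g)) w" "p1 (pr q (m g)) = q" "\<forall>X<K. nthc (p2 (pr q (m g))) X \<le> f X"
      using q(1) m by (auto simp: memw W_def)
    then show ?thesis using mem_less by blast
  qed
  have "cert_code w"
    unfolding cert_code_def
  proof (intro conjI allI impI)
    fix q assume "q < nq" "ini q"
    then show "\<exists>c<w. mem c w \<and> p1 c = q \<and> (\<forall>X<K. nthc (p2 c) X = 0)"
      using ex[of q "\<lambda>_. 0"] no by auto
  next
    fix c assume "mem c w"
    then obtain q M where c: "c = pr q (m M)" "q < nq" "M \<in> B q" by (auto simp: memw W_def)
    have nr: "\<not> reach q (nthc (m M))"
      using B[OF c(3)] reach_mono[of q "nthc (m M)" M] m by auto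
    then show "\<not> tgt (p1 c)" using base c by auto
    fix q' assume q': "q' < nq" "cs (p1 c) (nthc (p2 c)) q'"
    then have "\<not> reach q' (\<lambda>X. nthc (p2 c) X + inc (p1 c) X - dec q' X)"
      using nr step[of q "nthc (m M)" q'] c by auto
    from ex[OF q'(1) this]
    show "\<exists>d<w. mem d w \<and> p1 d = q' \<and>
           (\<forall>X<K. nthc (p2 d) X \<le> nthc (p2 c) X + inc (p1 c) X - dec q' X)" .
  qed
  then show "\<exists>w. cert_code w" by blast
qed

end

section \<open>The counter system of a formula\<close>

text \<open>
  A state is a bit set of facts about the positions \<open>t, \<dots>, t + e\<close>. \<open>TT s c\<close>: the formula with code \<open>c\<close>
  holds at \<open>t\<close>. \<open>LE s m x n y\<close> and \<open>EQ s m x n y\<close> compare \<open>x\<close> at \<open>t + m\<close> with \<open>y\<close> at \<open>t + n\<close>. The value of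
  \<open>x\<close> at \<open>t + m\<close> occurs at \<open>y\<close> later in its current segment (\<open>IN s m x y\<close>) or after the end of that
  segment (\<open>FO s m x y\<close>). In \<open>IN\<close> the index \<open>y = Suc e\<close> is not a variable: it says that the segment ends.
\<close>

definition TT where "TT s c \<longleftrightarrow> mem (pr 0 c) s"
definition LE where
  "LE s m x n y \<longleftrightarrow> mem (pr 1 (pr m (pr x (pr n y)))) s"
definition EQ where
  "EQ s m x n y \<longleftrightarrow> mem (pr 2 (pr m (pr x (pr n y)))) s"
definition IN where
  "IN s m x y \<longleftrightarrow> mem (pr 3 (pr m (pr x y))) s"
definition FO where
  "FO s m x y \<longleftrightarrow> mem (pr 4 (pr m (pr x y))) s"

definition ntypes :: "nat \<Rightarrow> nat" where "ntypes e = 2 ^ Suc e"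
text \<open>\<open>ntypes e\<close> is the number of sets of variables and exceeds \<open>e\<close>,
  so it bounds the components of every fact. The generous bound also covers the sets of obligations,
  in which labels occur, and sets of labels; thus all components of a control state share one
  bound.\<close>

definition nstates where
  "nstates e = 2 ^ Suc (pr 4 (pr (ntypes e) (pr (ntypes e) (pr (ntypes e) (ntypes e)))))"
definition nctrl where
  "nctrl e = Suc (pr 1 (pr (nstates e) (pr (nstates e) (pr (nstates e) (nstates e)))))"

text \<open>All numbers up to \<open>e\<close> that have the shape of a code are constrained, so the
  subformula relation need not be computed.\<close>

definition okT where
  "okT e s \<longleftrightarrow> (\<forall>x\<le>e. (pr 5 x \<le> e \<longrightarrow> (TT s (pr 5 x) \<longleftrightarrow> \<not> TT s x)) \<and> (\<forall>y\<le>e.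
     (pr 3 (pr x y) \<le> e \<longrightarrow> (TT s (pr 3 (pr x y)) \<longleftrightarrow> IN s 0 x y \<or> FO s 0 x y)) \<and>
     (pr 4 (pr x y) \<le> e \<longrightarrow> (TT s (pr 4 (pr x y)) \<longleftrightarrow> TT s x \<and> TT s y)) \<and>
     (\<forall>i\<le>e.
       (pr 0 (pr x (pr i y)) \<le> e \<longrightarrow>
         (TT s (pr 0 (pr x (pr i y))) \<longleftrightarrow> LE s 0 x i y \<and> LE s i y 0 x)) \<and>
       (pr 1 (pr x (pr i y)) \<le> e \<longrightarrow> (TT s (pr 1 (pr x (pr i y))) \<longleftrightarrow> \<not> LE s i y 0 x)) \<and>
       (pr 2 (pr x (pr i y)) \<le> e \<longrightarrow> (TT s (pr 2 (pr x (pr i y))) \<longleftrightarrow> EQ s 0 x i y)))))"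

definition stT where
  "stT e s s' \<longleftrightarrow> (\<forall>x\<le>e. (pr 6 x \<le> e \<longrightarrow> (TT s (pr 6 x) \<longleftrightarrow> TT s' x)) \<and>
     (pr 8 x \<le> e \<longrightarrow> (TT s' (pr 8 x) \<longleftrightarrow> TT s x)) \<and> (\<forall>y\<le>e.
     (pr 7 (pr x y) \<le> e \<longrightarrow> (TT s (pr 7 (pr x y)) \<longleftrightarrow> TT s y \<or> TT s x \<and> TT s' (pr 7 (pr x y)))) \<and>
     (pr 9 (pr x y) \<le> e \<longrightarrow> (TT s' (pr 9 (pr x y)) \<longleftrightarrow> TT s' y \<or> TT s' x \<and> TT s (pr 9 (pr x y))))))"

definition iniT where
  "iniT e s \<longleftrightarrow> TT s e \<and> (\<forall>x\<le>e. (pr 8 x \<le> e \<longrightarrow> \<not> TT s (pr 8 x)) \<and>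
     (\<forall>y\<le>e. pr 9 (pr x y) \<le> e \<longrightarrow> (TT s (pr 9 (pr x y)) \<longleftrightarrow> TT s y)))"

definition okL where
  "okL e s \<longleftrightarrow> (\<forall>m\<le>e. \<forall>x\<le>e. \<forall>n\<le>e. \<forall>y\<le>e. (LE s m x n y \<or> LE s n y m x) \<and>
     (\<forall>l\<le>e. \<forall>z\<le>e. LE s m x n y \<and> LE s n y l z \<longrightarrow> LE s m x l z))"

definition entering where
  "entering e s x \<longleftrightarrow> (\<forall>m<e. \<forall>y\<le>e. \<not> EQ s m y e x)"
definition leaving where
  "leaving e s x \<longleftrightarrow> (\<forall>m<e. \<forall>y\<le>e. \<not> EQ s 0 x (Suc m) y)"
definition least_rep where
  "least_rep s m x \<longleftrightarrow> (\<forall>y<x. \<not> EQ s m y m x)"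

definition okE where
  "okE e s \<longleftrightarrow> (\<forall>m\<le>e. \<forall>x\<le>e. EQ s m x m x \<and> (\<forall>n\<le>e. \<forall>y\<le>e. (EQ s m x n y \<longrightarrow> EQ s n y m x) \<and>
     (\<forall>l\<le>e. \<forall>z\<le>e. EQ s m x n y \<and> EQ s n y l z \<longrightarrow> EQ s m x l z)))"

text \<open>An occurrence inherits the promises of later ones of its segment and passes on those not
  kept in between. The index \<open>Suc e\<close> is never kept by an occurrence, so it persists to
  the end of the segment.\<close>

definition okI where
  "okI e s \<longleftrightarrow> (\<forall>m\<le>e. \<forall>x\<le>e. \<forall>n\<le>e. \<forall>z\<le>e. EQ s m x n z \<longrightarrow>
     (m < n \<longrightarrow> IN s m x z) \<and>
     (m \<le> n \<longrightarrow> (\<forall>y\<le>Suc e. (IN s n z y \<longrightarrow> IN s m x y) \<and>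
        (IN s m x y \<longrightarrow> IN s n z y \<or> y \<le> e \<and> (\<exists>k\<le>n. m < k \<and> EQ s m x k y)))))"

text \<open>A promise beyond the segment forces the segment to end and is shared by all its
  occurrences; the last occurrence has nothing left to promise within the segment.\<close>

definition okF where
  "okF e s \<longleftrightarrow> (\<forall>m\<le>e. \<forall>x\<le>e. \<forall>y\<le>e. (FO s m x y \<longrightarrow> IN s m x (Suc e)) \<and>
     (\<forall>n\<le>e. \<forall>z\<le>e. EQ s m x n z \<longrightarrow> (FO s m x y \<longleftrightarrow> FO s n z y))) \<and>
     (\<forall>x\<le>e. leaving e s x \<longrightarrow> (\<forall>y\<le>e. \<not> IN s 0 x y))"

definition shifted where
  "shifted e s s' \<longleftrightarrow> (\<forall>m<e. \<forall>x\<le>e.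
     (\<forall>n<e. \<forall>y\<le>e. (LE s (Suc m) x (Suc n) y \<longleftrightarrow> LE s' m x n y) \<and>
        (EQ s (Suc m) x (Suc n) y \<longleftrightarrow> EQ s' m x n y)) \<and>
     (\<forall>y\<le>e. FO s (Suc m) x y \<longleftrightarrow> FO s' m x y) \<and>
     (\<forall>y\<le>Suc e. IN s (Suc m) x y \<longleftrightarrow> IN s' m x y))"

definition ok where
  "ok e s \<longleftrightarrow> okT e s \<and> okL e s \<and> okE e s \<and> okI e s \<and> okF e s"
definition stp where
  "stp e s s' \<longleftrightarrow> stT e s s' \<and> shifted e s s'"

text \<open>Least representatives ensure one token per value rather than one per variable.\<close>

definition deposits where
  "deposits e s X x \<longleftrightarrow> least_rep s 0 x \<and> leaving e s x \<and> (\<forall>y\<le>e. FO s 0 x y \<longleftrightarrow> mem y X)"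
definition supplies where
  "supplies e s X x \<longleftrightarrow> least_rep s e x \<and> entering e s x \<and>
     (\<forall>y\<le>e. EQ s e x e y \<or> IN s e x y \<or> FO s e x y \<longleftrightarrow> mem y X)"
text \<open>Such a consumer makes progress towards \<open>y\<close>: its segment shows
  \<open>y\<close>, or the label left after the segment has lost a variable.\<close>

definition good where
  "good e s X y x \<longleftrightarrow> supplies e s X x \<and>
     (EQ s e x e y \<or> IN s e x y \<or> (\<exists>z\<le>e. mem z X \<and> \<not> FO s e x z))"

definition ndep where
  "ndep e s X = card {x. x \<le> e \<and> deposits e s X x}"
definition nsup where
  "nsup e s X = card {x. x \<le> e \<and> supplies e s X x}"

definition quiet where
  "quiet e s s' I \<longleftrightarrow> (\<forall>X<ntypes e. 0 < X \<longrightarrow> \<not> mem X I \<longrightarrow> ndep e s X = 0 \<and> nsup e s' X = 0)"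

definition until_open where
  "until_open e s c \<longleftrightarrow> (\<exists>x\<le>e. \<exists>y\<le>e. c = pr 7 (pr x y) \<and> TT s c \<and> \<not> TT s y)"

text \<open>The obligations \<open>P\<close> of a loop: an until formula, a label waiting for a suitable consumer, an
  occurrence promised by \<open>IN\<close>. The last kind moves along the segment until it is fulfilled.\<close>

definition pend0 where
  "pend0 e s I P \<longleftrightarrow> (\<forall>c\<le>e. mem (pr 0 c) P) \<and>
     (\<forall>X<ntypes e. mem X I \<longrightarrow> (\<forall>y\<le>e. mem y X \<longrightarrow> mem (pr 1 (pr X y)) P)) \<and>
     (\<forall>m\<le>e. \<forall>x\<le>e. \<forall>y\<le>Suc e. IN s m x y \<longrightarrow> mem (pr 2 (pr m (pr x y))) P)"

text \<open>Only lower bounds on \<open>P'\<close> are imposed; too large a guess merely makes the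
  empty set harder to reach. An occurrence obligation at offset 0 is fulfilled in this window or
  passes to all equal values later in it; if there are none, the segment ends and it lapses.\<close>

definition pend_step where
  "pend_step e s s' P P' \<longleftrightarrow>
     (\<forall>c\<le>e. mem (pr 0 c) P \<and> until_open e s c \<longrightarrow> mem (pr 0 c) P') \<and>
     (\<forall>X<ntypes e. \<forall>y\<le>e. mem (pr 1 (pr X y)) P \<and> \<not> (\<exists>x\<le>e. good e s' X y x) \<longrightarrow> mem (pr 1 (pr X y)) P') \<and>
     (\<forall>m<e. \<forall>x\<le>e. \<forall>y\<le>Suc e. mem (pr 2 (pr (Suc m) (pr x y))) P \<longrightarrow> mem (pr 2 (pr m (pr x y))) P') \<and>
     (\<forall>x\<le>e. \<forall>y\<le>Suc e. mem (pr 2 (pr 0 (pr x y))) P \<and>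
        \<not> (y \<le> e \<and> (\<exists>n<e. EQ s 0 x (Suc n) y)) \<longrightarrow>
        (\<forall>n<e. \<forall>z\<le>e. EQ s 0 x (Suc n) z \<longrightarrow> mem (pr 2 (pr n (pr z y))) P'))"

text \<open>A control state is a phase (0: prefix, 1: loop), a state, the first state of the loop, the labels
  with infinitely many consumers, and the pending obligations.\<close>

abbreviation (input) "qph q \<equiv> p1 q"
abbreviation (input) "qst q \<equiv> p1 (p2 q)"
abbreviation (input) "qstar q \<equiv> p1 (p2 (p2 q))"
abbreviation (input) "qI q \<equiv> p1 (p2 (p2 (p2 q)))"
abbreviation (input) "qP q \<equiv> p2 (p2 (p2 (p2 q)))"

definition q_init where
  "q_init e q \<longleftrightarrow> qph q = 0 \<and> ok e (qst q) \<and> iniT e (qst q)"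
definition q_target where
  "q_target q \<longleftrightarrow> qph q = 1 \<and> qst q = qstar q \<and> qP q = 0"
text \<open>The marking is consulted only on entering the loop, and only for zero, a condition
  inherited by smaller markings. During the loop \<open>quiet\<close> keeps the relevant counts at
  zero without further tests.\<close>

definition q_step :: "nat \<Rightarrow> nat \<Rightarrow> (nat \<Rightarrow> nat) \<Rightarrow> nat \<Rightarrow> bool" where
  "q_step e q M q' \<longleftrightarrow> ok e (qst q') \<and>
     (qph q = 0 \<and> qph q' = 0 \<and> stp e (qst q) (qst q') \<or>
      qph q = 0 \<and> qph q' = 1 \<and> qst q' = qst q \<and> qstar q' = qst q \<and>
        (\<forall>X<ntypes e. 0 < X \<longrightarrow> \<not> mem X (qI q') \<longrightarrow> M X = 0) \<and> pend0 e (qst q') (qI q') (qP q') \<or>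
      qph q = 1 \<and> qph q' = 1 \<and> stp e (qst q) (qst q') \<and> qstar q' = qstar q \<and> qI q' = qI q \<and>
        quiet e (qst q) (qst q') (qI q) \<and> pend_step e (qst q) (qst q') (qP q) (qP q'))"

text \<open>The state at 0 contributes no consumers, as nothing can have been deposited before
  it.\<close>

fun tokens :: "nat \<Rightarrow> (nat \<Rightarrow> nat) \<Rightarrow> nat \<Rightarrow> nat \<Rightarrow> nat" where
  "tokens e s 0 X = 0"
| "tokens e s (Suc t) X = tokens e s t X + ndep e (s t) X - nsup e (s (Suc t)) X"

section \<open>Computability of the counter system\<close>

lemma recp_TT: "rec1 f \<Longrightarrow> rec1 g \<Longrightarrow> recp (\<lambda>z. TT (f z) (g z))"
  unfolding TT_def by (intro rec_intros)
lemma recp_LE: "rec1 f \<Longrightarrow> rec1 g \<Longrightarrow> rec1 h \<Longrightarrow> rec1 i \<Longrightarrow> rec1 j \<Longrightarrow> recp (\<lambda>z. LE (f z) (g z) (h z) (i z) (j z))"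
  unfolding LE_def by (intro rec_intros)
lemma recp_EQ: "rec1 f \<Longrightarrow> rec1 g \<Longrightarrow> rec1 h \<Longrightarrow> rec1 i \<Longrightarrow> rec1 j \<Longrightarrow> recp (\<lambda>z. EQ (f z) (g z) (h z) (i z) (j z))"
  unfolding EQ_def by (intro rec_intros)
lemma recp_IN: "rec1 f \<Longrightarrow> rec1 g \<Longrightarrow> rec1 h \<Longrightarrow> rec1 i \<Longrightarrow> recp (\<lambda>z. IN (f z) (g z) (h z) (i z))"
  unfolding IN_def by (intro rec_intros)
lemma recp_FO: "rec1 f \<Longrightarrow> rec1 g \<Longrightarrow> rec1 h \<Longrightarrow> rec1 i \<Longrightarrow> recp (\<lambda>z. FO (f z) (g z) (h z) (i z))"
  unfolding FO_def by (intro rec_intros)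
lemmas rec_states = recp_TT recp_LE recp_EQ recp_IN recp_FO

lemma rec1_ntypes: "rec1 f \<Longrightarrow> rec1 (\<lambda>z. ntypes (f z))"
  unfolding ntypes_def by (intro rec_intros)
lemma rec1_nstates: "rec1 f \<Longrightarrow> rec1 (\<lambda>z. nstates (f z))"
  unfolding nstates_def by (intro rec_intros rec1_ntypes)
lemma rec1_nctrl: "rec1 f \<Longrightarrow> rec1 (\<lambda>z. nctrl (f z))"
  unfolding nctrl_def by (intro rec_intros rec1_nstates)


lemma recp_okT: "recp2 okT" unfolding okT_def by (intro rec_intros rec_states)
lemma recp_okL: "recp2 okL" unfolding okL_def by (intro rec_intros rec_states)
lemma recp_okE: "recp2 okE" unfolding okE_def by (intro rec_intros rec_states)
lemma recp_okI: "recp2 okI" unfolding okI_def by (intro rec_intros rec_states)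
lemma recp_entering: "recp3 entering"
  unfolding entering_def by (intro rec_intros rec_states)
lemma recp_leaving: "recp3 leaving"
  unfolding leaving_def by (intro rec_intros rec_states)
lemma recp_least_rep: "recp3 least_rep"
  unfolding least_rep_def by (intro rec_intros rec_states)
lemmas rec_states2 = rec_states recp_subst2[of okT, OF recp_okT] recp_subst2[of okL, OF recp_okL] recp_subst2[of okE, OF recp_okE]
  recp_subst2[of okI, OF recp_okI] recp_subst3[of entering, OF recp_entering] recp_subst3[of leaving, OF recp_leaving]
  recp_subst3[of least_rep, OF recp_least_rep] rec1_ntypes rec1_nstates rec1_nctrl

lemma recp_okF: "recp2 okF" unfolding okF_def by (intro rec_intros rec_states2)
lemma recp_ok: "recp2 ok"
  unfolding ok_def by (intro rec_intros rec_states2 recp_subst2[of okF, OF recp_okF])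
lemma recp_stp: "recp3 stp"
  unfolding stp_def stT_def shifted_def by (intro rec_intros rec_states2)
lemma recp_iniT: "recp2 iniT" unfolding iniT_def by (intro rec_intros rec_states2)
lemma recp_deposits: "recp4 deposits"
  unfolding deposits_def by (intro rec_intros rec_states2)
lemma recp_supplies: "recp4 supplies"
  unfolding supplies_def by (intro rec_intros rec_states2)
lemmas rec_states3 = rec_states2 recp_subst2[of ok, OF recp_ok] recp_subst3[of stp, OF recp_stp] recp_subst2[of iniT, OF recp_iniT]
  recp_subst4[of deposits, OF recp_deposits] recp_subst4[of supplies, OF recp_supplies]

lemma rec1_ndep: "rec1 (\<lambda>z. ndep (p1 z) (p1 (p2 z)) (p2 (p2 z)))" unfolding ndep_def by (intro rec_intros rec_states3)
lemma rec1_nsup: "rec1 (\<lambda>z. nsup (p1 z) (p1 (p2 z)) (p2 (p2 z)))" unfolding nsup_def by (intro rec_intros rec_states3)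
lemmas rec_states4 = rec_states3 rec1_subst3[of ndep, OF rec1_ndep] rec1_subst3[of nsup, OF rec1_nsup]

lemma recp_quiet: "recp4 quiet"
  unfolding quiet_def by (intro rec_intros rec_states4)
lemma recp_until_open: "recp3 until_open"
  unfolding until_open_def by (intro rec_intros rec_states4)
lemma recp_pend0: "recp4 pend0"
  unfolding pend0_def by (intro rec_intros rec_states4)
lemma recp_pend_step: "rec1 f \<Longrightarrow> rec1 g \<Longrightarrow> rec1 h \<Longrightarrow> rec1 i \<Longrightarrow> rec1 j \<Longrightarrow> recp (\<lambda>z. pend_step (f z) (g z) (h z) (i z) (j z))"
proof -
  assume *: "rec1 f" "rec1 g" "rec1 h" "rec1 i" "rec1 j"
  note c = *[THEN rec1_comp]
  show ?thesis unfolding pend_step_def good_def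
    by (intro rec_intros rec_states4 c recp_subst3[of until_open, OF recp_until_open])
qed
lemmas rec_states5 = rec_states4 recp_subst4[of quiet, OF recp_quiet] recp_subst4[of pend0, OF recp_pend0] recp_pend_step

lemma recp_q_init: "recp2 q_init" unfolding q_init_def by (intro rec_intros rec_states5)
lemma recp_q_target: "recp q_target" unfolding q_target_def[abs_def] by (intro rec_intros rec_states5)
lemma recp_q_step:
  "recp (\<lambda>z. q_step (p1 z) (p1 (p2 z)) (nthc (p1 (p2 (p2 z)))) (p2 (p2 (p2 z))))"
  unfolding q_step_def by (intro rec_intros rec_states5)
lemmas rec_states6 = rec_states5 recp_subst2[of q_init, OF recp_q_init] recp_comp[OF recp_q_target]
  recp_subst4[of "\<lambda>e q m. q_step e q (nthc m)", OF recp_q_step]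

interpretation sys: counter_system "nctrl e" "ntypes e" "q_init e" q_target "q_step e"
  "\<lambda>q. ndep e (qst q)" "\<lambda>q. nsup e (qst q)" for e
  by unfold_locales (fastforce simp: q_step_def)

lemma recp_path_code: "recp2 sys.path_code"
  unfolding sys.path_code_def sys.is_path_def by (intro rec_intros rec_states6)

lemma recp_cert_code: "recp2 sys.cert_code"
  unfolding sys.cert_code_def by (intro rec_intros rec_states6)

lemma decidable_reach:
  assumes "\<And>\<phi>. P \<phi> \<longleftrightarrow> (\<exists>q<nctrl (enc \<phi>). q_init (enc \<phi>) q \<and> sys.reach (enc \<phi>) q (\<lambda>_. 0))"
  shows "decidable_form P"
  by (rule decidable_search[of sys.path_code sys.cert_code])
    (auto simp: recp_path_code recp_cert_code sys.path_code sys.cert_code assms)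

section \<open>From models to paths\<close>

lemma triangle_ge: "n \<le> triangle n"
  by (induction n) auto

lemma pr_mono: "a \<le> a' \<Longrightarrow> b \<le> b' \<Longrightarrow> pr a b \<le> pr a' b'"
  unfolding prod_encode_def using triangle_mono[of "a + b" "a' + b'"] by simp

lemma p2_less: "0 < p1 c \<Longrightarrow> p2 c < c"
proof -
  assume "0 < p1 c"
  moreover have "triangle (p1 c + p2 c) + p1 c = c"
    using prod_decode_inverse[of c] by (cases "prod_decode c") (simp add: prod_encode_def)
  ultimately show ?thesis using triangle_ge[of "p1 c + p2 c"] by linarith
qed

lemma p1_le: "p1 c \<le> c" and p2_le: "p2 c \<le> c"
  using le_prod_encode_1[of "p1 c" "p2 c"] le_prod_encode_2[of "p2 c" "p1 c"] by auto

text \<open>States assign a truth value to every number up to \<open>e\<close>, so in a model each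
  number must name a formula; tags above 9 get an arbitrary one.\<close>

function dec :: "nat \<Rightarrow> form" where
  "dec c = (let t = p1 c; r = p2 c in
     if t = 0 then EqL (p1 r) (p1 (p2 r)) (p2 (p2 r))
     else if t = 1 then LtL (p1 r) (p1 (p2 r)) (p2 (p2 r))
     else if t = 2 then EqR (p1 r) (p1 (p2 r)) (p2 (p2 r))
     else if t = 3 then EqXF (p1 r) (p2 r)
     else if t = 4 then And (dec (p1 r)) (dec (p2 r))
     else if t = 5 then Neg (dec r)
     else if t = 6 then Next (dec r)
     else if t = 7 then Until (dec (p1 r)) (dec (p2 r))
     else if t = 8 then Prev (dec r)
     else if t = 9 then Since (dec (p1 r)) (dec (p2 r))
     else EqL 0 0 0)"
  by pat_completeness auto
termination
proof (relation "measure id", goal_cases)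
  case 1 show ?case by simp
qed (auto intro: p2_less le_less_trans[OF p1_le p2_less] le_less_trans[OF p2_le p2_less])

lemma dec_simps:
  "dec (pr 0 (pr x (pr i y))) = EqL x i y"
  "dec (pr 1 (pr x (pr i y))) = LtL x i y"
  "dec (pr 2 (pr x (pr i y))) = EqR x i y"
  "dec (pr 3 (pr x y)) = EqXF x y"
  "dec (pr 4 (pr x y)) = And (dec x) (dec y)"
  "dec (pr 5 x) = Neg (dec x)"
  "dec (pr 6 x) = Next (dec x)"
  "dec (pr 7 (pr x y)) = Until (dec x) (dec y)"
  "dec (pr 8 x) = Prev (dec x)"
  "dec (pr 9 (pr x y)) = Since (dec x) (dec y)"
  by (subst dec.simps, simp)+

declare dec.simps [simp del]

lemma dec_enc: "dec (enc \<phi>) = \<phi>"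
  by (induction \<phi>) (simp_all add: dec_simps del: One_nat_def)

lemma set_encode_less: "A \<subseteq> {..<w} \<Longrightarrow> set_encode A < 2 ^ w"
proof -
  assume "A \<subseteq> {..<w}"
  then have "set_encode A \<le> (\<Sum>i<w. 2 ^ i)"
    unfolding set_encode_def by (intro sum_mono2) auto
  also have "\<dots> < 2 ^ w" by (induction w) auto
  finally show ?thesis .
qed

lemma mem_bound: "mem y X \<Longrightarrow> X < 2 ^ w \<Longrightarrow> y < w"
proof -
  assume "mem y X" "X < 2 ^ w"
  then have "2 ^ y \<le> X" unfolding set_decode_def by (cases "X < 2 ^ y") auto
  then have "(2::nat) ^ y < 2 ^ w" using \<open>X < 2 ^ w\<close> by linarith
  then show "y < w" by simp
qed

lemma ntypes_ge: "Suc e \<le> ntypes e"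
  unfolding ntypes_def using less_exp[of "Suc e"] by linarith

lemma holds_Until_unfold:
  "holds lt \<sigma> t (Until \<phi> \<psi>) \<longleftrightarrow> holds lt \<sigma> t \<psi> \<or> holds lt \<sigma> t \<phi> \<and> holds lt \<sigma> (Suc t) (Until \<phi> \<psi>)"
proof -
  have 1: "(\<exists>j\<ge>t. Q j) \<longleftrightarrow> Q t \<or> (\<exists>j\<ge>Suc t. Q j)" for Q
    by (metis Suc_leD Suc_leI le_neq_implies_less order_refl)
  have 2: "(\<forall>l. t \<le> l \<and> l < j \<longrightarrow> A l) \<longleftrightarrow> A t \<and> (\<forall>l. Suc t \<le> l \<and> l < j \<longrightarrow> A l)"
    if "Suc t \<le> j" for A j
    using that by (metis Suc_leD Suc_le_eq le_neq_implies_less order_refl)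
  show ?thesis unfolding holds.simps(8) by (subst 1) (auto simp: 2 cong: conj_cong)
qed

lemma holds_Since_unfold:
  "holds lt \<sigma> (Suc t) (Since \<phi> \<psi>) \<longleftrightarrow>
     holds lt \<sigma> (Suc t) \<psi> \<or> holds lt \<sigma> (Suc t) \<phi> \<and> holds lt \<sigma> t (Since \<phi> \<psi>)"
  unfolding holds.simps(10) by (auto simp: le_Suc_eq)

lemma sto_irrefl: "strict_total_order lt \<Longrightarrow> \<not> lt a a"
  and sto_trans: "strict_total_order lt \<Longrightarrow> lt a b \<Longrightarrow> lt b c \<Longrightarrow> lt a c"
  and sto_total: "strict_total_order lt \<Longrightarrow> a \<noteq> b \<Longrightarrow> lt a b \<or> lt b a"
  unfolding strict_total_order_def by blast+

lemma finite_bound: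
  fixes Q :: "'a \<Rightarrow> nat \<Rightarrow> bool"
  assumes "finite A" and "\<And>a. a \<in> A \<Longrightarrow> \<exists>u. Q a u" and mono: "\<And>a u v. Q a u \<Longrightarrow> u \<le> v \<Longrightarrow> Q a v"
  shows "\<exists>U. \<forall>a\<in>A. Q a U"
  using assms(1,2)
proof (induction A)
  case (insert a A)
  obtain u where "Q a u" using insert.prems by blast
  moreover obtain U where "\<forall>a\<in>A. Q a U" using insert.IH insert.prems by blast
  ultimately have "\<forall>b\<in>insert a A. Q b (max U u)" using mono by (auto elim: mono)
  then show ?case ..
qed auto

section \<open>The states of a model\<close>

locale model =
  fixes lt :: "'d \<Rightarrow> 'd \<Rightarrow> bool" and \<sigma> :: "nat \<Rightarrow> var \<Rightarrow> 'd" and e :: nat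
  assumes sto: "strict_total_order lt"
begin

abbreviation "R p x \<equiv> \<sigma> p (Rem x)"
definition "leq a b \<longleftrightarrow> lt a b \<or> a = b"

lemma leq_antisym: "leq a b \<and> leq b a \<longleftrightarrow> a = b"
  and not_leq: "\<not> leq b a \<longleftrightarrow> lt a b"
  and leq_total: "leq a b \<or> leq b a"
  and leq_trans: "leq a b \<Longrightarrow> leq b c \<Longrightarrow> leq a c"
  unfolding leq_def using sto_irrefl[OF sto] sto_trans[OF sto] sto_total[OF sto] by blast+

definition "occ v p \<longleftrightarrow> (\<exists>x\<le>e. R p x = v)"
text \<open>\<open>v\<close> need not occur at \<open>q\<close>, but the first gap at or after an
  occurrence is itself at an occurrence, the last one of the segment.\<close>

definition "gap v q \<longleftrightarrow> (\<forall>q'. q < q' \<and> q' \<le> q + e \<longrightarrow> \<not> occ v q')"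
definition "conn v p j \<longleftrightarrow> (\<forall>q. p \<le> q \<and> q < j \<longrightarrow> \<not> gap v q)"
definition "seen p x y \<longleftrightarrow> (if y \<le> e then \<exists>j>p. R j y = R p x \<and> conn (R p x) p j
  else \<exists>q\<ge>p. gap (R p x) q)"
definition "later p x y \<longleftrightarrow> (\<exists>q\<ge>p. gap (R p x) q \<and> (\<exists>j>q. R j y = R p x))"

definition "holds_at t z \<longleftrightarrow> (let a = p1 z; r = p2 z; m = p1 r; x = p1 (p2 r);
    n = p1 (p2 (p2 r)); y = p2 (p2 (p2 r)); y' = p2 (p2 r) in
  if a = 0 then r \<le> e \<and> holds lt \<sigma> t (dec r)
  else if a = 1 then m \<le> e \<and> x \<le> e \<and> n \<le> e \<and> y \<le> e \<and> leq (\<sigma> (t + m) (Loc x)) (\<sigma> (t + n) (Loc y))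
  else if a = 2 then m \<le> e \<and> x \<le> e \<and> n \<le> e \<and> y \<le> e \<and> R (t + m) x = R (t + n) y
  else if a = 3 then m \<le> e \<and> x \<le> e \<and> y' \<le> Suc e \<and> seen (t + m) x y'
  else a = 4 \<and> m \<le> e \<and> x \<le> e \<and> y' \<le> e \<and> later (t + m) x y')"

abbreviation "W \<equiv> Suc (pr 4 (pr (ntypes e) (pr (ntypes e) (pr (ntypes e) (ntypes e)))))"

definition "st t = set_encode {z. z < W \<and> holds_at t z}"

lemma st_less: "st t < nstates e"
  unfolding st_def nstates_def by (rule set_encode_less) auto

lemma mem_st: "mem z (st t) \<longleftrightarrow> z < W \<and> holds_at t z"
  unfolding st_def by (subst set_encode_inverse) auto

lemma
  assumes "a \<le> 4" "m \<le> ntypes e"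
  shows less_W1: "pr a m < W"
    and less_W2: "x \<le> ntypes e \<Longrightarrow> pr a (pr m x) < W"
    and less_W3: "x \<le> ntypes e \<Longrightarrow> y \<le> ntypes e \<Longrightarrow> pr a (pr m (pr x y)) < W"
    and less_W4: "x \<le> ntypes e \<Longrightarrow> n \<le> ntypes e \<Longrightarrow> y \<le> ntypes e \<Longrightarrow> pr a (pr m (pr x (pr n y))) < W"
  unfolding less_Suc_eq_le using assms by (auto intro!: pr_mono intro: le_trans[OF _ le_prod_encode_1])

lemma st_TT: "TT (st t) c \<longleftrightarrow> c \<le> e \<and> holds lt \<sigma> t (dec c)"
  unfolding TT_def mem_st using less_W1[of 0 c] ntypes_ge[of e] by (auto simp: holds_at_def)

lemma st_LE: "m \<le> e \<Longrightarrow> x \<le> e \<Longrightarrow> n \<le> e \<Longrightarrow> y \<le> e \<Longrightarrow>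
  LE (st t) m x n y \<longleftrightarrow> leq (\<sigma> (t + m) (Loc x)) (\<sigma> (t + n) (Loc y))"
  unfolding LE_def mem_st using less_W4[of 1 m x n y] ntypes_ge[of e]
  by (simp add: holds_at_def)

lemma st_EQ: "m \<le> e \<Longrightarrow> x \<le> e \<Longrightarrow> n \<le> e \<Longrightarrow> y \<le> e \<Longrightarrow>
  EQ (st t) m x n y \<longleftrightarrow> R (t + m) x = R (t + n) y"
  unfolding EQ_def mem_st using less_W4[of 2 m x n y] ntypes_ge[of e]
  by (simp add: holds_at_def)

lemma st_IN: "m \<le> e \<Longrightarrow> x \<le> e \<Longrightarrow> y \<le> Suc e \<Longrightarrow> IN (st t) m x y \<longleftrightarrow> seen (t + m) x y"
  unfolding IN_def mem_st using less_W3[of 3 m x y] ntypes_ge[of e]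
  by (simp add: holds_at_def)

lemma st_FO: "m \<le> e \<Longrightarrow> x \<le> e \<Longrightarrow> y \<le> e \<Longrightarrow> FO (st t) m x y \<longleftrightarrow> later (t + m) x y"
  unfolding FO_def mem_st using less_W3[of 4 m x y] ntypes_ge[of e]
  by (simp add: holds_at_def)

lemmas st_simps = st_TT st_LE st_EQ st_IN st_FO

lemma seen_or_later: "y \<le> e \<Longrightarrow> seen p x y \<or> later p x y \<longleftrightarrow> (\<exists>j>p. R j y = R p x)"
  unfolding seen_def later_def conn_def by (auto intro: le_less_trans)

text \<open>A gap keeps \<open>v\<close> away for \<open>e\<close> positions; starting at or after
  \<open>p\<close> but before \<open>p'\<close>, it would cover the occurrence at
  \<open>p'\<close>.\<close>

lemma gap_after: "occ v p' \<Longrightarrow> p \<le> q \<Longrightarrow> p' \<le> p + e \<Longrightarrow> gap v q \<Longrightarrow> p' \<le> q"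
  unfolding gap_def by (metis add_le_mono1 le_trans not_le)

lemma later_eq:
  assumes "p \<le> p'" "p' \<le> p + e" "R p x = R p' z" "z \<le> e"
  shows "later p x y \<longleftrightarrow> later p' z y"
proof -
  have "occ (R p x) p'" unfolding occ_def using assms(3,4) by auto
  from gap_after[OF this _ assms(2)] show ?thesis
    unfolding later_def using assms(1,3) by (metis le_trans)
qed

lemma conn_window:
  assumes "p' \<le> p + e" "occ v p'"
  shows "conn v p p'"
  unfolding conn_def using gap_after[OF assms(2) _ assms(1)] not_le by blast

lemma seen_back:
  assumes "p \<le> p'" "p' \<le> p + e" "R p x = R p' z" "z \<le> e" "seen p' z y"
  shows "seen p x y"
proof -
  have "conn (R p x) p p'" by (rule conn_window) (use assms in \<open>auto simp: occ_def\<close>)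
  then show ?thesis using assms unfolding seen_def conn_def
    by (auto split: if_splits intro: le_trans) (metis le_less_trans not_le)
qed

lemma seen_forw:
  assumes "p \<le> p'" "p' \<le> p + e" "R p x = R p' z" "z \<le> e" "seen p x y"
  shows "seen p' z y \<or> y \<le> e \<and> (\<exists>j. p < j \<and> j \<le> p' \<and> R j y = R p x)"
proof (cases "y \<le> e")
  case True
  then obtain j where j: "j > p" "R j y = R p x" "conn (R p x) p j" using assms by (auto simp: seen_def)
  show ?thesis
  proof (cases "j \<le> p'")
    case False
    then have "seen p' z y" using True j assms(1,3) unfolding seen_def conn_def
      by (auto intro!: exI[of _ j])
    then show ?thesis ..
  qed (use True j in auto)
next
  case False
  then obtain q where "q \<ge> p" "gap (R p x) q" using assms by (auto simp: seen_def)
  moreover have "occ (R p x) p'" unfolding occ_def using assms(3,4) by auto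
  ultimately have "q \<ge> p'" using gap_after assms(2) by blast
  then show ?thesis using False \<open>gap (R p x) q\<close> assms(3) by (auto simp: seen_def)
qed

lemma leaving_iff:
  assumes x: "x \<le> e"
  shows "leaving e (st t) x \<longleftrightarrow> gap (R t x) t"
proof
  assume l: "leaving e (st t) x"
  show "gap (R t x) t"
    unfolding gap_def occ_def
  proof (intro allI impI notI; elim conjE exE)
    fix q' y assume *: "t < q'" "q' \<le> t + e" "y \<le> e" "R q' y = R t x"
    define m where "m = q' - Suc t"
    have m: "q' = t + Suc m" "m < e" using * by (auto simp: m_def)
    then have "\<not> EQ (st t) 0 x (Suc m) y" using l * by (auto simp: leaving_def)
    then show False using * x m by (simp add: st_EQ)
  qed
next
  assume g: "gap (R t x) t"
  show "leaving e (st t) x"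
    unfolding leaving_def
  proof (intro allI impI notI)
    fix m y assume "m < e" "y \<le> e" "EQ (st t) 0 x (Suc m) y"
    then have "R (t + Suc m) y = R t x" "y \<le> e" "t + Suc m \<le> t + e" using x by (auto simp: st_EQ)
    then show False using g unfolding gap_def occ_def by (metis less_add_Suc1 add_Suc_right)
  qed
qed

lemma entering_iff:
  assumes x: "x \<le> e"
  shows "entering e (st t) x \<longleftrightarrow> (\<forall>q. t \<le> q \<and> q < t + e \<longrightarrow> \<not> occ (R (t + e) x) q)"
proof
  assume l: "entering e (st t) x"
  show "\<forall>q. t \<le> q \<and> q < t + e \<longrightarrow> \<not> occ (R (t + e) x) q"
    unfolding occ_def
  proof (intro allI impI notI; elim conjE exE)
    fix q y assume *: "t \<le> q" "q < t + e" "y \<le> e" "R q y = R (t + e) x"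
    then have "\<not> EQ (st t) (q - t) y e x" using l by (auto simp: entering_def)
    then show False using * x by (simp add: st_EQ)
  qed
next
  assume g: "\<forall>q. t \<le> q \<and> q < t + e \<longrightarrow> \<not> occ (R (t + e) x) q"
  show "entering e (st t) x"
    unfolding entering_def
  proof (intro allI impI notI)
    fix m y assume *: "m < e" "y \<le> e" "EQ (st t) m y e x"
    then have "R (t + m) y = R (t + e) x" using x by (auto simp: st_EQ)
    then show False using g[rule_format, of "t + m"] * unfolding occ_def by auto
  qed
qed

lemma ok_st: "ok e (st t)"
  unfolding ok_def
proof (intro conjI)
  show "okT e (st t)"
    unfolding okT_def
    by (simp add: st_simps dec_simps leq_antisym not_leq seen_or_later eq_commute del: One_nat_def cong: imp_cong)
  show "okL e (st t)"
    unfolding okL_def by (simp add: st_simps leq_total) (blast intro: leq_trans)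
  show "okE e (st t)"
    unfolding okE_def by (simp add: st_simps)
  show "okI e (st t)"
    unfolding okI_def
  proof (intro allI impI conjI; (elim conjE)?)
    fix m x n z assume b: "m \<le> e" "x \<le> e" "n \<le> e" "z \<le> e" and "EQ (st t) m x n z"
    then have eq: "R (t + m) x = R (t + n) z" by (simp add: st_EQ)
    show "IN (st t) m x z" if "m < n"
    proof -
      have "conn (R (t + m) x) (t + m) (t + n)"
        by (rule conn_window) (use b eq in \<open>auto simp: occ_def\<close>)
      then show ?thesis using b eq that by (auto simp: st_IN seen_def intro!: exI[of _ "t + n"])
    qed
    fix y assume y: "m \<le> n" "y \<le> Suc e"
    show "IN (st t) m x y" if "IN (st t) n z y"
      using seen_back[of "t + m" "t + n" x z y] b eq y that by (simp add: st_IN)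
    show "IN (st t) n z y \<or> y \<le> e \<and> (\<exists>k\<le>n. m < k \<and> EQ (st t) m x k y)" if i: "IN (st t) m x y"
    proof (rule ccontr)
      assume n: "\<not> ?thesis"
      then have "\<not> seen (t + n) z y" using b y by (simp add: st_IN)
      then obtain j where j: "y \<le> e" "t + m < j" "j \<le> t + n" "R j y = R (t + m) x"
        using seen_forw[of "t + m" "t + n" x z y] b eq y i by (auto simp: st_IN)
      then have "j - t \<le> n" "m < j - t" "EQ (st t) m x (j - t) y" using b by (auto simp: st_EQ)
      then show False using n j(1) by blast
    qed
  qed
  show "okF e (st t)"
    unfolding okF_def
  proof (intro allI impI conjI)
    fix m x y assume b: "m \<le> e" "x \<le> e" "y \<le> e"
    show "IN (st t) m x (Suc e)" if "FO (st t) m x y"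
      using that b by (auto simp: st_IN st_FO seen_def later_def)
    fix n z assume c: "n \<le> e" "z \<le> e" "EQ (st t) m x n z"
    then have "R (t + m) x = R (t + n) z" using b by (simp add: st_EQ)
    then show "FO (st t) m x y = FO (st t) n z y"
      using later_eq[of "t + m" "t + n" x z y] later_eq[of "t + n" "t + m" z x y] b c
      by (cases "m \<le> n") (auto simp: st_FO)
  next
    fix x y assume "x \<le> e" "leaving e (st t) x" "y \<le> e"
    then show "\<not> IN (st t) 0 x y" by (auto simp: st_IN leaving_iff seen_def conn_def)
  qed
qed

lemma stp_st: "stp e (st t) (st (Suc t))"
  unfolding stp_def stT_def shifted_def
  by (auto simp add: st_simps dec_simps holds_Until_unfold[of _ _ t] holds_Since_unfold simp del: holds.simps(8,10))

lemma iniT_st: "holds lt \<sigma> 0 (dec e) \<Longrightarrow> iniT e (st 0)"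
  unfolding iniT_def by (auto simp: st_TT dec_simps)

section \<open>Values absent from the window, compared with the token counts\<close>

definition "future v p X \<longleftrightarrow> (\<forall>y\<le>e. (\<exists>j\<ge>p. R j y = v) \<longleftrightarrow> mem y X)"
definition "Out t X = {v. (\<exists>p<t. occ v p) \<and> (\<forall>q. t \<le> q \<and> q \<le> t + e \<longrightarrow> \<not> occ v q) \<and> future v t X}"
definition "Dep t X = {v. occ v t \<and> gap v t \<and> future v (Suc t) X}"
definition "Ent t X = {v. occ v (t + e) \<and> (\<forall>q. t \<le> q \<and> q < t + e \<longrightarrow> \<not> occ v q) \<and> future v (t + e) X}"

lemma least_rep_iff: "m \<le> e \<Longrightarrow> x \<le> e \<Longrightarrow> least_rep (st t) m x \<longleftrightarrow> (\<forall>y<x. R (t + m) y \<noteq> R (t + m) x)"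
  unfolding least_rep_def by (simp add: st_EQ)

lemma least_rep_ex:
  assumes "m \<le> e" "occ v (t + m)"
  shows "\<exists>x\<le>e. least_rep (st t) m x \<and> R (t + m) x = v"
proof -
  obtain x where "x \<le> e" "R (t + m) x = v" using assms(2) by (auto simp: occ_def)
  then show ?thesis
  proof (induction x rule: less_induct)
    case (less x)
    show ?case
    proof (cases "\<exists>y<x. R (t + m) y = v")
      case True
      then show ?thesis using less by (meson less_imp_le le_trans)
    next
      case False
      then have "least_rep (st t) m x" using less.prems assms(1) by (auto simp: least_rep_iff)
      then show ?thesis using less.prems by blast
    qed
  qed
qed

lemma least_rep_inj:
  assumes "m \<le> e"
  shows "inj_on (R (t + m)) {x. x \<le> e \<and> least_rep (st t) m x}"
proof (rule inj_onI)
  fix x y assume "x \<in> {x. x \<le> e \<and> least_rep (st t) m x}" "y \<in> {x. x \<le> e \<and> least_rep (st t) m x}"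
    "R (t + m) x = R (t + m) y"
  then show "x = y" using assms by (cases x y rule: linorder_cases) (auto simp: least_rep_iff)
qed

lemma deposits_iff:
  "x \<le> e \<Longrightarrow> deposits e (st t) X x \<longleftrightarrow> least_rep (st t) 0 x \<and> R t x \<in> Dep t X"
proof -
  assume x: "x \<le> e"
  have "later t x y \<longleftrightarrow> (\<exists>j\<ge>Suc t. R j y = R t x)" if "gap (R t x) t" for y
    unfolding later_def using that by (auto intro: Suc_leI le_less_trans simp: Suc_le_eq)
  then show ?thesis using x
    by (auto simp: deposits_def leaving_iff Dep_def st_FO future_def occ_def)
qed

lemma supplies_iff:
  "x \<le> e \<Longrightarrow> supplies e (st t) X x \<longleftrightarrow> least_rep (st t) e x \<and> R (t + e) x \<in> Ent t X"
proof -
  assume x: "x \<le> e"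
  have "R (t + e) x = R (t + e) y \<or> seen (t + e) x y \<or> later (t + e) x y \<longleftrightarrow> (\<exists>j\<ge>t + e. R j y = R (t + e) x)"
    if "y \<le> e" for y
    unfolding seen_or_later[OF that] by (metis le_less)
  then show ?thesis using x
    by (auto simp: supplies_def entering_iff Ent_def st_IN st_FO st_EQ future_def occ_def)
qed

lemma Dep_image: "Dep t X = R t ` {x. x \<le> e \<and> deposits e (st t) X x}"
proof (intro equalityI subsetI)
  fix v assume v: "v \<in> Dep t X"
  then have "occ v (t + 0)" by (simp add: Dep_def)
  from least_rep_ex[OF _ this] obtain x where "x \<le> e" "least_rep (st t) 0 x" "R (t + 0) x = v" by auto
  then show "v \<in> R t ` {x. x \<le> e \<and> deposits e (st t) X x}"
    using v by (intro image_eqI[of _ _ x]) (auto simp: deposits_iff)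
qed (auto simp: deposits_iff)

lemma Ent_image: "Ent t X = R (t + e) ` {x. x \<le> e \<and> supplies e (st t) X x}"
proof (intro equalityI subsetI)
  fix v assume v: "v \<in> Ent t X"
  then have "occ v (t + e)" by (simp add: Ent_def)
  from least_rep_ex[OF _ this] obtain x where "x \<le> e" "least_rep (st t) e x" "R (t + e) x = v" by auto
  then show "v \<in> R (t + e) ` {x. x \<le> e \<and> supplies e (st t) X x}"
    using v by (intro image_eqI[of _ _ x]) (auto simp: supplies_iff)
qed (auto simp: supplies_iff)

lemma ndep_card: "ndep e (st t) X = card (Dep t X)" and finite_Dep: "finite (Dep t X)"
proof -
  have "inj_on (R t) {x. x \<le> e \<and> deposits e (st t) X x}"
    by (rule inj_on_subset[OF least_rep_inj[of 0 t, simplified]]) (auto simp: deposits_def)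
  then show "ndep e (st t) X = card (Dep t X)" unfolding ndep_def Dep_image by (simp add: card_image)
  show "finite (Dep t X)" unfolding Dep_image by simp
qed

lemma nsup_card: "nsup e (st t) X = card (Ent t X)" and finite_Ent: "finite (Ent t X)"
proof -
  have "inj_on (R (t + e)) {x. x \<le> e \<and> supplies e (st t) X x}"
    by (rule inj_on_subset[OF least_rep_inj[of e t, simplified]]) (auto simp: supplies_def)
  then show "nsup e (st t) X = card (Ent t X)" unfolding nsup_def Ent_image by (simp add: card_image)
  show "finite (Ent t X)" unfolding Ent_image by simp
qed

lemma finite_Out: "finite (Out t X)"
proof (rule finite_subset)
  show "Out t X \<subseteq> (\<Union>p<t. R p ` {..e})" unfolding Out_def occ_def by auto
qed auto

lemma future_shift: "p \<le> q \<Longrightarrow> (\<And>j. p \<le> j \<Longrightarrow> j < q \<Longrightarrow> \<not> occ v j) \<Longrightarrow> future v p X \<longleftrightarrow> future v q X"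
proof -
  assume *: "p \<le> q" "\<And>j. p \<le> j \<Longrightarrow> j < q \<Longrightarrow> \<not> occ v j"
  have "(\<exists>j\<ge>p. R j y = v) \<longleftrightarrow> (\<exists>j\<ge>q. R j y = v)" if "y \<le> e" for y
    using * that unfolding occ_def by (metis le_trans not_le)
  then show ?thesis unfolding future_def by simp
qed

text \<open>When the window moves on, an absent value stays absent or enters at the new last
  position. Its label does not change meanwhile, because it does not occur.\<close>

lemma Out_step: "Out t X \<union> Dep t X \<subseteq> Out (Suc t) X \<union> Ent (Suc t) X"
proof
  fix v assume v: "v \<in> Out t X \<union> Dep t X"
  have n: "\<not> occ v q" if "Suc t \<le> q" "q < Suc t + e" for q
    using v that by (auto simp: Out_def Dep_def gap_def)
  have f: "future v (Suc t) X"
    using v future_shift[of t "Suc t" v X] by (auto simp: Out_def Dep_def le_less_Suc_eq)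
  have p: "\<exists>p<Suc t. occ v p" using v by (auto simp: Out_def Dep_def intro: less_SucI)
  show "v \<in> Out (Suc t) X \<union> Ent (Suc t) X"
  proof (cases "occ v (Suc t + e)")
    case True
    then have "v \<in> Ent (Suc t) X" using n f future_shift[of "Suc t" "Suc t + e" v X] by (auto simp: Ent_def)
    then show ?thesis ..
  next
    case False
    have "\<not> occ v q" if "Suc t \<le> q" "q \<le> Suc t + e" for q
      using n[of q] False that by (cases "q = Suc t + e") auto
    then have "v \<in> Out (Suc t) X" using f p by (auto simp: Out_def)
    then show ?thesis ..
  qed
qed

text \<open>Equality can fail, since \<open>Ent\<close> also counts values that occur for the first
  time, and the counter lets these consume tokens too. An upper bound is what the zero test
  needs.\<close>

lemma tokens_le: "tokens e st t X \<le> card (Out t X)"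
proof (induction t)
  case (Suc t)
  have "tokens e st t X + card (Dep t X) \<le> card (Out t X) + card (Dep t X)" using Suc by simp
  also have "\<dots> = card (Out t X \<union> Dep t X)"
    by (intro card_Un_disjoint[symmetric] finite_Out finite_Dep) (auto simp: Out_def Dep_def)
  also have "\<dots> \<le> card (Out (Suc t) X \<union> Ent (Suc t) X)"
    by (intro card_mono Out_step) (simp add: finite_Out finite_Ent)
  also have "\<dots> \<le> card (Out (Suc t) X) + card (Ent (Suc t) X)" by (rule card_Un_le)
  finally show ?case by (simp add: ndep_card nsup_card)
qed simp

text \<open>A nonempty label promises a return, and the first return is a consumer of that label. So
  once the consumers have ceased, no value is absent with label \<open>X\<close>.\<close>

lemma quiet_after:
  assumes X: "0 < X" "X < ntypes e" and T: "\<And>t. T \<le> t \<Longrightarrow> nsup e (st t) X = 0" and t: "T \<le> t"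
  shows "tokens e st t X = 0" "ndep e (st t) X = 0"
proof -
  obtain y where y: "mem y X" using X(1) by (metis set_decode_0 set_decode_inverse set_encode_empty ex_in_conv less_numeral_extra(3))
  then have ye: "y \<le> e" using mem_bound[of y X "Suc e"] X(2) by (simp add: ntypes_def)
  have S: "Ent t X = {}" if "T \<le> t" for t
    using T[OF that] finite_Ent[of t X] by (simp add: nsup_card)
  have O: "Out t X = {}" if t: "T \<le> t" for t
  proof (rule ccontr)
    assume "Out t X \<noteq> {}"
    then obtain v where v: "v \<in> Out t X" by blast
    then obtain j where "j \<ge> t" "R j y = v" using y ye by (auto simp: Out_def future_def)
    then have j: "t \<le> j \<and> occ v j" using ye by (auto simp: occ_def)
    let ?p = "LEAST j. t \<le> j \<and> occ v j"
    have p: "t \<le> ?p" "occ v ?p" using LeastI[of "\<lambda>j. t \<le> j \<and> occ v j", OF j] by auto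
    have n: "\<not> occ v q" if "t \<le> q" "q < ?p" for q
      using not_less_Least[of q "\<lambda>j. t \<le> j \<and> occ v j"] that by blast
    have "t + e < ?p" using v p by (auto simp: Out_def not_le[symmetric])
    then have e: "?p - e + e = ?p" "t \<le> ?p - e" by auto
    have "future v ?p X" using future_shift[of t ?p v X] p(1) n v by (auto simp: Out_def)
    then have "v \<in> Ent (?p - e) X" using p n e by (auto simp: Ent_def)
    then show False using S e(2) t by (metis empty_iff le_trans)
  qed
  show "tokens e st t X = 0" using tokens_le[of t X] O[OF t] by simp
  have "Dep t X = {}" using Out_step[of t X] O[of "Suc t"] S[of "Suc t"] t by auto
  then show "ndep e (st t) X = 0" by (simp add: ndep_card)
qed

text \<open>If the consumer is not good for \<open>y\<close>, its segment ends without
  \<open>y\<close> and every variable of \<open>X\<close> recurs later. So the same value enters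
  again with the same label, closer to its occurrence \<open>j\<close>; this descent ends at a good
  consumer.\<close>

lemma good_from_supply:
  assumes s: "supplies e (st t) X x" "x \<le> e" and y: "mem y X" "y \<le> e"
    and j: "t + e \<le> j" "R j y = R (t + e) x"
  shows "\<exists>t'\<ge>t. \<exists>x\<le>e. good e (st t') X y x"
  using s j
proof (induction "j - (t + e)" arbitrary: t x rule: less_induct)
  case (less t x)
  define v where "v = R (t + e) x"
  show ?case
  proof (cases "good e (st t) X y x")
    case False
    then have ng: "R (t + e) y \<noteq> v" "\<not> seen (t + e) x y" "\<And>z. z \<le> e \<Longrightarrow> mem z X \<Longrightarrow> later (t + e) x z"
      using less.prems(1,2) y(2) by (auto simp: good_def st_EQ st_IN st_FO v_def)
    then have "t + e < j" using less.prems v_def by (metis le_neq_implies_less)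
    then have "\<not> conn v (t + e) j" using ng(2) less.prems y(2) by (auto simp: seen_def v_def)
    then obtain q0 where q0: "t + e \<le> q0 \<and> gap v q0" "q0 < j" unfolding conn_def by blast
    \<comment> \<open>\<open>q\<close> is the end of the current segment; \<open>p\<close>, defined
      below, is the start of the next one.\<close>
    define q where "q = (LEAST q. t + e \<le> q \<and> gap v q)"
    have q12: "t + e \<le> q \<and> gap v q"
      unfolding q_def by (rule LeastI[of "\<lambda>q. t + e \<le> q \<and> gap v q", OF q0(1)])
    have ql: "q \<le> q'" if "t + e \<le> q'" "gap v q'" for q'
      unfolding q_def by (rule Least_le) (use that in blast)
    have q: "t + e \<le> q" "gap v q" "q < j" using q12 ql[of q0] q0 by auto
    have jo: "q < j \<and> occ v j" using q(3) less.prems y(2) by (auto simp: occ_def v_def)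
    define p where "p = (LEAST j. q < j \<and> occ v j)"
    have p12: "q < p \<and> occ v p"
      unfolding p_def by (rule LeastI[of "\<lambda>j. q < j \<and> occ v j", OF jo])
    moreover have "p \<le> j" unfolding p_def by (rule Least_le) (rule jo)
    ultimately have p: "q < p" "occ v p" "p \<le> j" by auto
    have n: "\<not> occ v i" if "q < i" "i < p" for i
      using not_less_Least[of i "\<lambda>j. q < j \<and> occ v j"] that unfolding p_def by blast
    have qp: "q + e < p" using q(2) p unfolding gap_def by (metis not_le)
    define t' where "t' = p - e"
    have t': "p = t' + e" "q < t'" using qp by (auto simp: t'_def)
    have fut: "future v (t + e) X" using less.prems(1,2) by (simp add: supplies_iff Ent_def v_def)
    have "future v p X"
      unfolding future_def
    proof (intro allI impI iffI)
      fix z assume z: "z \<le> e"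
      { assume "\<exists>j\<ge>p. R j z = v"
        then have "\<exists>j\<ge>t + e. R j z = v"
          using q(1) p(1) le_trans[of "t + e" p] by (metis less_imp_le le_trans)
        then show "mem z X" using fut z by (simp add: future_def) }
      assume "mem z X"
      then obtain q' j' where q': "t + e \<le> q'" "gap v q'" "j' > q'" "R j' z = v"
        using ng(3)[OF z] unfolding later_def v_def by blast
      then have "q < j'" using ql[of q'] by simp
      moreover have "occ v j'" using q'(4) z by (auto simp: occ_def)
      ultimately have "p \<le> j'" using n by (metis not_le)
      then show "\<exists>j\<ge>p. R j z = v" using q'(4) by blast
    qed
    then have "v \<in> Ent t' X" using t' p n by (auto simp: Ent_def)
    moreover obtain x' where x': "x' \<le> e" "least_rep (st t') e x'" "R (t' + e) x' = v"
      using least_rep_ex[of e v t'] p t' by auto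
    ultimately have sx: "supplies e (st t') X x'" by (simp add: supplies_iff)
    have "\<exists>t''\<ge>t'. \<exists>x\<le>e. good e (st t'') X y x"
      by (rule less.hyps[OF _ sx x'(1)]) (use less.prems t' p q x' v_def in auto)
    moreover have "t \<le> t'" using t'(2) q(1) by simp
    ultimately show ?thesis using le_trans by blast
  qed (use less.prems in blast)
qed

lemma good_infinitely:
  assumes "infinite {t. 0 < nsup e (st t) X}" and y: "mem y X" "y \<le> e"
  shows "\<exists>t\<ge>T. \<exists>x\<le>e. good e (st t) X y x"
proof -
  obtain t where t: "t > T" "0 < nsup e (st t) X"
    using assms(1) unfolding infinite_nat_iff_unbounded by auto
  then obtain x where x: "x \<le> e" "supplies e (st t) X x" by (auto simp: nsup_def card_gt_0_iff)
  then obtain j where "t + e \<le> j" "R j y = R (t + e) x"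
    using y by (auto simp: supplies_iff Ent_def future_def)
  from good_from_supply[OF x(2,1) y this] t(1) show ?thesis by (meson le_trans less_imp_le)
qed

lemma until_closes: "\<exists>u\<ge>T. \<not> until_open e (st u) c"
proof (rule ccontr)
  assume "\<not> ?thesis"
  then have o: "until_open e (st u) c" if "T \<le> u" for u using that by blast
  from o[of T] obtain x y where c: "x \<le> e" "y \<le> e" "c = pr 7 (pr x y)"
    "holds lt \<sigma> T (Until (dec x) (dec y))" by (auto simp: until_open_def st_TT dec_simps)
  then obtain j where j: "T \<le> j" "holds lt \<sigma> j (dec y)" by auto
  from o[OF j(1)] show False using c j by (auto simp: until_open_def st_TT prod_encode_eq)
qed

text \<open>The finite horizon makes all these obligations vanish at position \<open>H\<close>, by
  \<open>due_less\<close>, so that the pending set can be empty at the end of the loop.\<close>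

definition "due H p x y \<longleftrightarrow> (if y \<le> e then \<exists>j>p. j \<le> H \<and> R j y = R p x
  else \<exists>q\<ge>p. q < H \<and> gap (R p x) q)"

lemma seen_due: "seen p x y \<Longrightarrow> \<exists>H. due H p x y"
  unfolding seen_def due_def by (auto split: if_splits)

lemma due_mono: "due H p x y \<Longrightarrow> H \<le> H' \<Longrightarrow> due H' p x y"
  unfolding due_def by (auto split: if_splits)

lemma due_less: "due H p x y \<Longrightarrow> p < H"
  unfolding due_def by (auto split: if_splits)

lemma due_transfer:
  assumes "due H t x y" "\<not> (y \<le> e \<and> (\<exists>n<e. R (t + Suc n) y = R t x))"
    and n: "n < e" "z \<le> e" "R (t + Suc n) z = R t x"
  shows "due H (t + Suc n) z y"
proof (cases "y \<le> e")
  case True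
  then obtain j where j: "j > t" "j \<le> H" "R j y = R t x" using assms(1) by (auto simp: due_def)
  have "t + Suc n < j"
  proof (rule ccontr)
    assume "\<not> t + Suc n < j"
    then have "j = t + Suc (j - Suc t)" "j - Suc t < e" using j n(1) by auto
    then show False using assms(2) True j(3) by metis
  qed
  then show ?thesis using True j n(3) by (auto simp: due_def)
next
  case False
  then obtain q where q: "q \<ge> t" "q < H" "gap (R t x) q" using assms(1) by (auto simp: due_def)
  have "occ (R t x) (t + Suc n)" using n by (auto simp: occ_def)
  then have "t + Suc n \<le> q" using gap_after[OF _ q(1) _ q(3)] n(1) by auto
  then show ?thesis using False q n(3) by (auto simp: due_def)
qed

definition "pending I H n t = {pr 0 c | c. c \<le> e \<and> (\<forall>u. n \<le> u \<and> u < t \<longrightarrow> until_open e (st u) c)} \<union>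
  {pr 1 (pr X y) | X y. X < ntypes e \<and> y \<le> e \<and> mem X I \<and> mem y X \<and>
     (\<forall>u. n \<le> u \<and> u < t \<longrightarrow> \<not> (\<exists>x\<le>e. good e (st (Suc u)) X y x))} \<union>
  {pr 2 (pr m (pr x y)) | m x y. m \<le> e \<and> x \<le> e \<and> y \<le> Suc e \<and> due H (t + m) x y}"

lemma pending_less: "pending I H n t \<subseteq> {..<W}"
proof -
  have "z < W" if "z \<in> pending I H n t" for z
    using that ntypes_ge[of e]
    by (auto simp: pending_def less_W1 less_W2 less_W3 simp del: One_nat_def)
  then show ?thesis by auto
qed

lemma mem_pending: "mem z (set_encode (pending I H n t)) \<longleftrightarrow> z \<in> pending I H n t"
  by (simp add: finite_subset[OF pending_less])

lemma pend_step_pending: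
  assumes "n \<le> t"
  shows "pend_step e (st t) (st (Suc t)) (set_encode (pending I H n t)) (set_encode (pending I H n (Suc t)))"
  unfolding pend_step_def mem_pending
proof (intro conjI allI impI; (elim conjE)?)
  fix c assume "c \<le> e" "pr 0 c \<in> pending I H n t" "until_open e (st t) c"
  then show "pr 0 c \<in> pending I H n (Suc t)" by (auto simp: pending_def prod_encode_eq less_Suc_eq)
next
  fix X y assume "pr 1 (pr X y) \<in> pending I H n t" "\<not> (\<exists>x\<le>e. good e (st (Suc t)) X y x)"
  then show "pr 1 (pr X y) \<in> pending I H n (Suc t)" by (auto simp: pending_def prod_encode_eq less_Suc_eq)
next
  fix m x y assume "m < e" "x \<le> e" "y \<le> Suc e" "pr 2 (pr (Suc m) (pr x y)) \<in> pending I H n t"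
  then show "pr 2 (pr m (pr x y)) \<in> pending I H n (Suc t)" by (auto simp: pending_def prod_encode_eq)
next
  fix x y k z assume *: "x \<le> e" "y \<le> Suc e" "pr 2 (pr 0 (pr x y)) \<in> pending I H n t"
    "\<not> (y \<le> e \<and> (\<exists>n<e. EQ (st t) 0 x (Suc n) y))" "k < e" "z \<le> e" "EQ (st t) 0 x (Suc k) z"
  then have "due H t x y" by (auto simp: pending_def prod_encode_eq)
  moreover have "\<not> (y \<le> e \<and> (\<exists>n<e. R (t + Suc n) y = R t x))"
    using *(1,4) by (auto simp: st_EQ)
  moreover have "R (t + Suc k) z = R t x" using * by (auto simp: st_EQ)
  ultimately have "due H (t + Suc k) z y" using due_transfer *(5,6) by blast
  then show "pr 2 (pr k (pr z y)) \<in> pending I H n (Suc t)" using * by (auto simp: pending_def prod_encode_eq)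
qed

text \<open>The loop starts when the labels outside \<open>I\<close> have no consumers any more, at
  a state that recurs infinitely often, and ends at a recurrence so late that all its obligations
  have been met.\<close>

lemma reach_of_model:
  assumes "holds lt \<sigma> 0 (dec e)"
  shows "\<exists>q<nctrl e. q_init e q \<and> sys.reach e q (\<lambda>_. 0)"
proof -
  define I where "I = set_encode {X. X < ntypes e \<and> infinite {t. 0 < nsup e (st t) X}}"
  have memI: "mem X I \<longleftrightarrow> X < ntypes e \<and> infinite {t. 0 < nsup e (st t) X}" for X
    unfolding I_def by (subst set_encode_inverse) auto
  have "\<exists>T. \<forall>X\<in>{X. X < ntypes e \<and> \<not> mem X I}. \<forall>t\<ge>T. nsup e (st t) X = 0"
  proof (rule finite_bound)
    fix X assume "X \<in> {X. X < ntypes e \<and> \<not> mem X I}"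
    then have "finite {t. 0 < nsup e (st t) X}" by (auto simp: memI)
    then obtain m where "\<forall>t\<in>{t. 0 < nsup e (st t) X}. t < m"
      unfolding finite_nat_set_iff_bounded by (rule exE)
    then have m: "t < m" if "0 < nsup e (st t) X" for t using that by simp
    have "nsup e (st t) X = 0" if "m \<le> t" for t using m[of t] that by (cases "nsup e (st t) X") auto
    then show "\<exists>T. \<forall>t\<ge>T. nsup e (st t) X = 0" by blast
  qed auto
  then obtain T where T: "\<And>X t. X < ntypes e \<Longrightarrow> \<not> mem X I \<Longrightarrow> T \<le> t \<Longrightarrow> nsup e (st t) X = 0" by auto
  have "finite (st ` UNIV)" by (rule finite_subset[of _ "{..<nstates e}"]) (auto simp: st_less)
  from pigeonhole_infinite[OF infinite_UNIV_nat this] obtain t0 where "infinite {t. st t = st t0}" by auto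
  then have often: "\<exists>t>m. st t = st t0" for m by (auto simp: infinite_nat_iff_unbounded)
  obtain n1 where n1: "T \<le> n1" "st n1 = st t0" using often[of T] less_imp_le by blast
  have "\<exists>H. \<forall>(m, x, y)\<in>{..e} \<times> {..e} \<times> {..Suc e}. seen (n1 + m) x y \<longrightarrow> due H (n1 + m) x y"
    by (rule finite_bound) (use seen_due due_mono in \<open>auto split: prod.splits\<close>)
  then obtain H where H: "\<And>m x y. m \<le> e \<Longrightarrow> x \<le> e \<Longrightarrow> y \<le> Suc e \<Longrightarrow> seen (n1 + m) x y \<Longrightarrow> due H (n1 + m) x y"
    by (auto simp del: atMost_Suc)
  have "\<exists>v. \<forall>c\<in>{..e}. \<exists>u\<ge>n1. u < v \<and> \<not> until_open e (st u) c"
    by (rule finite_bound) (use until_closes[of n1] less_le_trans in \<open>blast | simp\<close>)+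
  then obtain U where U: "\<And>c. c \<le> e \<Longrightarrow> \<exists>u\<ge>n1. u < U \<and> \<not> until_open e (st u) c" by auto
  have "\<exists>v. \<forall>(X, y)\<in>{(X, y). X < ntypes e \<and> y \<le> e \<and> mem X I \<and> mem y X}.
      \<exists>u\<ge>n1. u < v \<and> (\<exists>x\<le>e. good e (st (Suc u)) X y x)"
  proof (rule finite_bound, goal_cases)
    case 1
    show ?case by (rule finite_subset[of _ "{..<ntypes e} \<times> {..e}"]) auto
  next
    case (2 a)
    obtain X y where a: "a = (X, y)" by (cases a)
    have "infinite {t. 0 < nsup e (st t) X}" "mem y X" "y \<le> e" using 2 a by (auto simp: memI)
    from good_infinitely[OF this, of "Suc n1"] obtain t where
      "Suc n1 \<le> t" "\<exists>x\<le>e. good e (st t) X y x" by blast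
    then have "n1 \<le> t - 1 \<and> t - 1 < t \<and> (\<exists>x\<le>e. good e (st (Suc (t - 1))) X y x)" by simp
    then show ?case unfolding a by blast
  next
    case (3 a u v)
    then show ?case by (auto split: prod.splits intro: less_le_trans)
  qed
  then obtain G where G': "\<forall>(X, y)\<in>{(X, y). X < ntypes e \<and> y \<le> e \<and> mem X I \<and> mem y X}.
      \<exists>u\<ge>n1. u < G \<and> (\<exists>x\<le>e. good e (st (Suc u)) X y x)" by (rule exE)
  have G: "\<exists>u\<ge>n1. u < G \<and> (\<exists>x\<le>e. good e (st (Suc u)) X y x)"
    if "X < ntypes e" "y \<le> e" "mem X I" "mem y X" for X y
    using bspec[OF G', of "(X, y)"] that by simp
  obtain n2 where "n1 + H + U + G < n2" "st n2 = st t0" using often by blast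
  then have n2: "n1 < n2" "H \<le> n2" "U \<le> n2" "G \<le> n2" "st n2 = st n1" using n1(2) by auto
  let ?P = "\<lambda>t. set_encode (pending I H n1 t)"
  have P2: "pending I H n1 n2 = {}"
  proof -
    have "z \<notin> pending I H n1 n2" for z
    proof
      assume "z \<in> pending I H n1 n2"
      then consider
        c where "c \<le> e" "\<forall>u. n1 \<le> u \<and> u < n2 \<longrightarrow> until_open e (st u) c"
      | X y where "X < ntypes e" "y \<le> e" "mem X I" "mem y X"
          "\<forall>u. n1 \<le> u \<and> u < n2 \<longrightarrow> \<not> (\<exists>x\<le>e. good e (st (Suc u)) X y x)"
      | m x y where "due H (n2 + m) x y" unfolding pending_def by blast
      then show False
      proof cases
        case 1 then show False using U n2(3) less_le_trans by blast
      next
        case 2 then show False using G n2(4) less_le_trans by blast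
      next
        case 3 then show False using due_less n2(2) by fastforce
      qed
    qed
    then show ?thesis by blast
  qed
  have pend0: "pend0 e (st n1) I (?P n1)"
    unfolding pend0_def mem_pending
  proof (intro conjI allI impI)
    fix m x y assume "m \<le> e" "x \<le> e" "y \<le> Suc e" "IN (st n1) m x y"
    then have "due H (n1 + m) x y" using H by (simp add: st_IN)
    then show "pr 2 (pr m (pr x y)) \<in> pending I H n1 n1"
      using \<open>m \<le> e\<close> \<open>x \<le> e\<close> \<open>y \<le> Suc e\<close> by (auto simp: pending_def)
  qed (auto simp: pending_def)
  \<comment> \<open>The phase switch does not advance the position, so indices \<open>n1\<close> and
    \<open>n1 + 1\<close> carry the same state, and from then on index \<open>u\<close> stands for
    position \<open>u - 1\<close>.\<close>
  define qs where "qs u = (if u \<le> n1 then pr 0 (pr (st u) (pr 0 (pr 0 0)))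
    else pr 1 (pr (st (u - 1)) (pr (st n1) (pr I (?P (u - 1))))))" for u
  define Ms where "Ms = rec_nat (\<lambda>_. 0 :: nat) (\<lambda>u M X. M X + ndep e (qst (qs u)) X - nsup e (qst (qs (Suc u))) X)"
  have tokens_prefix: "Ms u X = tokens e st u X" if "u \<le> n1" for u X
    using that by (induction u arbitrary: X) (auto simp: Ms_def qs_def)
  have I_less: "I < nstates e"
    unfolding I_def nstates_def
    by (rule set_encode_less) (auto intro: less_trans[OF _ less_W1[of 0 "ntypes e"]]
        simp: less_le_trans[OF _ le_prod_encode_2])
  have P_less: "?P t < nstates e" for t
    unfolding nstates_def by (rule set_encode_less[OF pending_less])
  have qs_less: "qs u < nctrl e" for u
    unfolding qs_def nctrl_def less_Suc_eq_le using st_less I_less P_less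
    by (auto intro!: pr_mono simp: less_imp_le)
  have "sys.is_path e (Suc n2) qs Ms"
    unfolding sys.is_path_def
  proof (intro conjI allI impI)
    show "q_target (qs (Suc n2))" using n2 P2 by (simp add: q_target_def qs_def)
    fix u assume u: "u < Suc n2"
    show "qs (Suc u) < nctrl e" by (rule qs_less)
    show "Ms (Suc u) X = Ms u X + ndep e (qst (qs u)) X - nsup e (qst (qs (Suc u))) X" for X
      by (simp add: Ms_def)
    consider "u < n1" | "u = n1" | t where "u = Suc t" "n1 \<le> t"
      by (metis less_Suc_eq_le not_less_iff_gr_or_eq old.nat.exhaust zero_less_iff_neq_zero less_nat_zero_code)
    then show "q_step e (qs u) (Ms u) (qs (Suc u))"
    proof cases
      case 1
      then show ?thesis by (simp add: q_step_def qs_def ok_st stp_st)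
    next
      case 2
      have "Ms u X = 0" if "X < ntypes e" "0 < X" "\<not> mem X I" for X
        using quiet_after(1)[OF that(2,1) T n1(1)] that tokens_prefix[of u X] 2 by auto
      then show ?thesis using 2 pend0 by (simp add: q_step_def qs_def ok_st)
    next
      case (3 t)
      have "quiet e (st t) (st (Suc t)) I"
        unfolding quiet_def
      proof (intro allI impI)
        fix X assume X: "X < ntypes e" "0 < X" "\<not> mem X I"
        show "ndep e (st t) X = 0 \<and> nsup e (st (Suc t)) X = 0"
          using quiet_after(2)[OF X(2,1) T[OF X(1,3)], of n1 t] T[OF X(1,3)] 3(2) n1(1) by auto
      qed
      then show ?thesis using 3 pend_step_pending[OF 3(2)]
        by (simp add: q_step_def qs_def ok_st stp_st)
    qed
  qed
  from sys.path_reach[OF this] have "sys.reach e (qs 0) (\<lambda>_. 0)" by (simp add: Ms_def)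
  moreover have "q_init e (qs 0)" using assms by (simp add: q_init_def qs_def ok_st iniT_st)
  ultimately show ?thesis using qs_less by blast
qed

end

section \<open>Matchings and dense orders\<close>

lemma infinite_representatives:
  fixes S :: "nat \<Rightarrow> 'a set"
  assumes "\<And>n. infinite (S n)"
  shows "\<exists>h. inj h \<and> (\<forall>n. h n \<in> S n)"
proof -
  \<comment> \<open>\<open>g n\<close> lists the first \<open>n\<close> choices, the latest one
    first; each choice avoids the finitely many before it.\<close>
  define g where "g = rec_nat [] (\<lambda>n xs. (SOME a. a \<in> S n - set xs) # xs)"
  define h where "h n = hd (g (Suc n))" for n
  have g: "g (Suc n) = h n # g n" for n by (simp add: g_def h_def)
  have h: "h n \<in> S n - set (g n)" for n
  proof -
    have "S n - set (g n) \<noteq> {}" using assms[of n] by (metis List.finite_set finite_Diff2 finite.emptyI)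
    then have "(SOME a. a \<in> S n - set (g n)) \<in> S n - set (g n)" by (metis ex_in_conv someI_ex)
    then show ?thesis by (simp add: h_def g_def)
  qed
  have sub: "h m \<in> set (g n)" if "m < n" for m n
    using that by (induction n) (auto simp: g less_Suc_eq)
  have "inj h"
  proof (rule injI)
    fix m n assume "h m = h n"
    then show "m = n" using sub[of m n] sub[of n m] h[of m] h[of n]
      by (cases m n rule: linorder_cases) auto
  qed
  then show ?thesis using h by blast
qed

text \<open>Greedy matching: each batch of consumers serves as many waiting deposits as possible, so
  the number left waiting obeys the truncated recursion of \<open>M\<close>. Only the cardinality of
  the rest is tracked, so an arbitrary subset may be served.\<close>

lemma fifo_matching:
  fixes d b :: "nat \<Rightarrow> 'a set"
  assumes fin: "\<And>t. finite (d t)" "\<And>t. finite (b t)"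
    and M: "M 0 = 0" "\<And>t. M (Suc t) = M t + card (d t) - card (b (Suc t))"
  shows "\<exists>f U. U \<subseteq> {(t, x). t < n \<and> x \<in> d t} \<and> finite U \<and> card U = M n \<and>
    inj_on f ({(t, x). t < n \<and> x \<in> d t} - U) \<and>
    (\<forall>z\<in>{(t, x). t < n \<and> x \<in> d t} - U. fst z < fst (f z) \<and> fst (f z) \<le> n \<and> snd (f z) \<in> b (fst (f z)))"
proof (induction n)
  case 0
  show ?case by (intro exI[of _ id] exI[of _ "{}"]) (auto simp: M)
next
  case (Suc n)
  define D where "D n = {(t, x). t < n \<and> x \<in> d t}" for n
  obtain f U where fU: "U \<subseteq> D n" "finite U" "card U = M n" "inj_on f (D n - U)"
    "\<And>z. z \<in> D n - U \<Longrightarrow> fst z < fst (f z) \<and> fst (f z) \<le> n \<and> snd (f z) \<in> b (fst (f z))"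
    using Suc unfolding D_def[symmetric] by blast
  define U1 where "U1 = U \<union> {n} \<times> d n"
  have finU1: "finite U1" using fU(2) fin by (simp add: U1_def)
  have cU1: "card U1 = M n + card (d n)"
    unfolding U1_def using fU(1,2,3) fin by (subst card_Un_disjoint) (auto simp: D_def card_cartesian_product)
  have DS: "D (Suc n) = D n \<union> {n} \<times> d n" by (auto simp: D_def less_Suc_eq)
  obtain V where V: "V \<subseteq> U1" "card V = min (card U1) (card (b (Suc n)))"
    using obtain_subset_with_card_n[of "min (card U1) (card (b (Suc n)))" U1] by auto
  have finV: "finite V" using V(1) finU1 finite_subset by blast
  have "card V \<le> card ({Suc n} \<times> b (Suc n))" using V(2) by (simp add: card_cartesian_product)
  then obtain g where g: "g ` V \<subseteq> {Suc n} \<times> b (Suc n)" "inj_on g V"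
    using card_le_inj[OF finV, of "{Suc n} \<times> b (Suc n)"] fin by auto
  define f' where "f' z = (if z \<in> V then g z else f z)" for z
  have split: "D (Suc n) - (U1 - V) \<subseteq> V \<union> (D n - U)" unfolding DS U1_def by auto
  have notU: "z \<in> D n - U" if "z \<in> D (Suc n) - (U1 - V)" "z \<notin> V" for z using split that by auto
  have "inj_on f' (D (Suc n) - (U1 - V))"
  proof (rule inj_onI)
    fix z w assume z: "z \<in> D (Suc n) - (U1 - V)" and w: "w \<in> D (Suc n) - (U1 - V)" and eq: "f' z = f' w"
    have gS: "fst (g z) = Suc n" if "z \<in> V" for z using g(1) that by auto
    show "z = w"
    proof (cases "z \<in> V"; cases "w \<in> V")
      assume "z \<in> V" "w \<in> V"
      then show ?thesis using eq g(2) by (auto simp: f'_def inj_on_def)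
    next
      assume "z \<in> V" "w \<notin> V"
      then show ?thesis using eq gS[of z] fU(5)[OF notU[OF w]] by (auto simp: f'_def)
    next
      assume "z \<notin> V" "w \<in> V"
      then show ?thesis using eq gS[of w] fU(5)[OF notU[OF z]] by (auto simp: f'_def)
    next
      assume "z \<notin> V" "w \<notin> V"
      then show ?thesis using eq notU[OF z] notU[OF w] inj_onD[OF fU(4)] by (auto simp: f'_def)
    qed
  qed
  moreover have "fst z < fst (f' z) \<and> fst (f' z) \<le> Suc n \<and> snd (f' z) \<in> b (fst (f' z))"
    if z: "z \<in> D (Suc n) - (U1 - V)" for z
  proof (cases "z \<in> V")
    case True
    then have "g z \<in> {Suc n} \<times> b (Suc n)" using g(1) by blast
    moreover have "fst z < Suc n" using z by (auto simp: D_def)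
    ultimately show ?thesis using True by (auto simp: f'_def)
  next
    case False
    then show ?thesis using fU(5)[OF notU[OF z False]] by (simp add: f'_def)
  qed
  moreover have "U1 - V \<subseteq> D (Suc n)" using fU(1) unfolding U1_def DS by auto
  moreover have "card (U1 - V) = M (Suc n)"
    using V finV by (simp add: card_Diff_subset cU1 M(2))
  ultimately show ?case unfolding D_def[symmetric] using finU1 by (intro exI[of _ f'] exI[of _ "U1 - V"]) blast
qed

section \<open>Realising locally consistent order types\<close>

lemma finite_max:
  assumes "strict_total_order lt" "finite A" "A \<noteq> {}"
  shows "\<exists>m\<in>A. \<forall>a\<in>A. a = m \<or> lt a m"
  using assms(2,3)
proof (induction A rule: finite_ne_induct)
  case (insert a A)
  then obtain m where m: "m \<in> A" "\<forall>a\<in>A. a = m \<or> lt a m" by blast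
  show ?case
  proof (cases "lt a m")
    case False
    then have "\<forall>b\<in>insert a A. b = a \<or> lt b a"
      using m sto_total[OF assms(1)] sto_trans[OF assms(1)] by (metis insert_iff)
    then show ?thesis by blast
  qed (use m in blast)
qed simp

lemma sto_converse: "strict_total_order lt \<Longrightarrow> strict_total_order (\<lambda>x y. lt y x)"
  unfolding strict_total_order_def by blast

text \<open>It suffices to separate the maximum of \<open>A\<close> from the minimum of
  \<open>B\<close>. Density does this; openness takes over when just one of the sets is
  empty.\<close>

lemma between_sets:
  assumes sto: "strict_total_order lt" and dense: "dense_rel lt" and opn: "open_rel lt"
    and fin: "finite A" "finite B" and AB: "\<And>a b. a \<in> A \<Longrightarrow> b \<in> B \<Longrightarrow> lt a b"
  shows "\<exists>v. (\<forall>a\<in>A. lt a v) \<and> (\<forall>b\<in>B. lt v b)"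
proof -
  have up: "\<exists>v. (\<forall>a\<in>A. lt a v) \<and> lt v u" if ne: "A \<noteq> {}" and u: "\<And>a. a \<in> A \<Longrightarrow> lt a u" for u
  proof -
    obtain m where m: "m \<in> A" "\<forall>a\<in>A. a = m \<or> lt a m" using finite_max[OF sto fin(1) ne] by blast
    obtain v where "lt m v" "lt v u" using dense u[OF m(1)] unfolding dense_rel_def by blast
    then show ?thesis using m(2) by (metis sto_trans[OF sto])
  qed
  show ?thesis
  proof (cases "B = {}")
    case True
    show ?thesis
    proof (cases "A = {}")
      case False
      then obtain m where m: "m \<in> A" "\<forall>a\<in>A. a = m \<or> lt a m" using finite_max[OF sto fin(1)] by blast
      then obtain v where "lt m v" using opn unfolding open_rel_def by blast
      then show ?thesis using m(2) True by (metis sto_trans[OF sto] empty_iff)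
    qed (use True in simp)
  next
    case False
    then obtain u where u: "u \<in> B" "\<forall>b\<in>B. b = u \<or> lt u b"
      using finite_max[OF sto_converse[OF sto] fin(2)] by blast
    show ?thesis
    proof (cases "A = {}")
      case True
      obtain v where "lt v u" using opn unfolding open_rel_def by blast
      then show ?thesis using u(2) True by (metis sto_trans[OF sto] empty_iff)
    next
      case False
      then obtain v where "\<forall>a\<in>A. lt a v" "lt v u" using up[of u] AB u(1) by blast
      then show ?thesis using u(2) by (metis sto_trans[OF sto])
    qed
  qed
qed

text \<open>If \<open>i\<close> is equivalent to some element of \<open>J\<close>, it takes the
  value of that element. Otherwise the values below and above it are strictly separated, and a point
  fits between.\<close>

lemma one_point_extension:
  assumes sto: "strict_total_order lt" and dense: "dense_rel lt" and opn: "open_rel lt"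
    and fin: "finite J"
    and total: "\<And>a b. a \<in> insert i J \<Longrightarrow> b \<in> insert i J \<Longrightarrow> le a b \<or> le b a"
    and trans: "\<And>a b c. a \<in> insert i J \<Longrightarrow> b \<in> insert i J \<Longrightarrow> c \<in> insert i J \<Longrightarrow> le a b \<Longrightarrow> le b c \<Longrightarrow> le a c"
    and h: "\<And>a b. a \<in> J \<Longrightarrow> b \<in> J \<Longrightarrow> le a b \<longleftrightarrow> \<not> lt (h b) (h a)"
  shows "\<exists>v. \<forall>j\<in>J. (le j i \<longleftrightarrow> \<not> lt v (h j)) \<and> (le i j \<longleftrightarrow> \<not> lt (h j) v)"
proof (cases "\<exists>j\<in>J. le j i \<and> le i j")
  case True
  then obtain k where k: "k \<in> J" "le k i" "le i k" by blast
  have "(le j i \<longleftrightarrow> \<not> lt (h k) (h j)) \<and> (le i j \<longleftrightarrow> \<not> lt (h j) (h k))" if "j \<in> J" for j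
    using that k trans[of j i k] trans[of j k i] trans[of i k j] trans[of k i j] h[of j k] h[of k j] by auto
  then show ?thesis by blast
next
  case False
  have lt: "lt (h a) (h b)" if "a \<in> {j\<in>J. le j i}" "b \<in> {j\<in>J. le i j}" for a b
  proof -
    have "\<not> le b a" using that False trans[of i b a] by auto
    then show ?thesis using h[of b a] that by auto
  qed
  have "\<exists>v. (\<forall>a\<in>h ` {j\<in>J. le j i}. lt a v) \<and> (\<forall>b\<in>h ` {j\<in>J. le i j}. lt v b)"
    by (rule between_sets[OF sto dense opn]) (use fin lt in auto)
  then obtain v where v: "\<And>j. j \<in> J \<Longrightarrow> le j i \<Longrightarrow> lt (h j) v" "\<And>j. j \<in> J \<Longrightarrow> le i j \<Longrightarrow> lt v (h j)" by auto
  have "(le j i \<longleftrightarrow> \<not> lt v (h j)) \<and> (le i j \<longleftrightarrow> \<not> lt (h j) v)" if "j \<in> J" for j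
    using v[OF that] total[of j i] that False sto_trans[OF sto, of "h j" v "h j"] sto_irrefl[OF sto, of "h j"] by blast
  then show ?thesis by blast
qed

text \<open>The earlier neighbours of \<open>i\<close> are pairwise near, so on them
  \<open>le\<close> is a total preorder that is already realised, and the value of \<open>i\<close>
  is a one-point extension. Points that are not near are left unconstrained.\<close>

lemma order_realisation:
  fixes lt :: "'d \<Rightarrow> 'd \<Rightarrow> bool" and le near :: "nat \<Rightarrow> nat \<Rightarrow> bool"
  assumes sto: "strict_total_order lt" and dense: "dense_rel lt" and opn: "open_rel lt"
    and near: "\<And>i j k. j \<le> i \<Longrightarrow> k \<le> i \<Longrightarrow> near j i \<Longrightarrow> near k i \<Longrightarrow> near j k"
    and refl: "\<And>i. near i i" and sym: "\<And>i j. near i j \<Longrightarrow> near j i"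
    and total: "\<And>a b. near a b \<Longrightarrow> le a b \<or> le b a"
    and trans: "\<And>a b c. near a b \<Longrightarrow> near b c \<Longrightarrow> near a c \<Longrightarrow> le a b \<Longrightarrow> le b c \<Longrightarrow> le a c"
  shows "\<exists>f. \<forall>i j. near i j \<longrightarrow> (le i j \<longleftrightarrow> \<not> lt (f j) (f i))"
proof -
  define ext where "ext g i v \<longleftrightarrow> (\<forall>j\<in>{j. j < i \<and> near j i}. (le j i \<longleftrightarrow> \<not> lt v (g j)) \<and> (le i j \<longleftrightarrow> \<not> lt (g j) v))"
    for g :: "nat \<Rightarrow> 'd" and i v
  define g where "g = rec_nat undefined (\<lambda>i g. g(i := SOME v. ext g i v))"
  define f where "f i = g (Suc i) i" for i
  have gS: "g (Suc i) = (g i)(i := SOME v. ext (g i) i v)" for i by (simp add: g_def)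
  have gf: "j < n \<Longrightarrow> g n j = f j" for j n
    by (induction n) (auto simp: gS f_def less_Suc_eq)
  have ext_gf: "ext (g i) i v \<longleftrightarrow> ext f i v" for i v by (auto simp: ext_def gf)
  have main: "\<forall>j\<le>i. \<forall>k\<le>i. near j k \<longrightarrow> (le j k \<longleftrightarrow> \<not> lt (f k) (f j))" for i
  proof (induction i rule: less_induct)
    case (less i)
    have IH: "le j k \<longleftrightarrow> \<not> lt (f k) (f j)" if "j < i" "k < i" "near j k" for j k
      using less[of "max j k"] that by auto
    have n: "near a b" if "a \<in> insert i {j. j < i \<and> near j i}" "b \<in> insert i {j. j < i \<and> near j i}" for a b
      using that near[of a i b] refl sym by auto
    have "\<exists>v. \<forall>j\<in>{j. j < i \<and> near j i}. (le j i \<longleftrightarrow> \<not> lt v (f j)) \<and> (le i j \<longleftrightarrow> \<not> lt (f j) v)"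
    proof (rule one_point_extension[OF sto dense opn])
      show "le a b \<or> le b a" if "a \<in> insert i {j. j < i \<and> near j i}" "b \<in> insert i {j. j < i \<and> near j i}" for a b
        by (rule total[OF n[OF that]])
      show "le a c" if "a \<in> insert i {j. j < i \<and> near j i}" "b \<in> insert i {j. j < i \<and> near j i}"
        "c \<in> insert i {j. j < i \<and> near j i}" "le a b" "le b c" for a b c
        by (rule trans[OF n[OF that(1,2)] n[OF that(2,3)] n[OF that(1,3)] that(4,5)])
      show "le a b \<longleftrightarrow> \<not> lt (f b) (f a)" if "a \<in> {j. j < i \<and> near j i}" "b \<in> {j. j < i \<and> near j i}" for a b
        using IH[of a b] n[of a b] that by simp
    qed simp
    then have "\<exists>v. ext (g i) i v" unfolding ext_gf by (simp add: ext_def)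
    then have "ext (g i) i (SOME v. ext (g i) i v)" by (rule someI_ex)
    then have "ext (g i) i (f i)" by (simp add: f_def gS)
    then have e: "ext f i (f i)" unfolding ext_gf .
    show ?case
    proof (intro allI impI)
      fix j k assume jk: "j \<le> i" "k \<le> i" "near j k"
      consider "j < i" "k < i" | "j = i" "k < i" | "j < i" "k = i" | "j = i" "k = i" using jk by linarith
      then show "le j k \<longleftrightarrow> \<not> lt (f k) (f j)"
      proof cases
        case 4
        then show ?thesis using total[OF refl, of i] sto_irrefl[OF sto] by auto
      qed (use IH jk e sym in \<open>auto simp: ext_def\<close>)
    qed
  qed
  have "le i j \<longleftrightarrow> \<not> lt (f j) (f i)" if "near i j" for i j
    using main[of "max i j"] that by simp
  then show ?thesis by blast
qed

section \<open>From runs to models\<close>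

text \<open>A finite derivation that a promise is not postponed forever; being inductive, it
  excludes an infinite sequence of \<open>moves\<close>.\<close>

inductive resolved :: "nat \<Rightarrow> (nat \<Rightarrow> nat) \<Rightarrow> nat \<Rightarrow> nat \<Rightarrow> nat \<Rightarrow> bool" for e s where
  seen: "y \<le> e \<Longrightarrow> n < e \<Longrightarrow> EQ (s p) 0 x (Suc n) y \<Longrightarrow> resolved e s p x y"
| leaves: "leaving e (s p) x \<Longrightarrow> resolved e s p x y"
| moves: "n < e \<Longrightarrow> z \<le> e \<Longrightarrow> EQ (s p) 0 x (Suc n) z \<Longrightarrow> resolved e s (p + Suc n) z y \<Longrightarrow> resolved e s p x y"

text \<open>The properties of an unrolled lasso that determine the remote values. \<open>T\<close>
  is the start of the loop; \<open>good_inf\<close> and \<open>resolves\<close> are its fairness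
  conditions.\<close>

locale run =
  fixes e T I :: nat and s :: "nat \<Rightarrow> nat"
  assumes ok: "ok e (s t)" and stp: "stp e (s t) (s (Suc t))"
    and tokens0: "0 < X \<Longrightarrow> X < ntypes e \<Longrightarrow> \<not> mem X I \<Longrightarrow> tokens e s T X = 0"
    and quiet: "T \<le> t \<Longrightarrow> quiet e (s t) (s (Suc t)) I"
    and good_inf: "X < ntypes e \<Longrightarrow> mem X I \<Longrightarrow> y \<le> e \<Longrightarrow> mem y X \<Longrightarrow>
      \<exists>t\<ge>N. \<exists>x\<le>e. good e (s (Suc t)) X y x"
    and resolves: "m \<le> e \<Longrightarrow> x \<le> e \<Longrightarrow> y \<le> Suc e \<Longrightarrow> IN (s t) m x y \<Longrightarrow> resolved e s (t + m) x y"
begin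

lemma shifted_s: "shifted e (s t) (s (Suc t))"
  using stp[of t] by (simp add: stp_def)

lemma shift_by:
  "m + d \<le> e \<Longrightarrow> n + d \<le> e \<Longrightarrow> x \<le> e \<Longrightarrow> y \<le> e \<Longrightarrow>
    (EQ (s t) (m + d) x (n + d) y \<longleftrightarrow> EQ (s (t + d)) m x n y) \<and>
    (LE (s t) (m + d) x (n + d) y \<longleftrightarrow> LE (s (t + d)) m x n y)"
proof (induction d arbitrary: t)
  case (Suc d)
  then show ?case using shifted_s[of t] Suc.IH[of "Suc t"] by (simp add: shifted_def)
qed simp

lemmas EQ_shift = shift_by[THEN conjunct1] and LE_shift = shift_by[THEN conjunct2]

lemma FO_shift: "m \<le> e \<Longrightarrow> x \<le> e \<Longrightarrow> y \<le> e \<Longrightarrow> FO (s t) m x y \<longleftrightarrow> FO (s (t + m)) 0 x y"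
  and IN_shift: "m \<le> e \<Longrightarrow> x \<le> e \<Longrightarrow> y \<le> Suc e \<Longrightarrow> IN (s t) m x y \<longleftrightarrow> IN (s (t + m)) 0 x y"
proof (induction m arbitrary: t)
  case (Suc m)
  { case 1 then show ?case using shifted_s[of t] Suc.IH(1)[of "Suc t"] by (simp add: shifted_def) }
  { case 2 then show ?case using shifted_s[of t] Suc.IH(2)[of "Suc t"] by (simp add: shifted_def) }
qed simp_all

section \<open>Equality and order across overlapping windows\<close>

definition "geq p x q y \<longleftrightarrow> EQ (s (min p q)) (p - min p q) x (q - min p q) y"
definition "gle p x q y \<longleftrightarrow> LE (s (min p q)) (p - min p q) x (q - min p q) y"

text \<open>Overlapping windows agree, so any window containing both positions may replace the last
  such window, which starts at \<open>min p q\<close>.\<close>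

lemma geq_at:
  assumes "t \<le> p" "t \<le> q" "p \<le> t + e" "q \<le> t + e" "x \<le> e" "y \<le> e"
  shows "EQ (s t) (p - t) x (q - t) y \<longleftrightarrow> geq p x q y"
  using EQ_shift[of "p - min p q" "min p q - t" "q - min p q" x y t] assms
  by (cases "p \<le> q") (auto simp: geq_def)

lemma gle_at:
  assumes "t \<le> p" "t \<le> q" "p \<le> t + e" "q \<le> t + e" "x \<le> e" "y \<le> e"
  shows "LE (s t) (p - t) x (q - t) y \<longleftrightarrow> gle p x q y"
  using LE_shift[of "p - min p q" "min p q - t" "q - min p q" x y t] assms
  by (cases "p \<le> q") (auto simp: gle_def)

lemma geq_EQ: "m \<le> e \<Longrightarrow> n \<le> e \<Longrightarrow> x \<le> e \<Longrightarrow> y \<le> e \<Longrightarrow> EQ (s t) m x n y \<longleftrightarrow> geq (t + m) x (t + n) y"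
  using geq_at[of t "t + m" "t + n" x y] by simp

lemma gle_LE: "m \<le> e \<Longrightarrow> n \<le> e \<Longrightarrow> x \<le> e \<Longrightarrow> y \<le> e \<Longrightarrow> LE (s t) m x n y \<longleftrightarrow> gle (t + m) x (t + n) y"
  using gle_at[of t "t + m" "t + n" x y] by simp

lemma okL_s: "okL e (s t)" and okE_s: "okE e (s t)" and okI_s: "okI e (s t)" and okF_s: "okF e (s t)"
  using ok[of t] unfolding ok_def by blast+

lemma LE_trans: "m \<le> e \<Longrightarrow> x \<le> e \<Longrightarrow> n \<le> e \<Longrightarrow> y \<le> e \<Longrightarrow> l \<le> e \<Longrightarrow> z \<le> e \<Longrightarrow>
    LE (s t) m x n y \<Longrightarrow> LE (s t) n y l z \<Longrightarrow> LE (s t) m x l z"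
  using okL_s[of t] unfolding okL_def by blast

lemma EQ_sym: "m \<le> e \<Longrightarrow> x \<le> e \<Longrightarrow> n \<le> e \<Longrightarrow> y \<le> e \<Longrightarrow> EQ (s t) m x n y \<Longrightarrow> EQ (s t) n y m x"
  and EQ_trans: "m \<le> e \<Longrightarrow> x \<le> e \<Longrightarrow> n \<le> e \<Longrightarrow> y \<le> e \<Longrightarrow> l \<le> e \<Longrightarrow> z \<le> e \<Longrightarrow>
    EQ (s t) m x n y \<Longrightarrow> EQ (s t) n y l z \<Longrightarrow> EQ (s t) m x l z"
  using okE_s[of t] unfolding okE_def by blast+

lemma IN_direct: "m \<le> e \<Longrightarrow> x \<le> e \<Longrightarrow> n \<le> e \<Longrightarrow> z \<le> e \<Longrightarrow> EQ (s t) m x n z \<Longrightarrow> m < n \<Longrightarrow> IN (s t) m x z"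
  and IN_back: "m \<le> e \<Longrightarrow> x \<le> e \<Longrightarrow> n \<le> e \<Longrightarrow> z \<le> e \<Longrightarrow> EQ (s t) m x n z \<Longrightarrow> m \<le> n \<Longrightarrow>
    y \<le> Suc e \<Longrightarrow> IN (s t) n z y \<Longrightarrow> IN (s t) m x y"
  and IN_forward: "m \<le> e \<Longrightarrow> x \<le> e \<Longrightarrow> n \<le> e \<Longrightarrow> z \<le> e \<Longrightarrow> EQ (s t) m x n z \<Longrightarrow> m \<le> n \<Longrightarrow>
    y \<le> Suc e \<Longrightarrow> IN (s t) m x y \<Longrightarrow> IN (s t) n z y \<or> y \<le> e \<and> (\<exists>k\<le>n. m < k \<and> EQ (s t) m x k y)"
  using okI_s[of t] unfolding okI_def by blast+

lemma gle_total:
  assumes "p \<le> q + e" "q \<le> p + e" "x \<le> e" "y \<le> e"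
  shows "gle p x q y \<or> gle q y p x"
proof -
  let ?t = "min p q"
  have "LE (s ?t) (p - ?t) x (q - ?t) y \<or> LE (s ?t) (q - ?t) y (p - ?t) x"
    using okL_s[of ?t, unfolded okL_def, rule_format, of "p - ?t" x "q - ?t" y] assms by linarith
  then show ?thesis using gle_at[of ?t p q x y] gle_at[of ?t q p y x] assms by auto
qed

lemma gle_trans:
  assumes "t \<le> p" "t \<le> q" "t \<le> r" "p \<le> t + e" "q \<le> t + e" "r \<le> t + e" "x \<le> e" "y \<le> e" "z \<le> e"
    "gle p x q y" "gle q y r z"
  shows "gle p x r z"
proof -
  have "LE (s t) (p - t) x (q - t) y \<and> LE (s t) (q - t) y (r - t) z \<longrightarrow> LE (s t) (p - t) x (r - t) z"
    using LE_trans[of "p - t" x "q - t" y "r - t" z t] assms by auto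
  then show ?thesis using gle_at[of t p q x y] gle_at[of t q r y z] gle_at[of t p r x z] assms by blast
qed

lemma geq_refl: "x \<le> e \<Longrightarrow> geq p x p x"
  using okE_s[of p, unfolded okE_def, rule_format, of 0 x] by (simp add: geq_def)

lemma geq_sym:
  assumes "p \<le> q + e" "q \<le> p + e" "x \<le> e" "y \<le> e" "geq p x q y"
  shows "geq q y p x"
proof -
  let ?t = "min p q"
  have "EQ (s ?t) (p - ?t) x (q - ?t) y \<longrightarrow> EQ (s ?t) (q - ?t) y (p - ?t) x"
    using EQ_sym[of "p - ?t" x "q - ?t" y ?t] assms by auto
  then show ?thesis using geq_at[of ?t p q x y] geq_at[of ?t q p y x] assms by auto
qed

text \<open>Transitivity is available only inside one window; beyond it, equality of values has to
  be rebuilt from chains of nodes.\<close>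

lemma geq_trans:
  assumes "t \<le> p" "t \<le> q" "t \<le> r" "p \<le> t + e" "q \<le> t + e" "r \<le> t + e" "x \<le> e" "y \<le> e" "z \<le> e"
    "geq p x q y" "geq q y r z"
  shows "geq p x r z"
proof -
  have "EQ (s t) (p - t) x (q - t) y \<and> EQ (s t) (q - t) y (r - t) z \<longrightarrow> EQ (s t) (p - t) x (r - t) z"
    using EQ_trans[of "p - t" x "q - t" y "r - t" z t] assms by auto
  then show ?thesis using geq_at[of t p q x y] geq_at[of t q r y z] geq_at[of t p r x z] assms by blast
qed

abbreviation "INp p x y \<equiv> IN (s p) 0 x y"
abbreviation "FOp p x y \<equiv> FO (s p) 0 x y"

lemma INp_direct:
  assumes "p < q" "q \<le> p + e" "x \<le> e" "z \<le> e" "geq p x q z"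
  shows "INp p x z"
proof -
  have "EQ (s p) 0 x (q - p) z" using geq_at[of p p q x z] assms by simp
  then show ?thesis using IN_direct[of 0 x "q - p" z p] assms by auto
qed

lemma INp_back:
  assumes "p \<le> q" "q \<le> p + e" "x \<le> e" "z \<le> e" "y \<le> Suc e" "geq p x q z" "INp q z y"
  shows "INp p x y"
proof -
  have "EQ (s p) 0 x (q - p) z" using geq_at[of p p q x z] assms by simp
  moreover have "IN (s p) (q - p) z y" using IN_shift[of "q - p" z y p] assms by simp
  moreover have "q - p \<le> e" using assms by simp
  ultimately show ?thesis using IN_back[of 0 x "q - p" z p y] assms by auto
qed

lemma INp_forward:
  assumes "p \<le> q" "q \<le> p + e" "x \<le> e" "z \<le> e" "y \<le> Suc e" "geq p x q z" "INp p x y"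
  shows "INp q z y \<or> y \<le> e \<and> (\<exists>r. p < r \<and> r \<le> q \<and> geq p x r y)"
proof -
  have "EQ (s p) 0 x (q - p) z" using geq_at[of p p q x z] assms by simp
  moreover have qp: "q - p \<le> e" using assms by simp
  ultimately have "IN (s p) (q - p) z y \<or> y \<le> e \<and> (\<exists>k\<le>q - p. 0 < k \<and> EQ (s p) 0 x k y)"
    using IN_forward[of 0 x "q - p" z p y] assms by auto
  then show ?thesis
  proof (elim disjE conjE exE)
    assume "IN (s p) (q - p) z y"
    then show ?thesis using IN_shift[of "q - p" z y p] assms by simp
  next
    fix k assume k: "y \<le> e" "k \<le> q - p" "0 < k" "EQ (s p) 0 x k y"
    then have "geq p x (p + k) y" using geq_EQ[of 0 k x y p] qp assms by simp
    then show ?thesis using k assms(1) by (intro disjI2 conjI exI[of _ "p + k"]) auto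
  qed
qed

lemma FOp_end: "x \<le> e \<Longrightarrow> y \<le> e \<Longrightarrow> FOp p x y \<Longrightarrow> INp p x (Suc e)"
  using okF_s[of p] unfolding okF_def by blast

lemma FOp_eq:
  assumes "p \<le> q" "q \<le> p + e" "x \<le> e" "z \<le> e" "y \<le> e" "geq p x q z"
  shows "FOp p x y \<longleftrightarrow> FOp q z y"
proof -
  have "EQ (s p) 0 x (q - p) z" using geq_at[of p p q x z] assms by simp
  moreover have qp: "q - p \<le> e" using assms by simp
  ultimately have "FO (s p) 0 x y \<longleftrightarrow> FO (s p) (q - p) z y"
    using okF_s[of p] assms unfolding okF_def by blast
  then show ?thesis using FO_shift[of "q - p" z y p] assms qp by simp
qed

lemma leaving_INp: "x \<le> e \<Longrightarrow> y \<le> e \<Longrightarrow> leaving e (s p) x \<Longrightarrow> \<not> INp p x y"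
  using okF_s[of p] unfolding okF_def by blast

lemma leaving_iff:
  assumes x: "x \<le> e"
  shows "leaving e (s p) x \<longleftrightarrow> (\<forall>r z. p < r \<and> r \<le> p + e \<and> z \<le> e \<longrightarrow> \<not> geq p x r z)"
proof (intro iffI allI impI notI)
  fix r z assume l: "leaving e (s p) x" and r: "p < r \<and> r \<le> p + e \<and> z \<le> e" and g: "geq p x r z"
  have "EQ (s p) 0 x (Suc (r - Suc p)) z" using geq_at[of p p r x z] r g x by (simp add: Suc_diff_Suc)
  moreover have "r - Suc p < e" using r by auto
  ultimately show False using l r unfolding leaving_def by blast
next
  assume *: "\<forall>r z. p < r \<and> r \<le> p + e \<and> z \<le> e \<longrightarrow> \<not> geq p x r z"
  show "leaving e (s p) x"
    unfolding leaving_def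
  proof (intro allI impI notI)
    fix m y assume "m < e" "y \<le> e" "EQ (s p) 0 x (Suc m) y"
    then show False using *[rule_format, of "p + Suc m" y] geq_EQ[of 0 "Suc m" x y p] x by simp
  qed
qed

lemma entering_iff:
  assumes x: "x \<le> e"
  shows "entering e (s t) x \<longleftrightarrow> (\<forall>r z. t \<le> r \<and> r < t + e \<and> z \<le> e \<longrightarrow> \<not> geq r z (t + e) x)"
proof (intro iffI allI impI notI)
  fix r z assume l: "entering e (s t) x" and r: "t \<le> r \<and> r < t + e \<and> z \<le> e" and g: "geq r z (t + e) x"
  have "EQ (s t) (r - t) z e x" using geq_at[of t r "t + e" z x] r g x by simp
  moreover have "r - t < e" using r by auto
  ultimately show False using l r unfolding entering_def by blast
next
  assume *: "\<forall>r z. t \<le> r \<and> r < t + e \<and> z \<le> e \<longrightarrow> \<not> geq r z (t + e) x"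
  show "entering e (s t) x"
    unfolding entering_def
  proof (intro allI impI notI)
    fix m y assume "m < e" "y \<le> e" "EQ (s t) m y e x"
    then show False using *[rule_format, of "t + m" y] geq_EQ[of m e y x t] x by simp
  qed
qed

section \<open>Segments as chains of links\<close>

definition "rep p x = (LEAST y. geq p y p x)"
text \<open>A node stands for a class of equal remote values at one position, named by its least
  variable.\<close>

definition "node c \<longleftrightarrow> snd c \<le> e \<and> (\<forall>y<snd c. \<not> geq (fst c) y (fst c) (snd c))"

lemma rep_le: "x \<le> e \<Longrightarrow> rep p x \<le> x"
  unfolding rep_def by (rule Least_le) (rule geq_refl)

lemma rep_geq: "x \<le> e \<Longrightarrow> geq p (rep p x) p x"
  unfolding rep_def by (rule LeastI[of "\<lambda>y. geq p y p x"]) (rule geq_refl)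

lemma node_rep: "x \<le> e \<Longrightarrow> node (p, rep p x)"
proof -
  assume x: "x \<le> e"
  have "\<not> geq p y p (rep p x)" if "y < rep p x" for y
  proof
    assume "geq p y p (rep p x)"
    then have "geq p y p x"
      using geq_trans[of p p p p y "rep p x" x] rep_geq[OF x] rep_le[OF x, of p] that x by auto
    then have "rep p x \<le> y" unfolding rep_def by (rule Least_le)
    then show False using that by simp
  qed
  then show ?thesis using rep_le[OF x, of p] x by (simp add: node_def)
qed

lemma node_unique: "node (p, x) \<Longrightarrow> node (p, y) \<Longrightarrow> geq p x p y \<Longrightarrow> x = y"
  using geq_sym[of p p x y] by (cases x y rule: linorder_cases) (auto simp: node_def)

lemma rep_node: "node (p, x) \<Longrightarrow> rep p x = x"
  using node_unique[OF node_rep _ rep_geq, of x p] by (auto simp: node_def)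

lemma least_rep_node: "m \<le> e \<Longrightarrow> x \<le> e \<Longrightarrow> least_rep (s t) m x \<longleftrightarrow> node (t + m, x)"
  unfolding least_rep_def node_def by (auto simp: geq_EQ)

text \<open>The next occurrence of the class, if at most \<open>e\<close> positions away; maximal
  chains of links are the segments.\<close>

definition links :: "((nat \<times> nat) \<times> nat \<times> nat) set" where
  "links = {(c, d). node c \<and> node d \<and> fst c < fst d \<and> fst d \<le> fst c + e \<and>
     geq (fst c) (snd c) (fst d) (snd d) \<and>
     (\<forall>r z. fst c < r \<and> r < fst d \<and> z \<le> e \<longrightarrow> \<not> geq (fst c) (snd c) r z)}"

text \<open>An equality within a window is split at intermediate occurrences until none lies
  strictly between.\<close>

lemma links_trancl:
  assumes "p < q" "q \<le> p + e" "node (p, x)" "node (q, y)" "geq p x q y"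
  shows "((p, x), (q, y)) \<in> links\<^sup>+"
  using assms
proof (induction "q - p" arbitrary: p q x y rule: less_induct)
  case less
  have xy: "x \<le> e" "y \<le> e" using less.prems by (auto simp: node_def)
  show ?case
  proof (cases "\<exists>r z. p < r \<and> r < q \<and> z \<le> e \<and> geq p x r z")
    case True
    then obtain r z where r: "p < r" "r < q" "z \<le> e" "geq p x r z" by blast
    let ?z = "rep r z"
    have z: "?z \<le> e" "node (r, ?z)" using rep_le[OF r(3), of r] node_rep[OF r(3)] r(3) by auto
    have "geq r z r ?z" using geq_sym[OF _ _ _ _ rep_geq[OF r(3)]] z r by simp
    then have 1: "geq p x r ?z" using geq_trans[of p p r r x z ?z] less.prems xy r z by simp
    have "geq r ?z p x" using geq_sym[OF _ _ _ _ 1] xy z r less.prems by simp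
    then have 2: "geq r ?z q y" using geq_trans[of p r p q ?z x y] less.prems xy r z by simp
    have "((p, x), (r, ?z)) \<in> links\<^sup>+" by (rule less.hyps) (use less.prems r z 1 in auto)
    moreover have "((r, ?z), (q, y)) \<in> links\<^sup>+" by (rule less.hyps) (use less.prems r z 2 in auto)
    ultimately show ?thesis by (rule trancl_trans)
  next
    case False
    then have "((p, x), (q, y)) \<in> links" using less.prems by (auto simp: links_def)
    then show ?thesis ..
  qed
qed

lemma rep_geq_rep:
  assumes "p \<le> q" "q \<le> p + e" "x \<le> e" "y \<le> e" "geq p x q y"
  shows "geq p (rep p x) q (rep q y)"
proof -
  have r: "rep p x \<le> e" "rep q y \<le> e" using rep_le assms by (meson le_trans)+
  have "geq q y q (rep q y)" using geq_sym[OF _ _ _ _ rep_geq] assms r by simp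
  then have "geq p x q (rep q y)" using geq_trans[of p p q q x y "rep q y"] assms r by simp
  then show ?thesis using geq_trans[of p p p q "rep p x" x "rep q y"] rep_geq assms r by simp
qed

lemma links_trancl_rep:
  assumes "p < q" "q \<le> p + e" "x \<le> e" "y \<le> e" "geq p x q y"
  shows "((p, rep p x), (q, rep q y)) \<in> links\<^sup>+"
  using assms by (intro links_trancl node_rep rep_geq_rep) auto

lemma links_rtrancl_FOp: "(c, d) \<in> links\<^sup>* \<Longrightarrow> y \<le> e \<Longrightarrow> FOp (fst c) (snd c) y \<longleftrightarrow> FOp (fst d) (snd d) y"
proof (induction rule: rtrancl_induct)
  case (step d d')
  then show ?case using FOp_eq[of "fst d" "fst d'" "snd d" "snd d'" y] by (auto simp: links_def node_def)
qed simp

text \<open>A move may skip occurrences, but by \<open>okI\<close> a promise that is not passed on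
  was kept on the way. The case \<open>leaves\<close> contradicts \<open>okF\<close>: a leaving
  class promises nothing more in its segment.\<close>

lemma resolved_seen:
  "resolved e s p x y \<Longrightarrow> x \<le> e \<Longrightarrow> y \<le> e \<Longrightarrow> INp p x y \<Longrightarrow>
    \<exists>q. ((p, rep p x), (q, rep q y)) \<in> links\<^sup>+"
proof (induction rule: resolved.induct)
  case (seen y n p x)
  then have "geq p x (p + Suc n) y" using geq_EQ[of 0 "Suc n" x y p] by simp
  then show ?case using links_trancl_rep[of p "p + Suc n" x y] seen by auto
next
  case (leaves p x y)
  then show ?case using leaving_INp by blast
next
  case (moves n z p x y)
  then have g: "geq p x (p + Suc n) z" using geq_EQ[of 0 "Suc n" x z p] by simp
  from INp_forward[OF _ _ _ _ _ g moves.prems(3)] moves.hyps moves.prems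
  consider "INp (p + Suc n) z y" | r where "p < r" "r \<le> p + Suc n" "geq p x r y" by auto
  then show ?case
  proof cases
    case 1
    from moves.IH[OF moves.hyps(2) moves.prems(2) this] obtain q where
      q: "((p + Suc n, rep (p + Suc n) z), (q, rep q y)) \<in> links\<^sup>+" by blast
    have "((p, rep p x), (p + Suc n, rep (p + Suc n) z)) \<in> links\<^sup>+"
      using links_trancl_rep[OF _ _ _ _ g] moves.hyps moves.prems by simp
    from trancl_trans[OF this q] show ?thesis by blast
  next
    case 2
    then show ?thesis using links_trancl_rep[of p r x y] moves.hyps moves.prems by auto
  qed
qed

lemma resolved_end:
  "resolved e s p x y \<Longrightarrow> y = Suc e \<Longrightarrow> x \<le> e \<Longrightarrow>
    \<exists>q z. ((p, rep p x), (q, z)) \<in> links\<^sup>* \<and> node (q, z) \<and> leaving e (s q) z"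
proof (induction rule: resolved.induct)
  case (leaves p x y)
  have z: "rep p x \<le> e" using rep_le[of x p] leaves by simp
  have "leaving e (s p) (rep p x)"
    unfolding leaving_iff[OF z]
  proof (intro allI impI notI)
    fix r w assume r: "p < r \<and> r \<le> p + e \<and> w \<le> e" and g: "geq p (rep p x) r w"
    have "geq p x p (rep p x)" using geq_sym[OF _ _ _ _ rep_geq] leaves z by simp
    then have "geq p x r w" using geq_trans[of p p p r x "rep p x" w] r g z leaves by auto
    then show False using leaves leaving_iff[of x p] r by blast
  qed
  then show ?case using node_rep leaves by blast
next
  case (moves n z p x y)
  then have g: "geq p x (p + Suc n) z" using geq_EQ[of 0 "Suc n" x z p] by simp
  have "((p, rep p x), (p + Suc n, rep (p + Suc n) z)) \<in> links\<^sup>+"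
    using links_trancl_rep[OF _ _ _ _ g] moves.hyps moves.prems by simp
  then have l: "((p, rep p x), (p + Suc n, rep (p + Suc n) z)) \<in> links\<^sup>*" by (rule trancl_into_rtrancl)
  from moves.IH[OF moves.prems(1) moves.hyps(2)] obtain q w where
    q: "((p + Suc n, rep (p + Suc n) z), (q, w)) \<in> links\<^sup>*" "node (q, w) \<and> leaving e (s q) w" by blast
  from rtrancl_trans[OF l q(1)] q(2) show ?case by blast
qed simp

lemma IN_seen:
  assumes "node (p, x)" "y \<le> e" "INp p x y"
  shows "\<exists>q. ((p, x), (q, rep q y)) \<in> links\<^sup>+"
  using resolved_seen[of p x y] resolves[of 0 x y p] assms rep_node[OF assms(1)] by (auto simp: node_def)

lemma FO_end:
  assumes "node (p, x)" "y \<le> e" "FOp p x y"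
  shows "\<exists>d. ((p, x), d) \<in> links\<^sup>* \<and> node d \<and> leaving e (s (fst d)) (snd d)"
proof -
  have x: "x \<le> e" using assms(1) by (simp add: node_def)
  have "resolved e s p x (Suc e)" using resolves[of 0 x "Suc e" p] FOp_end[OF x assms(2,3)] x by simp
  from resolved_end[OF this refl x] show ?thesis using rep_node[OF assms(1)] by auto
qed

end

lemma infinite_fst:
  fixes A :: "(nat \<times> 'a) set"
  assumes "\<And>N. \<exists>d\<in>A. N \<le> fst d"
  shows "infinite A"
proof
  assume "finite A"
  then have "finite (fst ` A)" by simp
  then obtain m where m: "\<forall>n\<in>fst ` A. n < m" unfolding finite_nat_set_iff_bounded by (rule exE)
  obtain d where "d \<in> A" "m \<le> fst d" using assms by blast
  then show False using m by auto
qed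

lemma type_eqI:
  assumes "X < ntypes e" "X' < ntypes e" "\<And>y. y \<le> e \<Longrightarrow> mem y X \<longleftrightarrow> mem y X'"
  shows "X = X'"
proof -
  have "mem y X \<longleftrightarrow> mem y X'" for y
    using mem_bound[of y X "Suc e"] mem_bound[of y X' "Suc e"] assms
    by (cases "y \<le> e") (auto simp: ntypes_def)
  then have "set_decode X = set_decode X'" by blast
  then show ?thesis by (metis set_decode_inverse)
qed

lemma mem_type_le: "X < ntypes e \<Longrightarrow> mem y X \<Longrightarrow> y \<le> e"
  using mem_bound[of y X "Suc e"] by (simp add: ntypes_def)

lemma type_nonempty: "0 < X \<Longrightarrow> \<exists>y. mem y X"
  by (metis set_decode_inverse set_encode_empty ex_in_conv less_numeral_extra(3))

context run
begin

section \<open>Matching deposits with consumers\<close>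

definition "dep X = {(t, x). x \<le> e \<and> deposits e (s t) X x}"
text \<open>Consumers are named by the position of the class, \<open>e\<close> after the start of
  the window. \<open>Suc t\<close> excludes the first window, before which nothing was
  deposited.\<close>

definition "entr X = {(p, x). \<exists>t. p = Suc t + e \<and> x \<le> e \<and> supplies e (s (Suc t)) X x}"
definition "goodn X y d \<longleftrightarrow> (\<exists>t. fst d = Suc t + e \<and> snd d \<le> e \<and> good e (s (Suc t)) X y (snd d))"

lemma dep_iff: "(t, x) \<in> dep X \<longleftrightarrow>
  node (t, x) \<and> leaving e (s t) x \<and> (\<forall>y\<le>e. FOp t x y \<longleftrightarrow> mem y X)"
  unfolding dep_def deposits_def using least_rep_node[of 0 x t] by (auto simp: node_def)

lemma entrD:
  assumes "(p, x) \<in> entr X"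
  shows "node (p, x)" "e < p" "\<And>r z. p \<le> r + e \<Longrightarrow> r < p \<Longrightarrow> z \<le> e \<Longrightarrow> \<not> geq r z p x"
    "\<And>y. y \<le> e \<Longrightarrow> geq p x p y \<or> INp p x y \<or> FOp p x y \<longleftrightarrow> mem y X"
proof -
  obtain t where t: "p = Suc t + e" "x \<le> e" "supplies e (s (Suc t)) X x" using assms by (auto simp: entr_def)
  then show "node (p, x)" "e < p"
    using least_rep_node[of e x "Suc t"] by (auto simp: supplies_def)
  show "\<not> geq r z p x" if "p \<le> r + e" "r < p" "z \<le> e" for r z
    using t that entering_iff[of x "Suc t"] by (auto simp: supplies_def)
  show "geq p x p y \<or> INp p x y \<or> FOp p x y \<longleftrightarrow> mem y X" if "y \<le> e" for y
    using t that geq_EQ[of e e x y "Suc t"] IN_shift[of e x y "Suc t"] FO_shift[of e x y "Suc t"]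
    by (auto simp: supplies_def)
qed

lemma goodn_entr: "goodn X y d \<Longrightarrow> d \<in> entr X"
  by (cases d) (auto simp: goodn_def entr_def good_def)

lemma goodnD:
  assumes "goodn X y d" "y \<le> e"
  shows "geq (fst d) (snd d) (fst d) y \<or> INp (fst d) (snd d) y \<or>
    (\<exists>z\<le>e. mem z X \<and> \<not> FOp (fst d) (snd d) z)"
  using assms geq_EQ[of e e "snd d" y] IN_shift[of e "snd d" y] FO_shift[of e "snd d"]
  by (fastforce simp: goodn_def good_def)

lemma infinite_goodn:
  assumes "X < ntypes e" "mem X I" "mem y X"
  shows "infinite {d. goodn X y d}"
proof (rule infinite_fst)
  fix N
  obtain t x where "N \<le> t" "x \<le> e" "good e (s (Suc t)) X y x"
    using good_inf[of X y N] assms mem_type_le by blast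
  then show "\<exists>d\<in>{d. goodn X y d}. N \<le> fst d"
    by (intro bexI[of _ "(Suc t + e, x)"]) (auto simp: goodn_def)
qed

text \<open>Of two successors at different positions the nearer would lie strictly between; at one
  position equal classes have the same least variable.\<close>

lemma links_functional: "(c, d) \<in> links \<Longrightarrow> (c, d') \<in> links \<Longrightarrow> d = d'"
proof -
  assume 1: "(c, d) \<in> links" and 2: "(c, d') \<in> links"
  obtain p x q y q' y' where c: "c = (p, x)" "d = (q, y)" "d' = (q', y')" by (cases c, cases d, cases d')
  have n: "node (p, x)" "node (q, y)" "node (q', y')" "x \<le> e" "y \<le> e" "y' \<le> e"
    using 1 2 c by (auto simp: links_def node_def)
  have "q = q'"
  proof (rule ccontr)
    assume "q \<noteq> q'"
    then show False using 1 2 c n by (cases q q' rule: linorder_cases) (auto simp: links_def)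
  qed
  moreover have "geq q y p x" using 1 c n geq_sym[of p q x y] by (auto simp: links_def)
  then have "geq q y q' y'" using \<open>q = q'\<close> 1 2 c n geq_trans[of p q p q y x y'] by (auto simp: links_def)
  ultimately show ?thesis using node_unique n c by simp
qed

text \<open>Two predecessors share a window with \<open>d\<close> and are therefore equal to each
  other; if they were at different positions, the later one would lie strictly between the earlier
  one and \<open>d\<close>.\<close>

lemma links_injective: "(c, d) \<in> links \<Longrightarrow> (c', d) \<in> links \<Longrightarrow> c = c'"
proof -
  assume 1: "(c, d) \<in> links" and 2: "(c', d) \<in> links"
  have *: "fst c = fst c' \<and> geq (fst c) (snd c) (fst c') (snd c')"
    if "(c, d) \<in> links" "(c', d) \<in> links" "fst c \<le> fst c'" for c c'
  proof -
    obtain p x q y p' x' where c: "c = (p, x)" "d = (q, y)" "c' = (p', x')" by (cases c, cases d, cases c')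
    have n: "x \<le> e" "y \<le> e" "x' \<le> e" using that c by (auto simp: links_def node_def)
    have "geq q y p' x'" using that c n geq_sym[of p' q x' y] by (auto simp: links_def)
    then have "geq p x p' x'" using that c n geq_trans[of p p q p' x y x'] by (auto simp: links_def)
    then show ?thesis using that c n by (cases "p = p'") (auto simp: links_def)
  qed
  have n: "node (fst c, snd c)" "node (fst c', snd c')" using 1 2 by (auto simp: links_def)
  show ?thesis
  proof (cases "fst c \<le> fst c'")
    case True
    then show ?thesis using *[OF 1 2 True] node_unique[of "fst c'" "snd c" "snd c'"] n by (auto simp: prod_eq_iff)
  next
    case False
    then show ?thesis using *[OF 2 1] by simp
  qed
qed

lemma links_entr: "d \<in> entr X \<Longrightarrow> (c, d) \<notin> links"
  using entrD(3)[of "fst d" "snd d" X "fst c" "snd c"] by (cases c; cases d) (auto simp: links_def node_def)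

text \<open>Links are injective and none leads into an entering class, so going backwards meets at
  most one such class.\<close>

lemma links_root:
  assumes "d \<in> entr X" "d' \<in> entr X" "(d, c) \<in> links\<^sup>*" "(d', c) \<in> links\<^sup>*"
  shows "d = d'"
proof -
  have "single_valued (links\<inverse>)" using links_injective by (auto simp: single_valued_def)
  from single_valued_confluent[OF this, of c d d'] assms(3,4)
  have "(d, d') \<in> links\<^sup>* \<or> (d', d) \<in> links\<^sup>*" by (auto simp: rtrancl_converse)
  then show ?thesis using links_entr assms(1,2) by (metis rtranclE)
qed

definition "next_target r = (if r = e then 0 else Suc r)"

text \<open>In the infinite case \<open>r c\<close> is the variable that the consumer of
  \<open>c\<close> has to serve; it advances when the token is deposited again with the same label.
  In the finite case the bound \<open>T\<close> limits how often a token can be handed on.\<close>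

definition "matching X f r \<longleftrightarrow> inj_on f (dep X) \<and> (\<forall>c\<in>dep X. f c \<in> entr X \<and> fst c + e < fst (f c) \<and>
   (if mem X I then r c \<le> e \<and> (mem (r c) X \<longrightarrow> goodn X (r c) (f c)) \<and>
      (\<forall>c'\<in>dep X. (f c, c') \<in> links\<^sup>* \<longrightarrow> r c' = next_target (r c))
    else fst c < T))"

text \<open>No tokens are left at \<open>T\<close>, so the greedy matching is complete there, and
  quietness excludes deposits from \<open>T\<close> on.\<close>

lemma matching_finite:
  assumes X: "0 < X" "X < ntypes e" "\<not> mem X I"
  shows "\<exists>f. matching X f r"
proof -
  let ?d = "\<lambda>t. {x. x \<le> e \<and> deposits e (s t) X x}" and ?b = "\<lambda>t. {x. x \<le> e \<and> supplies e (s t) X x}"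
  let ?D = "{(t, x). t < T \<and> x \<in> ?d t}"
  have "\<exists>f U. U \<subseteq> ?D \<and> finite U \<and> card U = tokens e s T X \<and> inj_on f (?D - U) \<and>
    (\<forall>z\<in>?D - U. fst z < fst (f z) \<and> fst (f z) \<le> T \<and> snd (f z) \<in> ?b (fst (f z)))"
    by (rule fifo_matching[where M = "\<lambda>t. tokens e s t X"]) (auto simp: ndep_def nsup_def)
  then obtain f U where U: "finite U" "card U = tokens e s T X" and f: "inj_on f (?D - U)"
    "\<And>z. z \<in> ?D - U \<Longrightarrow> fst z < fst (f z) \<and> snd (f z) \<in> ?b (fst (f z))" by blast
  have U0: "U = {}" using U tokens0[OF X] by simp
  have D: "dep X = ?D"
  proof -
    have "t < T" if "x \<le> e" "deposits e (s t) X x" for t x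
    proof (rule ccontr)
      assume "\<not> t < T"
      then have "ndep e (s t) X = 0" using quiet[of t] X by (auto simp: quiet_def)
      then show False using that by (auto simp: ndep_def)
    qed
    then show ?thesis by (auto simp: dep_def)
  qed
  \<comment> \<open>\<open>f c\<close> names the consuming state; the class it supplies is at the
    last position of that window.\<close>
  let ?f = "\<lambda>c. (fst (f c) + e, snd (f c))"
  have "inj_on ?f (dep X)" using f(1) unfolding D U0 by (auto simp: inj_on_def prod_eq_iff)
  moreover have "?f c \<in> entr X \<and> fst c + e < fst (?f c) \<and> fst c < T" if "c \<in> dep X" for c
  proof -
    have c: "fst c < fst (f c)" "snd (f c) \<in> ?b (fst (f c))" "fst c < T"
      using f(2)[of c] that unfolding D U0 by auto
    then have "fst (f c) = Suc (fst (f c) - 1)" by simp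
    then show ?thesis using c by (auto simp: entr_def intro!: exI[of _ "fst (f c) - 1"])
  qed
  ultimately have "matching X ?f r" using X(3) by (simp add: matching_def)
  then show ?thesis by (rule exI[of _ ?f])
qed

text \<open>Every consumed token has a target variable, which advances cyclically; the entering classes are
  divided up among the targets in advance, each target getting infinitely many suitable ones.\<close>

lemma matching_infinite:
  assumes X: "0 < X" "X < ntypes e" "mem X I"
  shows "\<exists>f r. matching X f r"
proof -
  \<comment> \<open>\<open>n\<close> codes a pair: \<open>p2 n\<close> is the variable for which the
    chosen consumer is reserved, \<open>p1 n\<close> a mere running index. If \<open>p2 n\<close> is
    not a variable in \<open>X\<close>, any consumer will do.\<close>
  define S where "S n = {d \<in> entr X. p2 n \<le> e \<longrightarrow> mem (p2 n) X \<longrightarrow> goodn X (p2 n) d}" for n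
  obtain y where y: "mem y X" using type_nonempty[OF X(1)] by blast
  have "infinite (S n)" for n
  proof (cases "p2 n \<le> e \<and> mem (p2 n) X")
    case True
    have "infinite {d. goodn X (p2 n) d}" using infinite_goodn X True by blast
    moreover have "{d. goodn X (p2 n) d} \<subseteq> S n" using goodn_entr by (auto simp: S_def)
    ultimately show ?thesis using finite_subset by blast
  next
    case False
    have "infinite {d. goodn X y d}" using infinite_goodn X y by blast
    moreover have "{d. goodn X y d} \<subseteq> S n" using goodn_entr False by (auto simp: S_def)
    ultimately show ?thesis using finite_subset by blast
  qed
  then obtain h where h: "inj h" "\<And>n. h n \<in> S n" using infinite_representatives[of S] by blast
  define P where "P c n \<longleftrightarrow> p2 n \<le> e \<and> (h n, c) \<in> links\<^sup>*" for c n
  have P_unique: "n = n'" if "P c n" "P c n'" for c n n'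
    using links_root[of "h n" X "h n'" c] h that by (auto simp: P_def S_def inj_def)
  \<comment> \<open>The target depends on what the first class of the segment of \<open>c\<close> is
    reserved for, not on the token it will be matched with. So targets are fixed before
    \<open>f\<close> is chosen, which avoids a circular definition. Segments without a reserved
    start get target 0.\<close>
  define r where "r c = (if \<exists>n. P c n then next_target (p2 (THE n. P c n)) else 0)" for c
  have r_le: "r c \<le> e" for c
  proof (cases "\<exists>n. P c n")
    case True
    then obtain n where n: "P c n" by blast
    then have "(THE n. P c n) = n" using P_unique by blast
    then show ?thesis using n by (auto simp: r_def next_target_def P_def)
  qed (simp add: r_def)
  have r_P: "r c = next_target (p2 n)" if "P c n" for c n
  proof -
    have "(THE n. P c n) = n" using P_unique that by blast
    then show ?thesis using that by (auto simp: r_def)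
  qed
  \<comment> \<open>Here \<open>n\<close> codes a deposit; its candidates are reserved for its
    target and more than \<open>e\<close> positions later. Infinitely many remain, so all deposits
    can choose distinct ones.\<close>
  define S' where "S' n = {d \<in> range (\<lambda>k. h (pr k (r (prod_decode n)))). fst (prod_decode n) + e < fst d}" for n
  have "infinite (S' n)" for n
  proof
    assume f: "finite (S' n)"
    let ?R = "range (\<lambda>k. h (pr k (r (prod_decode n))))"
    have "?R \<subseteq> S' n \<union> {..fst (prod_decode n) + e} \<times> {..e}"
    proof
      fix d assume d: "d \<in> ?R"
      then have "d \<in> entr X" using h(2) by (auto simp: S_def)
      then have "snd d \<le> e" by (auto simp: entr_def)
      then show "d \<in> S' n \<union> {..fst (prod_decode n) + e} \<times> {..e}"
        using d by (cases d) (auto simp: S'_def)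
    qed
    then have "finite ?R" using f finite_subset by blast
    moreover have "inj (\<lambda>k. h (pr k (r (prod_decode n))))"
      using injD[OF h(1)] by (intro injI) (fastforce simp: prod_encode_eq)
    ultimately show False using finite_imageD[of _ UNIV] by auto
  qed
  then obtain h' where h': "inj h'" "\<And>n. h' n \<in> S' n" using infinite_representatives[of S'] by blast
  define f where "f c = h' (prod_encode c)" for c
  have "inj_on f (dep X)" using injD[OF h'(1)] by (intro inj_onI) (fastforce simp: f_def prod_encode_eq)
  moreover have "f c \<in> entr X \<and> fst c + e < fst (f c) \<and> r c \<le> e \<and> (mem (r c) X \<longrightarrow> goodn X (r c) (f c)) \<and>
      (\<forall>c'\<in>dep X. (f c, c') \<in> links\<^sup>* \<longrightarrow> r c' = next_target (r c))" for c
  proof -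
    obtain k where k: "f c = h (pr k (r c))" "fst c + e < fst (f c)"
      using h'(2)[of "prod_encode c"] by (auto simp: S'_def f_def)
    have "f c \<in> S (pr k (r c))" using h(2) k(1) by simp
    moreover have "r c' = next_target (r c)" if "(f c, c') \<in> links\<^sup>*" for c'
      using r_P[of c' "pr k (r c)"] that k r_le by (simp add: P_def)
    ultimately show ?thesis using k(2) r_le by (auto simp: S_def)
  qed
  ultimately have "matching X f r" using X(3) by (simp add: matching_def)
  then show ?thesis by blast
qed

lemma matching_exists: "\<exists>F r. \<forall>X. 0 < X \<and> X < ntypes e \<longrightarrow> matching X (F X) (r X)"
proof -
  have "\<forall>X. \<exists>f r. 0 < X \<and> X < ntypes e \<longrightarrow> matching X f r"
    using matching_finite matching_infinite by blast
  then show ?thesis by metis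
qed

end

section \<open>Chains of segments and the liveness of tokens\<close>

locale matched_run = run +
  fixes F :: "nat \<Rightarrow> nat \<times> nat \<Rightarrow> nat \<times> nat" and target :: "nat \<Rightarrow> nat \<times> nat \<Rightarrow> nat"
  assumes matching: "0 < X \<Longrightarrow> X < ntypes e \<Longrightarrow> matching X (F X) (target X)"
begin

definition "jumps = {(c, F X c) | X c. 0 < X \<and> X < ntypes e \<and> c \<in> dep X}"
definition "next = links \<union> jumps"

lemma jumpsE:
  assumes "(c, d) \<in> jumps"
  obtains X where "0 < X" "X < ntypes e" "c \<in> dep X" "d = F X c" "d \<in> entr X" "fst c + e < fst d"
  using assms matching by (auto simp: jumps_def matching_def)

lemma dep_unique: "c \<in> dep X \<Longrightarrow> c \<in> dep X' \<Longrightarrow> X < ntypes e \<Longrightarrow> X' < ntypes e \<Longrightarrow> X = X'"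
  by (cases c) (auto simp: dep_iff intro: type_eqI)

lemma entr_unique: "d \<in> entr X \<Longrightarrow> d \<in> entr X' \<Longrightarrow> X < ntypes e \<Longrightarrow> X' < ntypes e \<Longrightarrow> X = X'"
  using entrD(4)[of "fst d" "snd d"] by (intro type_eqI) auto

lemma links_dep: "c \<in> dep X \<Longrightarrow> (c, d) \<notin> links"
  using leaving_iff[of "snd c" "fst c"] by (cases c; cases d) (auto simp: dep_iff links_def node_def)

text \<open>A class that deposits a token leaves the window and has no link, and its label is
  determined by its promises; so links and jumps never compete.\<close>

lemma next_functional: "(c, d) \<in> next \<Longrightarrow> (c, d') \<in> next \<Longrightarrow> d = d'"
  unfolding next_def using links_functional links_dep dep_unique by (elim UnE jumpsE) blast+

text \<open>A consumer has no incoming link, its label is determined by the class, and the matching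
  for that label is injective.\<close>

lemma next_injective: "(c, d) \<in> next \<Longrightarrow> (c', d) \<in> next \<Longrightarrow> c = c'"
proof -
  assume "(c, d) \<in> next" "(c', d) \<in> next"
  then consider "(c, d) \<in> links" "(c', d) \<in> links" | "(c, d) \<in> jumps" "(c', d) \<in> links"
    | "(c, d) \<in> links" "(c', d) \<in> jumps" | "(c, d) \<in> jumps" "(c', d) \<in> jumps" unfolding next_def by blast
  then show ?thesis
  proof cases
    case 1
    then show ?thesis by (rule links_injective)
  next
    case 2
    obtain X where "d \<in> entr X" using 2(1) by (rule jumpsE)
    then show ?thesis using links_entr 2(2) by blast
  next
    case 3
    obtain X where "d \<in> entr X" using 3(2) by (rule jumpsE)
    then show ?thesis using links_entr 3(1) by blast
  next
    case 4
    obtain X where X: "0 < X" "X < ntypes e" "c \<in> dep X" "d = F X c" "d \<in> entr X" using 4(1) by (rule jumpsE)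
    obtain X' where X': "X' < ntypes e" "c' \<in> dep X'" "d = F X' c'" "d \<in> entr X'" using 4(2) by (rule jumpsE)
    have "X = X'" using entr_unique X X' by blast
    moreover have "inj_on (F X) (dep X)" using matching[OF X(1,2)] by (simp add: matching_def)
    ultimately show ?thesis using X X' by (auto dest: inj_onD)
  qed
qed

lemma next_less: "(c, d) \<in> next \<Longrightarrow> fst c < fst d"
  unfolding next_def by (auto simp: links_def elim: jumpsE)

lemma next_nodes: "(c, d) \<in> next \<Longrightarrow> node c \<and> node d"
  unfolding next_def
proof (elim UnE)
  assume "(c, d) \<in> jumps"
  then obtain X where "c \<in> dep X" "d \<in> entr X" by (rule jumpsE)
  then show ?thesis using entrD(1)[of "fst d" "snd d" X] by (cases c) (auto simp: dep_iff)
qed (simp add: links_def)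

lemma next_trancl_less: "(c, d) \<in> next\<^sup>+ \<Longrightarrow> fst c < fst d"
  by (induction rule: trancl_induct) (auto dest: next_less)

lemma next_rtrancl_le: "(c, d) \<in> next\<^sup>* \<Longrightarrow> fst c \<le> fst d"
  by (auto simp: rtrancl_eq_or_trancl dest: next_trancl_less)

lemma links_next: "(c, d) \<in> links\<^sup>+ \<Longrightarrow> (c, d) \<in> next\<^sup>+"
  by (rule trancl_mono[of _ links]) (auto simp: next_def)

lemma links_next_rtrancl: "(c, d) \<in> links\<^sup>* \<Longrightarrow> (c, d) \<in> next\<^sup>*"
  using rtrancl_mono[of links "next"] by (auto simp: next_def)

definition "shows_var d y \<longleftrightarrow> geq (fst d) (snd d) (fst d) y"

lemma dep_of_FO:
  assumes "node d" "leaving e (s (fst d)) (snd d)" "y \<le> e" "FOp (fst d) (snd d) y"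
  obtains X where "0 < X" "X < ntypes e" "d \<in> dep X" "mem y X"
proof -
  let ?A = "{z. z \<le> e \<and> FOp (fst d) (snd d) z}"
  have "set_encode ?A < ntypes e" unfolding ntypes_def by (rule set_encode_less) auto
  moreover have m: "mem z (set_encode ?A) \<longleftrightarrow> z \<in> ?A" for z by (subst set_encode_inverse) auto
  moreover have "0 < set_encode ?A" using m[of y] assms by (metis (mono_tags, lifting) gr0I mem_Collect_eq set_decode_0 set_decode_zero empty_iff)
  moreover have "d \<in> dep (set_encode ?A)" using assms m by (cases d) (auto simp: dep_iff)
  ultimately show ?thesis using that assms by auto
qed

lemma shows_var_rep: "y \<le> e \<Longrightarrow> shows_var (q, rep q y) y"
  unfolding shows_var_def by (simp add: rep_geq)

text \<open>Descent on a lexicographic measure. If a token is handed on without \<open>y\<close>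
  being shown, its label shrinks or stays the same. In the latter case either the cyclic distance
  from the target to \<open>y\<close> drops or, for finitely many consumers, the time left before
  \<open>T\<close> does. When the target is \<open>y\<close> itself, the consumer is good, so
  \<open>y\<close> is shown or the label shrinks.\<close>

lemma token_live:
  assumes "0 < X" "X < ntypes e" "c \<in> dep X" "mem y X"
  shows "\<exists>d. (c, d) \<in> next\<^sup>+ \<and> shows_var d y"
  using assms
proof (induction "(card (set_decode X), if mem X I then (if target X c \<le> y then y - target X c else y + Suc e - target X c)
      else T - fst c)" arbitrary: X c rule: wf_induct_rule[OF wf_lex_prod[OF wf_less_than wf_less_than]])
  case (1 X c)
  define d where "d = F X c"
  have cd: "(c, d) \<in> next" using "1.prems" unfolding next_def jumps_def d_def by blast
  have m: "d \<in> entr X" "fst c + e < fst d" using matching[of X] "1.prems" by (auto simp: matching_def d_def)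
  have ye: "y \<le> e" using mem_type_le "1.prems" by blast
  obtain p x where d: "d = (p, x)" by (cases d)
  have nd: "node (p, x)" using entrD(1) m d by simp
  consider "geq p x p y" | "INp p x y" | "\<not> geq p x p y" "\<not> INp p x y" "FOp p x y"
    using entrD(4)[of p x X y] m(1) d ye "1.prems" by auto
  then show ?case
  proof cases
    case 1
    then show ?thesis using cd d by (auto simp: shows_var_def)
  next
    case 2
    obtain q where "((p, x), (q, rep q y)) \<in> links\<^sup>+" using IN_seen[OF nd ye 2] by blast
    then have "(c, (q, rep q y)) \<in> next\<^sup>+" using cd d links_next by (meson r_into_trancl trancl_trans)
    then show ?thesis using shows_var_rep[OF ye] by blast
  next
    case 3
    obtain c' where c': "(d, c') \<in> links\<^sup>*" "node c'" "leaving e (s (fst c')) (snd c')"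
      using FO_end[OF nd ye 3(3)] d by blast
    have FO: "FOp p x z \<longleftrightarrow> FOp (fst c') (snd c') z" if "z \<le> e" for z
      using links_rtrancl_FOp[OF c'(1) that] d by simp
    obtain X' where X': "0 < X'" "X' < ntypes e" "c' \<in> dep X'" "mem y X'"
      using dep_of_FO[OF c'(2,3) ye] FO[OF ye] 3 by blast
    have mX': "mem z X' \<longleftrightarrow> FOp p x z" if "z \<le> e" for z
      using X'(3) FO that by (cases c') (auto simp: dep_iff)
    \<comment> \<open>The new label holds what recurs after the segment, the old one also what the
      segment itself shows.\<close>
    have sub: "set_decode X' \<subseteq> set_decode X"
      using mX' entrD(4)[of p x X] m(1) d mem_type_le[OF X'(2)] by auto
    have cc': "(c, c') \<in> next\<^sup>+" using cd links_next_rtrancl[OF c'(1)] by (rule rtrancl_into_trancl2)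
    have "\<exists>d. (c', d) \<in> next\<^sup>+ \<and> shows_var d y"
    proof (rule "1.hyps"[OF _ X'])
      show "((card (set_decode X'), if mem X' I then (if target X' c' \<le> y then y - target X' c' else y + Suc e - target X' c')
          else T - fst c'),
        (card (set_decode X), if mem X I then (if target X c \<le> y then y - target X c else y + Suc e - target X c)
          else T - fst c)) \<in> less_than <*lex*> less_than"
      proof (cases "X' = X")
        case False
        then have "set_decode X' \<noteq> set_decode X" by (metis set_decode_inverse)
        then have "card (set_decode X') < card (set_decode X)" using sub by (intro psubset_card_mono) auto
        then show ?thesis by simp
      next
        case True
        have mat: "if mem X I then target X c \<le> e \<and> (mem (target X c) X \<longrightarrow> goodn X (target X c) d) \<and>
             (\<forall>c'\<in>dep X. (d, c') \<in> links\<^sup>* \<longrightarrow> target X c' = next_target (target X c)) else fst c < T"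
          using matching[of X] "1.prems" by (auto simp: matching_def d_def)
        show ?thesis
        proof (cases "mem X I")
          case I: True
          have "target X c \<noteq> y"
          proof
            assume "target X c = y"
            then have "goodn X y d" using mat I "1.prems" by auto
            then show False using goodnD[of X y d] ye d 3 mX' True by auto
          qed
          moreover have "target X c' = next_target (target X c)" "target X c \<le> e"
            using mat I c'(1) X' True by auto
          ultimately show ?thesis using True I ye by (auto simp: next_target_def)
        next
          case nI: False
          have "fst c' < T" using matching[of X] X' True nI by (auto simp: matching_def)
          then show ?thesis using True nI next_trancl_less[OF cc'] by simp
        qed
      qed
    qed
    then show ?thesis using trancl_trans[OF cc'] by blast
  qed
qed

end

context matched_run
begin

text \<open>A jump covers more than \<open>e\<close> positions, so a path that stays within
  \<open>e\<close> consists of links.\<close>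

lemma next_geq:
  assumes "(c, d) \<in> next\<^sup>*" "node c" "fst d \<le> fst c + e"
  shows "geq (fst c) (snd c) (fst d) (snd d)"
  using assms(1,3)
proof (induction rule: rtrancl_induct)
  case base
  then show ?case using assms(2) geq_refl by (auto simp: node_def)
next
  case (step d d')
  have l: "fst c \<le> fst d" "fst d < fst d'" using next_rtrancl_le[OF step.hyps(1)] next_less[OF step.hyps(2)] by auto
  have "(d, d') \<notin> jumps"
  proof
    assume "(d, d') \<in> jumps"
    then have "fst d + e < fst d'" by (rule jumpsE)
    then show False using step.prems l by simp
  qed
  then have "(d, d') \<in> links" using step.hyps(2) by (auto simp: next_def)
  then show ?case
    using step l geq_trans[of "fst c" "fst c" "fst d" "fst d'" "snd c" "snd d" "snd d'"] assms(2)
    by (auto simp: links_def node_def)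
qed

section \<open>Remote values as names of chains\<close>

definition "same c d \<longleftrightarrow> (c, d) \<in> next\<^sup>* \<or> (d, c) \<in> next\<^sup>*"

text \<open>As \<open>next\<close> is functional and injective, its paths form disjoint lines, so
  two nodes comparable with a third are comparable.\<close>

lemma same_trans: "same a b \<Longrightarrow> same b c \<Longrightarrow> same a c"
proof -
  have sv: "single_valued next" "single_valued (next\<inverse>)"
    using next_functional next_injective by (auto simp: single_valued_def)
  have 1: "same a c" if "(b, a) \<in> next\<^sup>*" "(b, c) \<in> next\<^sup>*"
    using single_valued_confluent[OF sv(1) that] by (simp add: same_def)
  have 2: "same a c" if "(a, b) \<in> next\<^sup>*" "(c, b) \<in> next\<^sup>*"
    using single_valued_confluent[OF sv(2), of b a c] that by (auto simp: same_def rtrancl_converse)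
  assume "same a b" "same b c"
  then show ?thesis using 1 2 unfolding same_def by (meson rtrancl_trans)
qed

lemma same_sym: "same a b \<Longrightarrow> same b a"
  by (auto simp: same_def)

text \<open>The choice depends on \<open>c\<close> only through the predicate \<open>same c\<close>,
  which is one and the same along a chain.\<close>

definition "canonical c = (SOME d. same c d)"

lemma canonical_eq: "canonical c = canonical d \<longleftrightarrow> same c d"
proof
  have s: "same c (canonical c)" for c
    unfolding canonical_def by (rule someI[of _ c]) (simp add: same_def)
  { assume "canonical c = canonical d"
    then show "same c d" using s[of c] s[of d] same_sym same_trans by metis }
  assume "same c d"
  then have "same c = same d" using same_sym same_trans by blast
  then show "canonical c = canonical d" by (simp add: canonical_def)
qed

definition "value_at p x = prod_encode (canonical (p, rep p x))"

lemma value_at_eq: "value_at p x = value_at q y \<longleftrightarrow> same (p, rep p x) (q, rep q y)"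
  by (simp add: value_at_def prod_encode_eq canonical_eq)

lemma rep_bound: "x \<le> e \<Longrightarrow> rep p x \<le> e"
  using rep_le le_trans by blast

lemma geq_rep: "x \<le> e \<Longrightarrow> geq p x p (rep p x)"
  using geq_sym[OF _ _ _ _ rep_geq] rep_bound by simp

lemma geq_rep_iff:
  assumes "p \<le> q" "q \<le> p + e" "x \<le> e" "y \<le> e"
  shows "geq p (rep p x) q (rep q y) \<longleftrightarrow> geq p x q y"
proof
  assume g: "geq p (rep p x) q (rep q y)"
  have "geq p x q (rep q y)"
    using geq_trans[of p p p q x "rep p x" "rep q y"] geq_rep[of x p] g assms rep_bound by simp
  then show "geq p x q y"
    using geq_trans[of p p q q x "rep q y" y] rep_geq[of y q] assms rep_bound by simp
qed (use rep_geq_rep assms in blast)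

lemma value_at_window:
  assumes "p \<le> q" "q \<le> p + e" "x \<le> e" "y \<le> e"
  shows "value_at p x = value_at q y \<longleftrightarrow> geq p x q y"
proof -
  let ?c = "(p, rep p x)" and ?d = "(q, rep q y)"
  have n: "node ?c" "node ?d" using node_rep assms by auto
  have "same ?c ?d \<longleftrightarrow> geq p (rep p x) q (rep q y)"
  proof
    assume "same ?c ?d"
    then consider "(?c, ?d) \<in> next\<^sup>*" | "(?d, ?c) \<in> next\<^sup>*" unfolding same_def by blast
    then show "geq p (rep p x) q (rep q y)"
    proof cases
      case 1
      then show ?thesis using next_geq[OF 1 n(1)] assms by simp
    next
      case 2
      then have "q \<le> p" using next_rtrancl_le by fastforce
      then show ?thesis using next_geq[OF 2 n(2)] assms geq_sym[of q p "rep q y" "rep p x"] rep_bound by simp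
    qed
  next
    assume g: "geq p (rep p x) q (rep q y)"
    show "same ?c ?d"
    proof (cases "p = q")
      case True
      then have "rep p x = rep q y" using node_unique[of p "rep p x" "rep q y"] n g by simp
      then show ?thesis using True by (simp add: same_def)
    next
      case False
      then have "(?c, ?d) \<in> links\<^sup>+" using links_trancl[OF _ assms(2) n g] assms(1) by simp
      then show ?thesis unfolding same_def by (intro disjI1 trancl_into_rtrancl links_next)
    qed
  qed
  then show ?thesis using geq_rep_iff[OF assms] by (simp add: value_at_eq)
qed

text \<open>No occurrence comes unannounced. It is propagated backwards along links by
  \<open>okI\<close> and \<open>okF\<close>, and across a jump because all that a consumer shows or
  promises is in the label of the deposit.\<close>

lemma next_future:
  "(c, d) \<in> next\<^sup>+ \<Longrightarrow> y \<le> e \<Longrightarrow> shows_var d y \<Longrightarrow> INp (fst c) (snd c) y \<or> FOp (fst c) (snd c) y"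
proof -
  have step: "INp (fst c) (snd c) y \<or> FOp (fst c) (snd c) y"
    if "(c, d) \<in> next" "y \<le> e" "shows_var d y \<or> INp (fst d) (snd d) y \<or> FOp (fst d) (snd d) y" for c d
  proof (cases "(c, d) \<in> links")
    case True
    then have l: "fst c < fst d" "fst d \<le> fst c + e" "snd c \<le> e" "snd d \<le> e" "geq (fst c) (snd c) (fst d) (snd d)"
      by (auto simp: links_def node_def)
    from that(3) consider "geq (fst d) (snd d) (fst d) y" | "INp (fst d) (snd d) y" | "FOp (fst d) (snd d) y"
      by (auto simp: shows_var_def)
    then show ?thesis
    proof cases
      case 1
      then have "geq (fst c) (snd c) (fst d) y"
        using geq_trans[of "fst c" "fst c" "fst d" "fst d" "snd c" "snd d" y] l that(2) by simp
      then show ?thesis using INp_direct[of "fst c" "fst d" "snd c" y] l that(2) by simp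
    next
      case 2
      then show ?thesis using INp_back[of "fst c" "fst d" "snd c" "snd d" y] l that(2) by simp
    next
      case 3
      then show ?thesis using FOp_eq[of "fst c" "fst d" "snd c" "snd d" y] l that(2) by simp
    qed
  next
    case False
    then have "(c, d) \<in> jumps" using that(1) by (simp add: next_def)
    then obtain X where X: "c \<in> dep X" "d \<in> entr X" by (rule jumpsE)
    then have "mem y X" using entrD(4)[of "fst d" "snd d" X y] that(2,3) by (auto simp: shows_var_def)
    then show ?thesis using X(1) that(2) by (cases c) (auto simp: dep_iff)
  qed
  assume "(c, d) \<in> next\<^sup>+" "y \<le> e" "shows_var d y"
  then show ?thesis
    by (induction rule: converse_trancl_induct) (use step in blast)+
qed

lemma value_at_later:
  assumes x: "x \<le> e" and y: "y \<le> e"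
  shows "(\<exists>q>p. value_at p x = value_at q y) \<longleftrightarrow> INp p x y \<or> FOp p x y"
proof -
  let ?c = "(p, rep p x)"
  have n: "node ?c" using node_rep x by auto
  have IN: "INp p x y \<longleftrightarrow> INp p (rep p x) y"
    using INp_back[of p p x "rep p x" y, OF order_refl le_add1 x rep_bound[OF x] le_SucI[OF y] geq_rep[OF x]]
      INp_back[of p p "rep p x" x y, OF order_refl le_add1 rep_bound[OF x] x le_SucI[OF y] rep_geq[OF x]]
    by blast
  have FO: "FOp p x y \<longleftrightarrow> FOp p (rep p x) y"
    by (rule FOp_eq[OF order_refl le_add1 x rep_bound[OF x] y geq_rep[OF x]])
  have "(\<exists>q>p. same ?c (q, rep q y)) \<longleftrightarrow> INp p (rep p x) y \<or> FOp p (rep p x) y"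
  proof
    assume "\<exists>q>p. same ?c (q, rep q y)"
    then obtain q where q: "p < q" "same ?c (q, rep q y)" by blast
    then have "(?c, (q, rep q y)) \<in> next\<^sup>*" using next_rtrancl_le by (fastforce simp: same_def)
    then have "(?c, (q, rep q y)) \<in> next\<^sup>+" using q(1) by (auto simp: rtrancl_eq_or_trancl)
    from next_future[OF this y shows_var_rep[OF y]] show "INp p (rep p x) y \<or> FOp p (rep p x) y" by simp
  next
    assume "INp p (rep p x) y \<or> FOp p (rep p x) y"
    then have "\<exists>d. (?c, d) \<in> next\<^sup>+ \<and> shows_var d y"
    proof
      assume "INp p (rep p x) y"
      then show ?thesis using IN_seen[OF n y] shows_var_rep[OF y] links_next by blast
    next
      assume F: "FOp p (rep p x) y"
      from FO_end[OF n y F] obtain c' where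
        c': "(?c, c') \<in> links\<^sup>*" "node c'" "leaving e (s (fst c')) (snd c')" by blast
      have "FOp (fst c') (snd c') y" using links_rtrancl_FOp[OF c'(1) y] F by simp
      then obtain X where "0 < X" "X < ntypes e" "c' \<in> dep X" "mem y X"
        using dep_of_FO[OF c'(2,3) y] by blast
      from token_live[OF this] obtain d where "(c', d) \<in> next\<^sup>+" "shows_var d y" by blast
      then show ?thesis using links_next_rtrancl[OF c'(1)] by (meson rtrancl_trancl_trancl)
    qed
    then obtain q z where d: "(?c, (q, z)) \<in> next\<^sup>+" "shows_var (q, z) y" by auto
    have nd: "node (q, z)" using d(1) by (auto elim: tranclE dest: next_nodes)
    then have z: "z \<le> e" by (simp add: node_def)
    have "geq q z q (rep q y)"
      using geq_trans[of q q q q z y "rep q y"] d(2) geq_rep[OF y] rep_bound[OF y] z y by (simp add: shows_var_def)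
    then have "z = rep q y" using node_unique[OF nd node_rep[OF y]] by blast
    then have "same ?c (q, rep q y)" unfolding same_def using trancl_into_rtrancl[OF d(1)] by simp
    moreover have "p < q" using next_trancl_less[OF d(1)] by simp
    ultimately show "\<exists>q>p. same ?c (q, rep q y)" by blast
  qed
  then show ?thesis unfolding value_at_eq using IN FO by simp
qed

end

context run
begin

lemma remote_values:
  "\<exists>v :: nat \<Rightarrow> nat \<Rightarrow> nat.
     (\<forall>p q x y. p \<le> q \<longrightarrow> q \<le> p + e \<longrightarrow> x \<le> e \<longrightarrow> y \<le> e \<longrightarrow> (v p x = v q y \<longleftrightarrow> geq p x q y)) \<and>
     (\<forall>p x y. x \<le> e \<longrightarrow> y \<le> e \<longrightarrow> ((\<exists>q>p. v p x = v q y) \<longleftrightarrow> INp p x y \<or> FOp p x y))"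
proof -
  obtain F r where "\<forall>X. 0 < X \<and> X < ntypes e \<longrightarrow> matching X (F X) (r X)" using matching_exists by blast
  then interpret matched_run e T I s F r by unfold_locales auto
  show ?thesis using value_at_window value_at_later by (intro exI[of _ value_at]) simp
qed

text \<open>Pairs of position and variable are enumerated position by position, \<open>Suc e\<close>
  numbers for each; so the earlier neighbours of a point all lie in the window that ends at its
  position.\<close>

lemma local_values:
  fixes lt :: "'d \<Rightarrow> 'd \<Rightarrow> bool"
  assumes "strict_total_order lt" "dense_rel lt" "open_rel lt"
  shows "\<exists>v. \<forall>p q x y. p \<le> q + e \<longrightarrow> q \<le> p + e \<longrightarrow> x \<le> e \<longrightarrow> y \<le> e \<longrightarrow>
    (gle p x q y \<longleftrightarrow> \<not> lt (v q y) (v p x))"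
proof -
  let ?pos = "\<lambda>i. i div Suc e" and ?var = "\<lambda>i. i mod Suc e"
  let ?near = "\<lambda>i j. ?pos i \<le> ?pos j + e \<and> ?pos j \<le> ?pos i + e"
  let ?le = "\<lambda>i j. gle (?pos i) (?var i) (?pos j) (?var j)"
  have var: "?var i \<le> e" for i by (simp add: less_Suc_eq_le[symmetric])
  have "\<exists>f. \<forall>i j. ?near i j \<longrightarrow> (?le i j \<longleftrightarrow> \<not> lt (f j) (f i))"
  proof (rule order_realisation[OF assms])
    show "?near j k" if "j \<le> i" "k \<le> i" "?near j i" "?near k i" for i j k
      using that div_le_mono[OF that(1), of "Suc e"] div_le_mono[OF that(2), of "Suc e"] by linarith
    show "?le a b \<or> ?le b a" if "?near a b" for a b
      using gle_total that var by blast
    show "?le a c" if "?near a b" "?near b c" "?near a c" "?le a b" "?le b c" for a b c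
      by (rule gle_trans[of "min (?pos a) (min (?pos b) (?pos c))" _ "?pos b" _ _ "?var b"]) (use that var in auto)
  qed auto
  then obtain f where f: "\<And>i j. ?near i j \<Longrightarrow> ?le i j \<longleftrightarrow> \<not> lt (f j) (f i)" by blast
  have pv: "?pos (p * Suc e + x) = p" "?var (p * Suc e + x) = x" if "x \<le> e" for p x
    using that by (simp_all add: div_mult_self3 less_Suc_eq_le del: mult_Suc_right)
  show ?thesis
    using f[of "_ * Suc e + _" "_ * Suc e + _", unfolded pv] pv
    by (intro exI[of _ "\<lambda>p x. f (p * Suc e + x)"]) (metis (no_types, lifting) f)
qed

end

text \<open>The expansion law alone would allow \<open>B\<close> to be postponed forever. Positions
  without an open until formula exclude this, by induction on the distance to the next one.\<close>

lemma until_unique: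
  assumes step: "\<And>t. U t \<longleftrightarrow> B t \<or> A t \<and> U (Suc t)" and live: "\<And>N. \<exists>t\<ge>N. \<not> (U t \<and> \<not> B t)"
  shows "U t \<longleftrightarrow> (\<exists>j\<ge>t. B j \<and> (\<forall>l. t \<le> l \<and> l < j \<longrightarrow> A l))"
proof
  obtain n where "\<not> (U (t + n) \<and> \<not> B (t + n))" using live[of t] le_Suc_ex by blast
  then show "U t \<Longrightarrow> \<exists>j\<ge>t. B j \<and> (\<forall>l. t \<le> l \<and> l < j \<longrightarrow> A l)"
  proof (induction n arbitrary: t)
    case (0 t)
    then show ?case by (intro exI[of _ t]) auto
  next
    case (Suc n)
    show ?case
    proof (cases "B t")
      case False
      then have A: "A t" "U (Suc t)" using step[of t] Suc.prems by auto
      have "\<not> (U (Suc t + n) \<and> \<not> B (Suc t + n))" using Suc.prems by simp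
      from Suc.IH[OF A(2) this] A(1)
      obtain j where j: "j \<ge> Suc t" "B j" "\<forall>l. Suc t \<le> l \<and> l < j \<longrightarrow> A l" "A t" by blast
      have "A l" if "t \<le> l" "l < j" for l using j(3,4) that by (cases "l = t") auto
      then show ?thesis using j by (intro exI[of _ j]) auto
    qed (auto intro!: exI[of _ t])
  qed
next
  assume "\<exists>j\<ge>t. B j \<and> (\<forall>l. t \<le> l \<and> l < j \<longrightarrow> A l)"
  then obtain n where "B (t + n)" "\<forall>l. t \<le> l \<and> l < t + n \<longrightarrow> A l" using le_Suc_ex by blast
  then show "U t"
  proof (induction n arbitrary: t)
    case (0 t)
    then show ?case using step[of t] by simp
  next
    case (Suc n)
    then have "U (Suc t)" "A t" by auto
    then show ?case using step by blast
  qed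
qed

text \<open>The past is finite, so the value at 0 takes the place of a liveness condition.\<close>

lemma since_unique:
  assumes "U 0 \<longleftrightarrow> B 0" and step: "\<And>t. U (Suc t) \<longleftrightarrow> B (Suc t) \<or> A (Suc t) \<and> U t"
  shows "U t \<longleftrightarrow> (\<exists>j\<le>t. B j \<and> (\<forall>l. j < l \<and> l \<le> t \<longrightarrow> A l))"
proof (induction t)
  case (Suc t)
  show ?case
  proof
    assume "U (Suc t)"
    then show "\<exists>j\<le>Suc t. B j \<and> (\<forall>l. j < l \<and> l \<le> Suc t \<longrightarrow> A l)"
      using step[of t] Suc by (auto simp: le_Suc_eq)
  next
    assume "\<exists>j\<le>Suc t. B j \<and> (\<forall>l. j < l \<and> l \<le> Suc t \<longrightarrow> A l)"
    then show "U (Suc t)" using step[of t] Suc by (auto simp: le_Suc_eq)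
  qed
qed (use assms in auto)

lemma pr_leD: "pr a b \<le> e \<Longrightarrow> a \<le> e \<and> b \<le> e"
  using le_prod_encode_1[of a b] le_prod_encode_2[of b a] by simp

context run
begin

lemma okT_s: "okT e (s t)" and stT_s: "stT e (s t) (s (Suc t))"
  using ok[of t] stp[of t] unfolding ok_def stp_def by blast+

lemma satisfiable_of_run:
  fixes lt :: "'d \<Rightarrow> 'd \<Rightarrow> bool"
  assumes sto: "strict_total_order lt" and "dense_rel lt" "open_rel lt" and inf: "infinite (UNIV :: 'd set)"
    and init: "iniT e (s 0)" and live: "\<And>c N. c \<le> e \<Longrightarrow> \<exists>t\<ge>N. \<not> until_open e (s t) c"
    and e: "e = enc \<phi>"
  shows "satisfiable lt \<phi>"
proof -
  obtain v :: "nat \<Rightarrow> nat \<Rightarrow> nat" where v: "\<And>p q x y. p \<le> q \<Longrightarrow> q \<le> p + e \<Longrightarrow> x \<le> e \<Longrightarrow> y \<le> e \<Longrightarrow> v p x = v q y \<longleftrightarrow> geq p x q y"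
    "\<And>p x y. x \<le> e \<Longrightarrow> y \<le> e \<Longrightarrow> (\<exists>q>p. v p x = v q y) \<longleftrightarrow> INp p x y \<or> FOp p x y"
    using remote_values by blast
  obtain w where w: "\<And>p q x y. p \<le> q + e \<Longrightarrow> q \<le> p + e \<Longrightarrow> x \<le> e \<Longrightarrow> y \<le> e \<Longrightarrow> gle p x q y \<longleftrightarrow> \<not> lt (w q y) (w p x)"
    using local_values[OF assms(1-3)] by blast
  \<comment> \<open>Remote values are compared only for equality, so any injection into the infinite
    domain serves, whatever the order.\<close>
  obtain \<iota> :: "nat \<Rightarrow> 'd" where \<iota>: "inj \<iota>" using infinite_countable_subset[OF inf] by blast
  define \<sigma> where "\<sigma> p z = (case z of Loc x \<Rightarrow> w p x | Rem x \<Rightarrow> \<iota> (v p x))" for p z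
  have "holds lt \<sigma> t \<psi> \<longleftrightarrow> TT (s t) (enc \<psi>)" if "enc \<psi> \<le> e" for \<psi> t
    using that
  proof (induction \<psi> arbitrary: t)
    case (EqL x i y)
    then have b: "x \<le> e" "i \<le> e" "y \<le> e"
      by (auto dest!: pr_leD)
    have "\<sigma> t (Loc x) = \<sigma> (t + i) (Loc y) \<longleftrightarrow> gle t x (t + i) y \<and> gle (t + i) y t x"
      using w[of t "t + i" x y] w[of "t + i" t y x] b sto_total[OF sto] sto_irrefl[OF sto] by (auto simp: \<sigma>_def)
    moreover have "TT (s t) (enc (EqL x i y)) \<longleftrightarrow> LE (s t) 0 x i y \<and> LE (s t) i y 0 x"
      using okT_s[of t] b EqL unfolding okT_def by simp
    ultimately show ?case using gle_LE[of 0 i x y t] gle_LE[of i 0 y x t] b by simp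
  next
    case (LtL x i y)
    then have b: "x \<le> e" "i \<le> e" "y \<le> e"
      by (auto dest!: pr_leD)
    have "lt (\<sigma> t (Loc x)) (\<sigma> (t + i) (Loc y)) \<longleftrightarrow> \<not> gle (t + i) y t x"
      using w[of "t + i" t y x] b by (simp add: \<sigma>_def)
    moreover have "TT (s t) (enc (LtL x i y)) \<longleftrightarrow> \<not> LE (s t) i y 0 x"
      using okT_s[of t] b LtL unfolding okT_def by simp
    ultimately show ?case using gle_LE[of i 0 y x t] b by simp
  next
    case (EqR x i y)
    then have b: "x \<le> e" "i \<le> e" "y \<le> e"
      by (auto dest!: pr_leD)
    have "\<sigma> t (Rem x) = \<sigma> (t + i) (Rem y) \<longleftrightarrow> geq t x (t + i) y"
      using v(1)[of t "t + i" x y] b inj_eq[OF \<iota>] by (simp add: \<sigma>_def)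
    moreover have "TT (s t) (enc (EqR x i y)) \<longleftrightarrow> EQ (s t) 0 x i y"
      using okT_s[of t] b EqR unfolding okT_def by simp
    ultimately show ?case using geq_EQ[of 0 i x y t] b by simp
  next
    case (EqXF x y)
    then have b: "x \<le> e" "y \<le> e"
      by (auto dest!: pr_leD)
    have "(\<exists>j>t. \<sigma> t (Rem x) = \<sigma> j (Rem y)) \<longleftrightarrow> INp t x y \<or> FOp t x y"
      using v(2)[of x y t] b inj_eq[OF \<iota>] by (simp add: \<sigma>_def)
    moreover have "TT (s t) (enc (EqXF x y)) \<longleftrightarrow> INp t x y \<or> FOp t x y"
      using okT_s[of t] b EqXF unfolding okT_def by simp
    ultimately show ?case by simp
  next
    case (And \<phi> \<psi>)
    then have b: "enc \<phi> \<le> e" "enc \<psi> \<le> e"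
      by (auto dest!: pr_leD)
    then show ?case using okT_s[of t] And unfolding okT_def by simp
  next
    case (Neg \<phi>)
    then have "enc \<phi> \<le> e" by (auto dest!: pr_leD)
    then show ?case using okT_s[of t] Neg unfolding okT_def by simp
  next
    case (Next \<phi>)
    then have "enc \<phi> \<le> e" by (auto dest!: pr_leD)
    then show ?case using stT_s[of t] Next unfolding stT_def by simp
  next
    case (Until \<phi> \<psi>)
    let ?c = "pr 7 (pr (enc \<phi>) (enc \<psi>))"
    have b: "enc \<phi> \<le> e" "enc \<psi> \<le> e" "?c \<le> e"
      using Until.prems by (auto dest!: pr_leD)
    have "TT (s t) ?c \<longleftrightarrow> (\<exists>j\<ge>t. TT (s j) (enc \<psi>) \<and> (\<forall>l. t \<le> l \<and> l < j \<longrightarrow> TT (s l) (enc \<phi>)))"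
    proof (rule until_unique)
      show "TT (s t) ?c \<longleftrightarrow> TT (s t) (enc \<psi>) \<or> TT (s t) (enc \<phi>) \<and> TT (s (Suc t)) ?c" for t
        using stT_s[of t] b unfolding stT_def by simp
      show "\<exists>t\<ge>N. \<not> (TT (s t) ?c \<and> \<not> TT (s t) (enc \<psi>))" for N
        using live[OF b(3), of N] b unfolding until_open_def by blast
    qed
    then show ?case using Until.IH b by simp
  next
    case (Prev \<phi>)
    then have "enc \<phi> \<le> e" by (auto dest!: pr_leD)
    then show ?case
      using init stT_s[of "t - 1"] Prev unfolding stT_def iniT_def by (cases t) auto
  next
    case (Since \<phi> \<psi>)
    let ?c = "pr 9 (pr (enc \<phi>) (enc \<psi>))"
    have b: "enc \<phi> \<le> e" "enc \<psi> \<le> e" "?c \<le> e"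
      using Since.prems by (auto dest!: pr_leD)
    have "TT (s t) ?c \<longleftrightarrow> (\<exists>j\<le>t. TT (s j) (enc \<psi>) \<and> (\<forall>l. j < l \<and> l \<le> t \<longrightarrow> TT (s l) (enc \<phi>)))"
    proof (rule since_unique)
      show "TT (s 0) ?c \<longleftrightarrow> TT (s 0) (enc \<psi>)" using init b unfolding iniT_def by simp
      show "TT (s (Suc t)) ?c \<longleftrightarrow> TT (s (Suc t)) (enc \<psi>) \<or> TT (s (Suc t)) (enc \<phi>) \<and> TT (s t) ?c" for t
        using stT_s[of t] b unfolding stT_def by simp
    qed
    then show ?case using Since.IH b by simp
  qed
  from this[of \<phi> 0] have "holds lt \<sigma> 0 \<phi>" using init e by (simp add: iniT_def)
  then show ?thesis unfolding satisfiable_def by blast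
qed

end

section \<open>Decidability\<close>

lemma pend_stepD:
  assumes "pend_step e s s' P P'"
  shows "c \<le> e \<Longrightarrow> mem (pr 0 c) P \<Longrightarrow> until_open e s c \<Longrightarrow> mem (pr 0 c) P'"
    and "X < ntypes e \<Longrightarrow> y \<le> e \<Longrightarrow> mem (pr 1 (pr X y)) P \<Longrightarrow> \<not> (\<exists>x\<le>e. good e s' X y x) \<Longrightarrow>
      mem (pr 1 (pr X y)) P'"
    and "m < e \<Longrightarrow> x \<le> e \<Longrightarrow> z \<le> Suc e \<Longrightarrow> mem (pr 2 (pr (Suc m) (pr x z))) P \<Longrightarrow>
      mem (pr 2 (pr m (pr x z))) P'"
    and "x \<le> e \<Longrightarrow> z \<le> Suc e \<Longrightarrow> mem (pr 2 (pr 0 (pr x z))) P \<Longrightarrow>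
      \<not> (z \<le> e \<and> (\<exists>n<e. EQ s 0 x (Suc n) z)) \<Longrightarrow> n < e \<Longrightarrow> v \<le> e \<Longrightarrow> EQ s 0 x (Suc n) v \<Longrightarrow>
      mem (pr 2 (pr n (pr v z))) P'"
  using assms[unfolded pend_step_def, THEN conjunct1, rule_format, of c]
    assms[unfolded pend_step_def, THEN conjunct2, THEN conjunct1, rule_format, of X y]
    assms[unfolded pend_step_def, THEN conjunct2, THEN conjunct2, THEN conjunct1, rule_format, of m x z]
    assms[unfolded pend_step_def, THEN conjunct2, THEN conjunct2, THEN conjunct2, rule_format, of x z n v]
  by blast+

section \<open>Unrolling a lasso into an infinite run\<close>

locale lasso =
  fixes e I n1 n2 :: nat and w P :: "nat \<Rightarrow> nat"
  assumes less: "n1 < n2" and loop: "w n2 = w n1" and end_pending: "P n2 = 0"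
    and w_ok: "t \<le> n2 \<Longrightarrow> ok e (w t)" and w_stp: "t < n2 \<Longrightarrow> stp e (w t) (w (Suc t))"
    and w_quiet: "n1 \<le> t \<Longrightarrow> t < n2 \<Longrightarrow> quiet e (w t) (w (Suc t)) I"
    and w_pend: "n1 \<le> t \<Longrightarrow> t < n2 \<Longrightarrow> pend_step e (w t) (w (Suc t)) (P t) (P (Suc t))"
    and w_pend0: "pend0 e (w n1) I (P n1)"
    and w_tokens: "0 < X \<Longrightarrow> X < ntypes e \<Longrightarrow> \<not> mem X I \<Longrightarrow> tokens e w n1 X = 0"
begin

definition "per = n2 - n1"
definition "s t = (if t < n1 then w t else w (n1 + (t - n1) mod per))"

lemma per: "0 < per" "n1 + per = n2"
  using less by (auto simp: per_def)

lemma s_loop: "r \<le> per \<Longrightarrow> s (n1 + k * per + r) = w (n1 + r)"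
proof (cases "r = per")
  case True
  have "(k * per + per) mod per = 0" by (metis mod_mult_self2_is_0 mult.commute mult_Suc add.commute)
  then show ?thesis using True per loop by (simp add: s_def)
next
  case False
  assume "r \<le> per"
  then have "(k * per + r) mod per = r" using False by simp
  then show ?thesis by (simp add: s_def)
qed

lemma s_prefix: "t \<le> n1 \<Longrightarrow> s t = w t"
  by (auto simp: s_def)

lemma s_step: "\<exists>t'<n2. s t = w t' \<and> s (Suc t) = w (Suc t') \<and> (n1 \<le> t \<longrightarrow> n1 \<le> t')"
proof (cases "t < n1")
  case True
  then show ?thesis using less s_prefix[of t] s_prefix[of "Suc t"] by (intro exI[of _ t]) auto
next
  case False
  define k r where "k = (t - n1) div per" and "r = (t - n1) mod per"
  have t: "t = n1 + k * per + r" using False div_mult_mod_eq[of "t - n1" per] unfolding k_def r_def by linarith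
  have r: "r < per" using per by (simp add: r_def)
  have "s t = w (n1 + r)" "s (Suc t) = w (n1 + Suc r)"
    using s_loop[of r k] s_loop[of "Suc r" k] r t by simp_all
  then show ?thesis using r per(2) by (intro exI[of _ "n1 + r"]) auto
qed

lemma s_ok: "ok e (s t)"
  using s_step[of t] w_ok by (metis less_imp_le)

lemma s_stp: "stp e (s t) (s (Suc t))"
  using s_step[of t] w_stp by metis

text \<open>An obligation that is absent at the end is dropped by some step of the loop; for until
  formulas and labels \<open>pend_step\<close> allows this only where it is met.\<close>

lemma discharge:
  assumes "mem z (P n1)"
  obtains r where "r < per" "mem z (P (n1 + r))" "\<not> mem z (P (n1 + Suc r))"
proof -
  have "\<exists>r<per. mem z (P (n1 + r)) \<and> \<not> mem z (P (n1 + Suc r))"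
  proof (rule ccontr)
    assume n: "\<not> ?thesis"
    have "r \<le> per \<Longrightarrow> mem z (P (n1 + r))" for r
      by (induction r) (use n assms in auto)
    from this[of per] show False using per(2) end_pending by simp
  qed
  then show ?thesis using that by blast
qed

lemma s_until: "c \<le> e \<Longrightarrow> \<exists>t\<ge>N. \<not> until_open e (s t) c"
proof -
  assume c: "c \<le> e"
  then have "mem (pr 0 c) (P n1)" using w_pend0 by (simp add: pend0_def)
  then obtain r where r: "r < per" "mem (pr 0 c) (P (n1 + r))" "\<not> mem (pr 0 c) (P (n1 + Suc r))" by (rule discharge)
  then have "\<not> until_open e (w (n1 + r)) c"
    using pend_stepD(1)[OF w_pend[of "n1 + r"], of c] per(2) c by auto
  then have "\<not> until_open e (s (n1 + N * per + r)) c" using s_loop[of r N] r by simp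
  moreover have "N \<le> n1 + N * per + r" using per(1) by (simp add: trans_le_add1 trans_le_add2)
  ultimately show ?thesis by blast
qed

lemma s_good:
  assumes "X < ntypes e" "mem X I" "y \<le> e" "mem y X"
  shows "\<exists>t\<ge>N. \<exists>x\<le>e. good e (s (Suc t)) X y x"
proof -
  have "mem (pr 1 (pr X y)) (P n1)" using w_pend0 assms unfolding pend0_def by blast
  then obtain r where r: "r < per" "mem (pr 1 (pr X y)) (P (n1 + r))" "\<not> mem (pr 1 (pr X y)) (P (n1 + Suc r))"
    by (rule discharge)
  have "pend_step e (w (n1 + r)) (w (n1 + Suc r)) (P (n1 + r)) (P (n1 + Suc r))"
    using w_pend[of "n1 + r"] per(2) r(1) by simp
  then have "\<exists>x\<le>e. good e (w (n1 + Suc r)) X y x"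
    using pend_stepD(2)[of e _ _ _ _ X y] r(2,3) assms by blast
  then have "\<exists>x\<le>e. good e (s (Suc (n1 + N * per + r))) X y x" using s_loop[of "Suc r" N] r by simp
  moreover have "N \<le> n1 + N * per + r" using per(1) by (simp add: trans_le_add1 trans_le_add2)
  ultimately show ?thesis by blast
qed

text \<open>An occurrence obligation changes its code from step to step, so \<open>discharge\<close>
  does not apply. The derivation is built by induction on the distance to the end of the loop, where
  nothing is pending.\<close>

lemma pending_resolved:
  assumes "r \<le> per" "m \<le> e" "x \<le> e" "y \<le> Suc e" "mem (pr 2 (pr m (pr x y))) (P (n1 + r))"
  shows "resolved e s (n1 + k * per + r + m) x y"
  using assms
proof (induction "per - r" arbitrary: r m x y)
  case 0
  then have "P (n1 + r) = 0" using per(2) end_pending by simp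
  then show ?case using 0 by simp
next
  case (Suc d)
  then have r: "r < per" "Suc r \<le> per" "d = per - Suc r" by auto
  let ?p = "n1 + k * per + r"
  have ps: "pend_step e (w (n1 + r)) (w (Suc (n1 + r))) (P (n1 + r)) (P (Suc (n1 + r)))"
    using w_pend[of "n1 + r"] r per(2) by simp
  have sp: "s ?p = w (n1 + r)" using s_loop[of r k] r by simp
  have IH: "resolved e s (?p + Suc m) x y"
    if "m \<le> e" "x \<le> e" "y \<le> Suc e" "mem (pr 2 (pr m (pr x y))) (P (Suc (n1 + r)))" for m x y
    using Suc.hyps(1)[OF r(3,2) that(1-3)] that(4) by simp
  show ?case
  proof (cases m)
    case (Suc m')
    then have "mem (pr 2 (pr m' (pr x y))) (P (Suc (n1 + r)))"
      using pend_stepD(3)[OF ps, of m' x y] Suc.prems by auto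
    then show ?thesis using IH[of m' x y] Suc Suc.prems by simp
  next
    case 0
    show ?thesis
    proof (cases "leaving e (s ?p) x")
      case True
      then show ?thesis using 0 by (auto intro: resolved.leaves)
    next
      case False
      then obtain n z where n: "n < e" "z \<le> e" "EQ (s ?p) 0 x (Suc n) z" by (auto simp: leaving_def)
      show ?thesis
      proof (cases "y \<le> e \<and> (\<exists>n<e. EQ (s ?p) 0 x (Suc n) y)")
        case True
        then show ?thesis using 0 by (auto intro: resolved.seen)
      next
        case nf: False
        have "mem (pr 2 (pr n (pr z y))) (P (Suc (n1 + r)))"
          using pend_stepD(4)[OF ps, of x y n z] Suc.prems 0 n nf unfolding sp by simp
        then have "resolved e s (?p + Suc n) z y" using IH[of n z y] n Suc.prems by simp
        then show ?thesis using n 0 by (auto intro: resolved.moves)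
      qed
    qed
  qed
qed

lemma s_resolves:
  assumes "m \<le> e" "x \<le> e" "y \<le> Suc e" "IN (s t) m x y"
  shows "resolved e s (t + m) x y"
proof -
  \<comment> \<open>A loop start not before \<open>t\<close>, since \<open>per\<close> is positive.
    There \<open>pend0\<close> has turned all promises into obligations; from an earlier position
    the promise is followed until it gets there or is resolved.\<close>
  define N where "N = n1 + t * per"
  have tN: "t \<le> N" using per(1) by (simp add: N_def trans_le_add2)
  show ?thesis
    using tN assms
  proof (induction "N - t" arbitrary: t m x y)
    case 0
    then have "IN (w n1) m x y" using s_loop[of 0] by (simp add: N_def)
    then have "mem (pr 2 (pr m (pr x y))) (P n1)" using w_pend0 0 unfolding pend0_def by blast
    then show ?case using pending_resolved[of 0 m x y] 0 by (simp add: N_def)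
  next
    case (Suc d t)
    have IH: "resolved e s (Suc t + m) x y" if "m \<le> e" "x \<le> e" "y \<le> Suc e" "IN (s (Suc t)) m x y" for m x y
      using Suc.hyps(1)[of "Suc t" m x y] Suc.hyps(2) that by simp
    have sh: "IN (s t) (Suc m) x y \<longleftrightarrow> IN (s (Suc t)) m x y" if "m < e" "x \<le> e" "y \<le> Suc e" for m x y
      using s_stp[of t] that unfolding stp_def shifted_def by blast
    show ?case
    proof (cases m)
      case (Suc m')
      then show ?thesis using IH[of m' x y] sh[of m' x y] Suc.prems by simp
    next
      case 0
      show ?thesis
      proof (cases "leaving e (s t) x")
        case True
        then show ?thesis using 0 by (auto intro: resolved.leaves)
      next
        case False
        then obtain n z where n: "n < e" "z \<le> e" "EQ (s t) 0 x (Suc n) z" by (auto simp: leaving_def)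
        have "okI e (s t)" using s_ok by (simp add: ok_def)
        then have "IN (s t) (Suc n) z y \<or> y \<le> e \<and> (\<exists>k\<le>Suc n. 0 < k \<and> EQ (s t) 0 x k y)"
          using n Suc.prems 0 unfolding okI_def by (metis Suc_leI le0)
        then show ?thesis
        proof
          assume "IN (s t) (Suc n) z y"
          then have "resolved e s (t + Suc n) z y" using IH[of n z y] sh[of n z y] n Suc.prems by simp
          then show ?thesis using n 0 by (auto intro: resolved.moves)
        next
          assume "y \<le> e \<and> (\<exists>k\<le>Suc n. 0 < k \<and> EQ (s t) 0 x k y)"
          then obtain k where k: "y \<le> e" "k \<le> Suc n" "0 < k" "EQ (s t) 0 x k y" by blast
          then obtain k' where "k = Suc k'" by (cases k) auto
          then show ?thesis using k n(1) 0 by (auto intro: resolved.seen[of y e k'])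
        qed
      qed
    qed
  qed
qed

lemma s_tokens: "t \<le> n1 \<Longrightarrow> tokens e s t X = tokens e w t X"
  by (induction t) (auto simp: s_prefix)

sublocale run e n1 I s
proof
  show "quiet e (s t) (s (Suc t)) I" if "n1 \<le> t" for t
    using s_step[of t] w_quiet that by metis
qed (use s_ok s_stp s_tokens w_tokens s_good s_resolves in auto)

end

lemma satisfiable_of_reach:
  fixes lt :: "'d \<Rightarrow> 'd \<Rightarrow> bool"
  assumes lt: "strict_total_order lt" "dense_rel lt" "open_rel lt" "infinite (UNIV :: 'd set)"
    and e: "e = enc \<phi>" and q: "q_init e q" "sys.reach e q (\<lambda>_. 0)"
  shows "satisfiable lt \<phi>"
proof -
  obtain n qs Ms where p: "qs 0 = q" "Ms 0 = (\<lambda>_. 0)" "sys.is_path e n qs Ms"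
    using sys.reach_path[OF q(2)] by blast
  have q_steps: "q_step e (qs t) (Ms t) (qs (Suc t))" if "t < n" for t
    using p(3) that by (simp add: sys.is_path_def)
  have Ms: "Ms (Suc t) X = Ms t X + ndep e (qst (qs t)) X - nsup e (qst (qs (Suc t))) X"
    if "t < n" "X < ntypes e" for t X
    using p(3) that by (simp add: sys.is_path_def)
  have tgt: "qph (qs n) = 1" "qst (qs n) = qstar (qs n)" "qP (qs n) = 0"
    using p(3) by (auto simp: sys.is_path_def q_target_def)
  have ph0: "qph (qs 0) = 0" using q p by (simp add: q_init_def)
  have "\<exists>n1<n. qph (qs n1) = 0 \<and> qph (qs (Suc n1)) \<noteq> 0 \<and> (\<forall>t\<le>n1. qph (qs t) = 0)"
  proof (rule ccontr)
    assume no: "\<not> ?thesis"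
    have "\<forall>t\<le>m. qph (qs t) = 0" if "m \<le> n" for m
      using that
    proof (induction m)
      case (Suc m)
      then have z: "\<forall>t\<le>m. qph (qs t) = 0" by simp
      then have "qph (qs (Suc m)) = 0" using no Suc.prems by (metis Suc_le_eq order_refl)
      then show ?case using z by (auto simp: le_Suc_eq)
    qed (use ph0 in simp)
    from this[of n] have "qph (qs n) = 0" by blast
    then show False using tgt(1) by simp
  qed
  then obtain n1 where n1: "n1 < n" "qph (qs (Suc n1)) \<noteq> 0" "\<And>t. t \<le> n1 \<Longrightarrow> qph (qs t) = 0" by blast
  define I where "I = qI (qs (Suc n1))"
  have jump: "qph (qs (Suc n1)) = 1" "qst (qs (Suc n1)) = qst (qs n1)" "qstar (qs (Suc n1)) = qst (qs n1)"
    "\<And>X. X < ntypes e \<Longrightarrow> 0 < X \<Longrightarrow> \<not> mem X I \<Longrightarrow> Ms n1 X = 0"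
    "pend0 e (qst (qs (Suc n1))) I (qP (qs (Suc n1)))"
    using q_steps[OF n1(1)] n1(2) n1(3)[of n1] by (auto simp: q_step_def I_def)
  have phase1: "qph (qs (Suc t)) = 1 \<and> qstar (qs (Suc t)) = qst (qs n1) \<and> qI (qs (Suc t)) = I"
    if "n1 \<le> t" "t < n" for t
    using that
  proof (induction t rule: dec_induct)
    case base
    then show ?case using jump by (simp add: I_def)
  next
    case (step t)
    then show ?case using q_steps[of "Suc t"] by (auto simp: q_step_def)
  qed
  define n2 where "n2 = n - 1"
  \<comment> \<open>The path repeats its state at the phase switch; \<open>w\<close> removes the
    repetition, so from \<open>n1\<close> on the path index is one ahead.\<close>
  define w where "w t = (if t \<le> n1 then qst (qs t) else qst (qs (Suc t)))" for t
  define P where "P t = qP (qs (Suc t))" for t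
  have w1: "w t = qst (qs (Suc t))" if "n1 \<le> t" for t
    using that jump(2) by (auto simp: w_def le_less)
  \<comment> \<open>\<open>pend0\<close> puts \<open>pr 0 c\<close> into the pending set for every
    \<open>c\<close> up to \<open>e\<close>, in particular for 0. So this set is not empty on
    entering the loop, and the loop has at least one step.\<close>
  have "Suc n1 \<noteq> n"
  proof
    assume "Suc n1 = n"
    then show False using jump(5) tgt(3) by (auto simp: pend0_def)
  qed
  then have less: "n1 < n2" and n2: "Suc n2 = n" using n1(1) by (auto simp: n2_def)
  have step1: "stp e (w t) (w (Suc t)) \<and> quiet e (w t) (w (Suc t)) I \<and> pend_step e (w t) (w (Suc t)) (P t) (P (Suc t))"
    if "n1 \<le> t" "t < n2" for t
    using q_steps[of "Suc t"] phase1[of t] that n2 w1[of t] w1[of "Suc t"] by (auto simp: q_step_def P_def)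
  have tok: "t \<le> n1 \<Longrightarrow> X < ntypes e \<Longrightarrow> Ms t X = tokens e w t X" for t X
  proof (induction t)
    case (Suc t)
    then show ?case using Ms[of t X] n1(1) by (simp add: w_def)
  qed (simp add: p)
  interpret lasso e I n1 n2 w P
  proof
    show "w n2 = w n1" using w1[of n2] w1[of n1] phase1[of n2] tgt(2) less n2 jump(2) by auto
    show "P n2 = 0" using tgt(3) n2 by (simp add: P_def)
    show "ok e (w t)" if "t \<le> n2" for t
    proof -
      have "ok e (qst (qs u))" if "u \<le> n" for u
        using q p q_steps[of "u - 1"] that by (cases u) (auto simp: q_init_def q_step_def)
      then show ?thesis using that n2 n1(1) by (auto simp: w_def)
    qed
    show "stp e (w t) (w (Suc t))" if "t < n2" for t
    proof (cases "t < n1")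
      case True
      then show ?thesis using q_steps[of t] n1 by (auto simp: q_step_def w_def)
    qed (use step1 that in simp)
    show "pend0 e (w n1) I (P n1)" using jump(5) w1[of n1] by (simp add: P_def)
    show "tokens e w n1 X = 0" if "0 < X" "X < ntypes e" "\<not> mem X I" for X
      using tok[of n1 X] jump(4) that by simp
  qed (use less step1 in auto)
  have "iniT e (s 0)" using q p by (simp add: s_prefix w_def q_init_def)
  then show ?thesis using satisfiable_of_run[OF lt _ s_until e] by blast
qed

lemma satisfiable_iff_reach:
  fixes lt :: "'d \<Rightarrow> 'd \<Rightarrow> bool"
  assumes "infinite (UNIV :: 'd set)" "strict_total_order lt" "dense_rel lt" "open_rel lt"
  shows "satisfiable lt \<phi> \<longleftrightarrow> (\<exists>q<nctrl (enc \<phi>). q_init (enc \<phi>) q \<and> sys.reach (enc \<phi>) q (\<lambda>_. 0))"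
proof
  assume "satisfiable lt \<phi>"
  then obtain \<sigma> where \<sigma>: "holds lt \<sigma> 0 (dec (enc \<phi>))" by (auto simp: satisfiable_def dec_enc)
  interpret model lt \<sigma> "enc \<phi>" by unfold_locales (rule assms)
  show "\<exists>q<nctrl (enc \<phi>). q_init (enc \<phi>) q \<and> sys.reach (enc \<phi>) q (\<lambda>_. 0)"
    by (rule reach_of_model[OF \<sigma>])
qed (use satisfiable_of_reach assms in blast)

theorem theorem2p2p9:
  fixes lt :: "'d \<Rightarrow> 'd \<Rightarrow> bool"
  assumes "infinite (UNIV :: 'd set)"
    and "strict_total_order lt"
    and "dense_rel lt"
    and "open_rel lt"
  shows "decidable_form (satisfiable lt)
         \<and> decidable_form (satisfiable ((<) :: real \<Rightarrow> real \<Rightarrow> bool))"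
proof
  show "decidable_form (satisfiable lt)"
    by (rule decidable_reach) (rule satisfiable_iff_reach[OF assms])
  have "strict_total_order ((<) :: real \<Rightarrow> real \<Rightarrow> bool)" by (auto simp: strict_total_order_def)
  moreover have "dense_rel ((<) :: real \<Rightarrow> real \<Rightarrow> bool)" unfolding dense_rel_def using dense by blast
  moreover have "open_rel ((<) :: real \<Rightarrow> real \<Rightarrow> bool)" unfolding open_rel_def using lt_ex gt_ex by blast
  ultimately show "decidable_form (satisfiable ((<) :: real \<Rightarrow> real \<Rightarrow> bool))"
    by (intro decidable_reach satisfiable_iff_reach infinite_UNIV_char_0)
qed

end
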